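(* Let $X(n)$ be a Rademacher or a Steinhaus random multiplicative function and define the random trigonometric polynomials $P_N(\theta)=\frac{1}{\sqrt{N}}\sum_{n=1}^N X(n)e(n\theta)$. Then almost surely, for every rectangle $E\subset\mathbb{C}$, $$\lim_{N\to\infty}\mathrm{meas}\{\theta\in[0,1]: P_N(\theta)\in E\} = \frac{1}{\pi}\int_E e^{-x^2-y^2}\,dx\,dy,$$ where $\mathrm{meas}$ denotes Lebesgue measure on $[0,1]$.
   Context: $e(x)=e^{2\pi i x}$. A Rademacher random multiplicative function: for each prime $p$, $X(p)$ are independent random variables taking values $\pm1$ with probability $1/2$ each, and for $n=p_1^{e_1}\cdots p_r^{e_r}$, $X(n)=X(p_1)^{e_1}\cdots X(p_r)^{e_r}$ (completely multiplicative, not restricted to squarefree $n$). A Steinhaus random multiplicative function is defined the same way except the $X(p)$ are independent and uniformly distributed on the complex unit circle. "Almost surely" refers to the probability space on which $X$ is defined. *)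

theory Defs
  imports "HOL-Probability.Probability" "HOL-Computational_Algebra.Primes"
begin

definition e_exp :: "real \<Rightarrow> complex" where
  "e_exp x = exp (2 * of_real pi * \<i> * of_real x)"

(* The value X 0 is left unconstrained and plays no role. *)
locale random_multiplicative = prob_space M for M :: "'a measure" +
  fixes X :: "nat \<Rightarrow> 'a \<Rightarrow> complex"
  assumes indep_primes: "indep_vars (\<lambda>_. borel) X {p. prime p}"
    and multiplicative: "\<And>n \<omega>. n \<ge> 1 \<Longrightarrow> \<omega> \<in> space M \<Longrightarrow>
      X n \<omega> = (\<Prod>p\<in>prime_factors n. X p \<omega> ^ multiplicity p n)"

locale rademacher_multiplicative = random_multiplicative +
  assumes prob_pos: "\<And>p. prime p \<Longrightarrow> prob {\<omega> \<in> space M. X p \<omega> = 1} = 1 / 2"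
    and prob_neg: "\<And>p. prime p \<Longrightarrow> prob {\<omega> \<in> space M. X p \<omega> = - 1} = 1 / 2"

definition uniform_circle :: "complex measure" where
  "uniform_circle = distr (uniform_measure lborel {0..1}) borel e_exp"

locale steinhaus_multiplicative = random_multiplicative +
  assumes distr_prime: "\<And>p. prime p \<Longrightarrow> distr M borel (X p) = uniform_circle"

definition trig_poly :: "(nat \<Rightarrow> complex) \<Rightarrow> nat \<Rightarrow> real \<Rightarrow> complex" where
  "trig_poly x N \<theta> = 1 / of_real (sqrt (real N)) * (\<Sum>n=1..N. x n * e_exp (real n * \<theta>))"

(* A rectangle need not have its sides parallel to the axes, and each of its edges may or may
   not belong to it: it is a rotation about 0 (multiplication by c) of a product I x J of two
   bounded intervals, each of which may be open, closed or half-open.  Translations are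
   absorbed by I and J. *)
definition rectangle :: "complex set \<Rightarrow> bool" where
  "rectangle E \<longleftrightarrow> (\<exists>(c::complex) (I::real set) (J::real set).
     norm c = 1 \<and> is_interval I \<and> bounded I \<and> is_interval J \<and> bounded J \<and>
     E = {c * Complex x y |x y. x \<in> I \<and> y \<in> J})"

end

theory Submission
  imports Defs "HOL-Computational_Algebra.Nth_Powers"
begin

text \<open>Only two properties of the values at the primes matter: they are independent, and each is a
  unimodular variable with a law invariant under negation. Group the integers \<open>n \<le> N\<close> by their largest
  prime factor \<open>p\<close>, discarding those with \<open>p \<le> N\<^bsup>\<delta>\<^esup>\<close> or \<open>p\<^sup>2\<close> dividing \<open>n\<close>; by Parseval the discarded part
  is small in \<open>L\<^sup>2(d\<theta>)\<close>, whatever the coefficients are. For fixed \<open>\<theta>\<close> the remaining polynomial is a sum over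
  \<open>p\<close> of increments that change sign when \<open>X p\<close> does and depend otherwise only on smaller primes, so that
  McLeish's form of the martingale central limit theorem applies. Its quadratic variation is nearly constant in
  \<open>L\<^sup>2(d\<theta>)\<close>, because the squared increments have frequencies divisible by \<open>p\<close>, a nonzero integer up to \<open>2 N\<close> has
  a bounded number of such prime divisors, and the fourth moments are controlled by the number of quadruples
  whose product is a square. Using this at two independent points \<open>\<theta>\<close>, \<open>\<theta>'\<close> bounds the variance of the
  empirical characteristic function by a power of \<open>N\<close>; Borel-Cantelli along \<open>N = j\<^bsup>A\<^esup>\<close> and Parseval
  between consecutive powers give almost sure convergence to the characteristic function of the complex Gaussian.\<close>

section \<open>The martingale central limit theorem with flips\<close>

text \<open>For fixed \<delta> the discarded part does not vanish: the proportion of integers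
  without a prime factor above N^\<delta> is bounded here only by a multiple of \<delta>. Hence the
  limit is double. With N = j^A the cut is at j^5, so \<delta> = 5 / A, and the error splits into a
  part that vanishes as j grows and a part that vanishes only as A grows. The exponent 5 is a
  balance. The count of square quadruples loses a factor N^(1/A) = j, the sum of 1 / p^2 over p >
  j^5 gains j^(-5), so the fourth moments add up to O(j^(-4)). Measuring the deviation of the
  quadratic variation at scale j^(-2) then gives a variance O(j^(-2)), which is summable. Working
  with sign flips alone treats both models at once. The price is that fourth moments see all
  quadruples with square product, not only a b = c d, which costs an arbitrarily small power. A
  single \<theta> may be exceptional, so the quadratic variation is controlled in mean square over
  \<theta> only, but for every \<omega>: its mean depends on nothing except the moduli of the
  coefficients.\<close>

lemma cos_minus_exp_bound:
  fixes x :: real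
  shows "\<bar>cos x - exp (- (x\<^sup>2 / 2))\<bar> \<le> x ^ 4"
proof -
  obtain s where s: "cos x = (\<Sum>m<4. cos_coeff m * x ^ m) + cos (s + 1/2 * real (4::nat) * pi) / fact 4 * x ^ 4"
    using Maclaurin_cos_expansion[of x 4] by blast
  have s': "(\<Sum>m<4. cos_coeff m * x ^ m) = 1 - x\<^sup>2 / 2"
  proof -
    have "{..<4::nat} = {0, 1, 2, 3}" by auto
    thus ?thesis by (simp add: cos_coeff_def)
  qed
  have "\<bar>cos x - (1 - x\<^sup>2 / 2)\<bar> = \<bar>cos (s + 1/2 * real (4::nat) * pi)\<bar> / 24 * x ^ 4"
    using s s' by (simp add: abs_mult fact_numeral)
  also have "\<dots> \<le> 1 / 24 * x ^ 4"
    by (intro mult_right_mono divide_right_mono) auto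
  finally have 1: "\<bar>cos x - (1 - x\<^sup>2 / 2)\<bar> \<le> 1 / 24 * x ^ 4" .
  define u where "u = x\<^sup>2 / 2"
  have u: "u \<ge> 0" by (simp add: u_def)
  have "exp (-u) \<ge> 1 - u" using exp_ge_add_one_self[of "-u"] by simp
  moreover have "exp (-u) \<le> 1 - u + u\<^sup>2 / 2"
  proof -
    \<comment> \<open>The product equals 1 + u^4 / 4. Thus 1 - u + u^2 / 2 bounds exp (- u) from
      above because 1 + u + u^2 / 2 bounds exp u from below.\<close>
    have "1 \<le> (1 - u + u\<^sup>2 / 2) * (1 + u + u\<^sup>2 / 2)"
      using u by (simp add: field_simps power2_eq_square)
    also have "\<dots> \<le> (1 - u + u\<^sup>2 / 2) * exp u"
    proof (intro mult_left_mono exp_lower_Taylor_quadratic u)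
      have "0 \<le> (1 - u)\<^sup>2 + 1" by simp
      thus "0 \<le> 1 - u + u\<^sup>2 / 2" by (simp add: power2_eq_square field_simps)
    qed
    finally show ?thesis by (simp add: exp_minus field_simps)
  qed
  ultimately have "\<bar>exp (-u) - (1 - u)\<bar> \<le> u\<^sup>2 / 2" by auto
  hence "\<bar>exp (- (x\<^sup>2 / 2)) - (1 - x\<^sup>2 / 2)\<bar> \<le> x ^ 4 / 8"
    by (simp add: u_def power2_eq_square eval_nat_numeral)
  moreover have "0 \<le> x ^ 4" by simp
  ultimately show ?thesis using 1 by linarith
qed

lemma norm_integral_le:
  fixes f :: "'a \<Rightarrow> 'b :: {banach, second_countable_topology}"
  assumes "integrable M g" "\<And>x. x \<in> space M \<Longrightarrow> norm (f x) \<le> g x"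
  shows "norm (integral\<^sup>L M f) \<le> integral\<^sup>L M g"
proof -
  have "norm (integral\<^sup>L M f) \<le> (\<integral>x. norm (f x) \<partial>M)" by (rule integral_norm_bound)
  also have "\<dots> \<le> integral\<^sup>L M g"
    using assms(2) by (intro integral_mono' assms(1)) (auto intro: order.trans[OF norm_ge_zero])
  finally show ?thesis .
qed

text \<open>McLeish's argument: the symmetry under the flips makes \<open>exp (\<i> x)\<close> act as \<open>cos x\<close>, and
  \<open>cos x * exp (x\<^sup>2 / 2) = 1 + O(x ^ 4)\<close>. Setting the increments to zero once the quadratic variation
  exceeds \<open>V + 1\<close> keeps the compensating factors bounded without destroying the symmetry.\<close>

lemma (in prob_space) char_flip_martingale:
  fixes \<xi> :: "nat \<Rightarrow> 'a \<Rightarrow> real" and T :: "nat \<Rightarrow> 'a \<Rightarrow> 'a"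
  assumes meas[measurable]: "\<And>k. \<xi> k \<in> borel_measurable M"
    and bdd: "\<And>k \<omega>. \<omega> \<in> space M \<Longrightarrow> \<bar>\<xi> k \<omega>\<bar> \<le> C"
    and T[measurable]: "\<And>k. T k \<in> measurable M M" and distr_T: "\<And>k. distr M M (T k) = M"
    and inv: "\<And>j k \<omega>. j < k \<Longrightarrow> \<omega> \<in> space M \<Longrightarrow> \<xi> j (T k \<omega>) = \<xi> j \<omega>"
    and flip: "\<And>k \<omega>. \<omega> \<in> space M \<Longrightarrow> \<xi> k (T k \<omega>) = - \<xi> k \<omega>"
    and V: "0 \<le> V"
  shows "norm (expectation (\<lambda>\<omega>. exp (\<i> * of_real (\<Sum>k<K. \<xi> k \<omega>))) - of_real (exp (- V / 2)))
    \<le> 2 * ((\<Sum>k<K. expectation (\<lambda>\<omega>. \<xi> k \<omega> ^ 4))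
         + 2 * expectation (\<lambda>\<omega>. \<bar>(\<Sum>k<K. (\<xi> k \<omega>)\<^sup>2) - V\<bar>))"
proof -
  define g where "g k \<omega> = (if (\<Sum>j\<le>k. (\<xi> j \<omega>)\<^sup>2) \<le> V + 1 then \<xi> k \<omega> else 0)" for k \<omega>
  define q where "q k \<omega> = (\<Sum>j<k. (g j \<omega>)\<^sup>2)" for k \<omega>
  define H where "H k \<omega> = exp (\<i> * of_real (\<Sum>j<k. g j \<omega>) + of_real (q k \<omega> / 2))" for k \<omega>
  have [measurable]: "g k \<in> borel_measurable M" for k unfolding g_def by measurable
  have [measurable]: "q k \<in> borel_measurable M" for k unfolding q_def by measurable
  have [measurable]: "H k \<in> borel_measurable M" for k unfolding H_def by measurable
  have gle: "(g k \<omega>)\<^sup>2 \<le> (\<xi> k \<omega>)\<^sup>2" for k \<omega> by (auto simp: g_def)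
  \<comment> \<open>If \<open>g k\<close> is kept, \<open>q (Suc k)\<close> is dominated by the
    untruncated partial sum, which has passed the test; otherwise nothing is added.\<close>
  have qle: "q k \<omega> \<le> V + 1" for k \<omega>
  proof (induction k)
    case 0 thus ?case using V by (simp add: q_def)
  next
    case (Suc k)
    show ?case
    proof (cases "(\<Sum>j\<le>k. (\<xi> j \<omega>)\<^sup>2) \<le> V + 1")
      case True
      have "q (Suc k) \<omega> \<le> (\<Sum>j\<le>k. (\<xi> j \<omega>)\<^sup>2)"
        unfolding q_def lessThan_Suc_atMost by (intro sum_mono gle)
      thus ?thesis using True by linarith
    next
      case False
      hence "g k \<omega> = 0" by (simp add: g_def)
      thus ?thesis using Suc by (simp add: q_def)
    qed
  qed
  have normH: "norm (H k \<omega>) = exp (q k \<omega> / 2)" for k \<omega>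
    by (simp add: H_def norm_exp)
  have normHle: "norm (H k \<omega>) \<le> exp ((V + 1) / 2)" for k \<omega>
    using qle[of k \<omega>] by (simp add: normH)
  have intH: "integrable M (H k)" for k
    by (rule integrable_const_bound[of _ "exp ((V+1)/2)"]) (use normHle in auto)
  have int4: "integrable M (\<lambda>\<omega>. \<xi> k \<omega> ^ 4)" for k
    by (rule integrable_const_bound[of _ "C ^ 4"])
       (use power_mono[OF bdd, of _ k 4] in \<open>auto simp: power_even_abs\<close>)
  have HSuc: "H (Suc k) \<omega> = H k \<omega> * exp (\<i> * of_real (g k \<omega>) + of_real ((g k \<omega>)\<^sup>2 / 2))" for k \<omega>
    by (simp add: H_def q_def exp_add[symmetric] algebra_simps add_divide_distrib)
  \<comment> \<open>\<open>T k\<close> preserves the measure and \<open>H k\<close> and reverses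
    \<open>g k\<close>. Averaging \<open>H (Suc k)\<close> with its image under \<open>T k\<close>
    therefore multiplies \<open>H k\<close> by cos (g k) times the compensating factor, a product
    close to 1.\<close>
  have step: "norm (expectation (H (Suc k)) - expectation (H k)) \<le> exp ((V+1)/2) * expectation (\<lambda>\<omega>. \<xi> k \<omega> ^ 4)" for k
  proof -
    have bd: "norm (H k \<omega> * of_real (cos (g k \<omega>) * exp ((g k \<omega>)\<^sup>2 / 2) - 1)) \<le> exp ((V+1)/2) * \<xi> k \<omega> ^ 4" for \<omega>
    proof -
      have "cos (g k \<omega>) * exp ((g k \<omega>)\<^sup>2 / 2) - 1 = (cos (g k \<omega>) - exp (- ((g k \<omega>)\<^sup>2 / 2))) * exp ((g k \<omega>)\<^sup>2 / 2)"
        by (simp add: left_diff_distrib flip: exp_add)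
      hence "\<bar>cos (g k \<omega>) * exp ((g k \<omega>)\<^sup>2 / 2) - 1\<bar> \<le> g k \<omega> ^ 4 * exp ((g k \<omega>)\<^sup>2 / 2)"
        using cos_minus_exp_bound[of "g k \<omega>"] by (simp add: abs_mult)
      hence "norm (H k \<omega> * of_real (cos (g k \<omega>) * exp ((g k \<omega>)\<^sup>2 / 2) - 1))
          \<le> exp (q k \<omega> / 2) * (g k \<omega> ^ 4 * exp ((g k \<omega>)\<^sup>2 / 2))"
        unfolding norm_mult normH norm_of_real by (intro mult_left_mono) auto
      also have "\<dots> = exp (q (Suc k) \<omega> / 2) * g k \<omega> ^ 4"
        by (simp add: q_def exp_add add_divide_distrib)
      also have "\<dots> \<le> exp ((V+1)/2) * \<xi> k \<omega> ^ 4"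
        by (intro mult_mono) (use qle[of "Suc k" \<omega>] in \<open>auto simp: g_def\<close>)
      finally show ?thesis .
    qed
    have gT: "g j (T k \<omega>) = g j \<omega>" if "j < k" "\<omega> \<in> space M" for j \<omega>
      unfolding g_def using that inv by auto
    \<comment> \<open>The test inside \<open>g k\<close> involves the square of the k-th increment
      as well, which the change of sign leaves alone.\<close>
    have gTk: "g k (T k \<omega>) = - g k \<omega>" if "\<omega> \<in> space M" for \<omega>
    proof -
      have "(\<Sum>j\<le>k. (\<xi> j (T k \<omega>))\<^sup>2) = (\<Sum>j\<le>k. (\<xi> j \<omega>)\<^sup>2)"
        by (intro sum.cong refl) (use that inv flip in \<open>auto simp: le_less\<close>)
      thus ?thesis using flip[OF that] by (simp add: g_def)
    qed
    have HT: "H k (T k \<omega>) = H k \<omega>" if "\<omega> \<in> space M" for \<omega>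
      unfolding H_def q_def using gT that by auto
    have e1: "expectation (H (Suc k)) = expectation (\<lambda>\<omega>. H (Suc k) (T k \<omega>))"
      using integral_distr[OF T[of k], of "H (Suc k)"] distr_T[of k] by simp
    have intHT: "integrable M (\<lambda>\<omega>. H (Suc k) (T k \<omega>))"
      by (rule integrable_const_bound[of _ "exp ((V+1)/2)"]) (use normHle in auto)
    have "2 * (expectation (H (Suc k)) - expectation (H k)) =
        expectation (\<lambda>\<omega>. H (Suc k) \<omega> + H (Suc k) (T k \<omega>) - 2 * H k \<omega>)"
      using intH intHT by (simp add: e1[symmetric])
    also have "\<dots> = expectation (\<lambda>\<omega>. 2 * (H k \<omega> * of_real (cos (g k \<omega>) * exp ((g k \<omega>)\<^sup>2 / 2) - 1)))"
    proof (intro Bochner_Integration.integral_cong refl)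
      fix \<omega> assume w: "\<omega> \<in> space M"
      have "H (Suc k) \<omega> + H (Suc k) (T k \<omega>) - 2 * H k \<omega> = H k \<omega> *
         ((exp (\<i> * of_real (g k \<omega>)) + exp (- (\<i> * of_real (g k \<omega>)))) * exp (of_real ((g k \<omega>)\<^sup>2 / 2)) - 2)"
        unfolding HSuc HT[OF w] gTk[OF w] exp_add by (simp add: algebra_simps)
      also have "exp (\<i> * of_real (g k \<omega>)) + exp (- (\<i> * of_real (g k \<omega>))) = 2 * of_real (cos (g k \<omega>))"
        by (simp add: cos_of_real cos_exp_eq flip: cos_of_real)
      finally show "H (Suc k) \<omega> + H (Suc k) (T k \<omega>) - 2 * H k \<omega> =
        2 * (H k \<omega> * of_real (cos (g k \<omega>) * exp ((g k \<omega>)\<^sup>2 / 2) - 1))"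
        by (simp add: algebra_simps flip: exp_of_real)
    qed
    also have "\<dots> = 2 * expectation (\<lambda>\<omega>. H k \<omega> * of_real (cos (g k \<omega>) * exp ((g k \<omega>)\<^sup>2 / 2) - 1))"
      by (rule integral_mult_right_zero)
    finally have "expectation (H (Suc k)) - expectation (H k) =
       expectation (\<lambda>\<omega>. H k \<omega> * of_real (cos (g k \<omega>) * exp ((g k \<omega>)\<^sup>2 / 2) - 1))"
      by (subst (asm) mult_cancel_left) simp
    also have "norm \<dots> \<le> expectation (\<lambda>\<omega>. exp ((V+1)/2) * \<xi> k \<omega> ^ 4)"
      by (rule norm_integral_le) (use bd int4 in auto)
    finally show ?thesis by simp
  qed
  have tele: "norm (expectation (H K) - 1) \<le> exp ((V+1)/2) * (\<Sum>k<K. expectation (\<lambda>\<omega>. \<xi> k \<omega> ^ 4))"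
  proof (induction K)
    case 0 thus ?case by (simp add: H_def q_def prob_space)
  next
    case (Suc K)
    have "norm (expectation (H (Suc K)) - 1) \<le> norm (expectation (H (Suc K)) - expectation (H K)) + norm (expectation (H K) - 1)"
      using norm_triangle_ineq[of "expectation (H (Suc K)) - expectation (H K)" "expectation (H K) - 1"] by simp
    thus ?case using step[of K] Suc by (simp add: distrib_left)
  qed
  define Q where "Q \<omega> = (\<Sum>k<K. (\<xi> k \<omega>)\<^sup>2)" for \<omega>
  define Z where "Z \<omega> = exp (\<i> * of_real (\<Sum>k<K. \<xi> k \<omega>))" for \<omega>
  have [measurable]: "Q \<in> borel_measurable M" unfolding Q_def by measurable
  have [measurable]: "Z \<in> borel_measurable M" unfolding Z_def by measurable
  have normZ: "norm (Z \<omega>) = 1" for \<omega> by (simp add: Z_def norm_exp)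
  \<comment> \<open>Below the threshold no increment was cut, so \<open>H K\<close> is exp (Q / 2)
    times \<open>Z\<close>. Above it the distance from Q to V exceeds 1, and bounding both terms by
    the larger exponential suffices; this accounts for the factor 2.\<close>
  have pt: "norm (H K \<omega> - of_real (exp (V/2)) * Z \<omega>) \<le> exp ((V+1)/2) * (2 * \<bar>Q \<omega> - V\<bar>)" for \<omega>
  proof (cases "Q \<omega> \<le> V + 1")
    case True
    have gx: "g k \<omega> = \<xi> k \<omega>" if "k < K" for k
    proof -
      have "(\<Sum>j\<le>k. (\<xi> j \<omega>)\<^sup>2) \<le> Q \<omega>" unfolding Q_def using that by (intro sum_mono2) auto
      thus ?thesis using True by (simp add: g_def)
    qed
    have qQ: "q K \<omega> = Q \<omega>" using gx by (simp add: q_def Q_def)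
    have "H K \<omega> = of_real (exp (Q \<omega> / 2)) * Z \<omega>"
      using gx by (simp add: H_def qQ Z_def exp_add flip: exp_of_real)
    hence "norm (H K \<omega> - of_real (exp (V/2)) * Z \<omega>) = norm (of_real (exp (Q \<omega> / 2) - exp (V/2)) * Z \<omega>)"
      by (simp add: algebra_simps)
    also have "\<dots> = \<bar>exp (Q \<omega> / 2) - exp (V/2)\<bar>" unfolding norm_mult normZ norm_of_real by simp
    also have "\<dots> \<le> exp ((V+1)/2) * \<bar>Q \<omega> / 2 - V / 2\<bar>"
    proof -
      have ineq: "exp a - exp b \<le> exp a * (a - b)" for a b :: real
      proof -
        have "1 + (b - a) \<le> exp (b - a)" by (rule exp_ge_add_one_self)
        hence "exp a * (1 + (b - a)) \<le> exp a * exp (b - a)" by (intro mult_left_mono) auto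
        thus ?thesis by (simp add: algebra_simps flip: exp_add)
      qed
      show ?thesis
      proof (cases "Q \<omega> \<le> V")
        case True
        have "\<bar>exp (Q \<omega> / 2) - exp (V/2)\<bar> = exp (V/2) - exp (Q \<omega> / 2)" using True by simp
        also have "\<dots> \<le> exp (V/2) * (V/2 - Q \<omega>/2)" by (rule ineq)
        also have "\<dots> \<le> exp ((V+1)/2) * (V/2 - Q \<omega>/2)" using True by (intro mult_right_mono) auto
        finally show ?thesis using True by simp
      next
        case False
        have "\<bar>exp (Q \<omega> / 2) - exp (V/2)\<bar> = exp (Q \<omega> / 2) - exp (V/2)" using False by simp
        also have "\<dots> \<le> exp (Q \<omega>/2) * (Q \<omega>/2 - V/2)" by (rule ineq)
        also have "\<dots> \<le> exp ((V+1)/2) * (Q \<omega>/2 - V/2)" using False \<open>Q \<omega> \<le> V + 1\<close> by (intro mult_right_mono) auto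
        finally show ?thesis using False by simp
      qed
    qed
    also have "\<dots> \<le> exp ((V+1)/2) * (2 * \<bar>Q \<omega> - V\<bar>)"
      by (intro mult_left_mono) (auto simp flip: diff_divide_distrib)
    finally show ?thesis .
  next
    case False
    have "norm (H K \<omega> - of_real (exp (V/2)) * Z \<omega>) \<le> norm (H K \<omega>) + norm (of_real (exp (V/2)) * Z \<omega>)"
      by (rule norm_triangle_ineq4)
    also have "\<dots> \<le> exp ((V+1)/2) + exp ((V+1)/2)"
      by (intro add_mono normHle) (simp add: norm_mult normZ)
    also have "\<dots> \<le> exp ((V+1)/2) * (2 * \<bar>Q \<omega> - V\<bar>)" using False by simp
    finally show ?thesis .
  qed
  have intZ: "integrable M Z"
    by (rule integrable_const_bound[of _ 1]) (auto simp: normZ)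
  have intQ: "integrable M (\<lambda>\<omega>. \<bar>Q \<omega> - V\<bar>)"
  proof (rule integrable_const_bound[of _ "real K * C\<^sup>2 + V"])
    have "\<bar>Q \<omega> - V\<bar> \<le> real K * C\<^sup>2 + V" if "\<omega> \<in> space M" for \<omega>
    proof -
      have "Q \<omega> \<le> (\<Sum>k<K. C\<^sup>2)" unfolding Q_def
        using bdd[OF that] by (intro sum_mono) (metis abs_ge_zero order_trans power2_abs power_mono)
      moreover have "Q \<omega> \<ge> 0" unfolding Q_def by (intro sum_nonneg) auto
      ultimately show ?thesis using V by auto
    qed
    thus "AE \<omega> in M. norm \<bar>Q \<omega> - V\<bar> \<le> real K * C\<^sup>2 + V" by auto
  qed measurable
  have "norm (expectation (H K) - of_real (exp (V/2)) * expectation Z) = norm (expectation (\<lambda>\<omega>. H K \<omega> - of_real (exp (V/2)) * Z \<omega>))"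
    using intH intZ by simp
  also have "\<dots> \<le> expectation (\<lambda>\<omega>. exp ((V+1)/2) * (2 * \<bar>Q \<omega> - V\<bar>))"
    using intQ by (intro norm_integral_le pt) auto
  also have "\<dots> = exp ((V+1)/2) * (2 * expectation (\<lambda>\<omega>. \<bar>Q \<omega> - V\<bar>))" by simp
  finally have fin: "norm (expectation (H K) - of_real (exp (V/2)) * expectation Z) \<le> \<dots>" .
  let ?R = "(\<Sum>k<K. expectation (\<lambda>\<omega>. \<xi> k \<omega> ^ 4)) + 2 * expectation (\<lambda>\<omega>. \<bar>Q \<omega> - V\<bar>)"
  have R0: "?R \<ge> 0" by (intro add_nonneg_nonneg sum_nonneg mult_nonneg_nonneg integral_nonneg_AE) auto
  have "norm (of_real (exp (V/2)) * expectation Z - 1) \<le> exp ((V+1)/2) * ?R"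
    using norm_triangle_ineq4[of "expectation (H K) - 1" "expectation (H K) - of_real (exp (V/2)) * expectation Z"] tele fin
    by (simp add: algebra_simps)
  moreover have "of_real (exp (V/2)) * expectation Z - 1 = of_real (exp (V/2)) * (expectation Z - of_real (exp (- V / 2)))"
  proof -
    have "of_real (exp (V/2)) * (of_real (exp (- V / 2)) :: complex) = of_real (exp (V/2) * exp (- V / 2))" by simp
    also have "exp (V/2) * exp (- V / 2) = 1" by (simp flip: exp_add)
    finally show ?thesis by (simp add: algebra_simps)
  qed
  \<comment> \<open>The factor exp (V / 2) cancels and leaves exp (1 / 2), so the final constant
    does not depend on V.\<close>
  ultimately have "exp (V/2) * norm (expectation Z - of_real (exp (- V / 2))) \<le> exp (V/2) * (exp (1/2) * ?R)"
    by (simp add: norm_mult add_divide_distrib exp_add mult.assoc)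
  hence "norm (expectation Z - of_real (exp (- V / 2))) \<le> exp (1/2) * ?R" by simp
  also have "\<dots> \<le> 2 * ?R"
  proof (rule mult_right_mono[OF _ R0])
    have "exp (1/2 :: real) ^ 2 = exp 1" by (simp flip: exp_of_nat_mult)
    also have "\<dots> \<le> 2 ^ 2" using exp_le by simp
    finally show "exp (1/2 :: real) \<le> 2" by (rule power2_le_imp_le) simp
  qed
  finally show ?thesis unfolding Z_def Q_def .
qed

section \<open>Trigonometric polynomials on the unit interval\<close>

abbreviation (input) unit_uniform :: "real measure" where
  "unit_uniform \<equiv> uniform_measure lborel {0..1}"

interpretation unit_uniform: prob_space unit_uniform
  by (rule prob_space_uniform_measure) auto

lemma e_exp_eq_cis: "e_exp x = cis (2 * pi * x)"
  by (simp add: e_exp_def cis_conv_exp mult_ac)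

lemma norm_e_exp [simp]: "norm (e_exp x) = 1"
  by (simp add: e_exp_eq_cis)

lemma e_exp_add: "e_exp (x + y) = e_exp x * e_exp y"
  by (simp add: e_exp_eq_cis cis_mult distrib_left)

lemma e_exp_0 [simp]: "e_exp 0 = 1"
  by (simp add: e_exp_eq_cis)

lemma cnj_e_exp: "cnj (e_exp x) = e_exp (- x)"
  by (simp add: e_exp_eq_cis cis_cnj)

lemma continuous_on_e_exp [continuous_intros]:
  "continuous_on A f \<Longrightarrow> continuous_on A (\<lambda>x. e_exp (f x))"
  unfolding e_exp_def by (intro continuous_intros)

lemma borel_measurable_e_exp [measurable]: "e_exp \<in> borel_measurable borel"
  by (intro borel_measurable_continuous_onI continuous_intros)

lemma unit_uniform_integrable:
  fixes f :: "real \<Rightarrow> 'b :: {banach, second_countable_topology}"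
  assumes "continuous_on UNIV f"
  shows "integrable unit_uniform f"
proof -
  have "compact (f ` {0..1})"
    by (intro compact_continuous_image continuous_on_subset[OF assms]) auto
  then obtain B where B: "\<And>x. x \<in> {0..1} \<Longrightarrow> norm (f x) \<le> B"
    using compact_imp_bounded[of "f ` {0..1}"] unfolding bounded_iff by blast
  have [measurable]: "f \<in> borel_measurable borel" using assms by (rule borel_measurable_continuous_onI)
  show ?thesis
  proof (rule unit_uniform.integrable_const_bound[of _ B])
    show "AE x in unit_uniform. norm (f x) \<le> B"
      by (rule AE_uniform_measureI) (use B in auto)
  qed measurable
qed

lemma integral_unit_uniform:
  fixes f :: "real \<Rightarrow> 'b :: {banach, second_countable_topology}"
  assumes "f \<in> borel_measurable borel"
  shows "integral\<^sup>L unit_uniform f = (LINT x:{0..1}|lborel. f x)"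
proof -
  have "unit_uniform = density lborel (\<lambda>x. ennreal (indicator {0..1} x))"
    unfolding uniform_measure_def by (intro density_cong) (auto simp: indicator_def)
  thus ?thesis using assms by (simp add: integral_density set_lebesgue_integral_def)
qed

lemma integral_e_exp:
  "(\<integral>\<theta>. e_exp (of_int h * \<theta>) \<partial>unit_uniform) = (if h = 0 then 1 else 0)"
proof (cases "h = 0")
  case True
  thus ?thesis by (simp add: unit_uniform.prob_space)
next
  case False
  define F where "F \<theta> = e_exp (of_int h * \<theta>) / (2 * of_real pi * \<i> * of_int h)" for \<theta> :: real
  have "(\<integral>\<theta>. indicator {0..1} \<theta> *\<^sub>R e_exp (of_int h * \<theta>) \<partial>lborel) = F 1 - F 0"
  proof (rule integral_FTC_Icc)
    show "(F has_vector_derivative e_exp (real_of_int h * x)) (at x within {0..1})" for x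
    proof -
      have "((\<lambda>z. exp (2 * of_real pi * \<i> * of_int h * z) / (2 * of_real pi * \<i> * of_int h)) has_field_derivative
         exp (2 * of_real pi * \<i> * of_int h * of_real x)) (at (of_real x))"
        using False by (auto intro!: derivative_eq_intros)
      from field_vector_diff_chain_at[OF has_vector_derivative_of_real[OF DERIV_ident] this]
      have "((\<lambda>x. exp (2 * of_real pi * \<i> * of_int h * of_real x) / (2 * of_real pi * \<i> * of_int h)) has_vector_derivative
         exp (2 * of_real pi * \<i> * of_int h * of_real x)) (at x)"
        unfolding o_def of_real_1 mult_1 .
      moreover have "F = (\<lambda>x. exp (2 * of_real pi * \<i> * of_int h * of_real x) / (2 * of_real pi * \<i> * of_int h))"
        by (simp add: F_def e_exp_def mult.assoc fun_eq_iff)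
      moreover have "e_exp (real_of_int h * x) = exp (2 * of_real pi * \<i> * of_int h * of_real x)"
        by (simp add: e_exp_def mult.assoc)
      ultimately show ?thesis by (metis has_vector_derivative_at_within)
    qed
    show "continuous_on {0..1} (\<lambda>x. e_exp (real_of_int h * x))" by (intro continuous_intros)
  qed auto
  also have "F 1 = F 0"
    using cis_multiple_2pi[of "of_int h"] by (simp add: F_def e_exp_eq_cis)
  finally show ?thesis
    using False by (simp add: integral_unit_uniform set_lebesgue_integral_def)
qed

lemma parseval_finite:
  assumes "finite H"
  shows "(\<integral>\<theta>. (norm (\<Sum>h\<in>H. a h * e_exp (of_int h * \<theta>)))\<^sup>2 \<partial>unit_uniform) = (\<Sum>h\<in>H. (norm (a h))\<^sup>2)"
proof -
  have "complex_of_real (\<integral>\<theta>. (norm (\<Sum>h\<in>H. a h * e_exp (of_int h * \<theta>)))\<^sup>2 \<partial>unit_uniform)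
      = (\<integral>\<theta>. of_real ((norm (\<Sum>h\<in>H. a h * e_exp (of_int h * \<theta>)))\<^sup>2) \<partial>unit_uniform)"
    by (rule integral_complex_of_real[symmetric])
  also have "\<dots> = (\<integral>\<theta>. (\<Sum>h\<in>H. \<Sum>k\<in>H. a h * cnj (a k) * e_exp (of_int (h - k) * \<theta>)) \<partial>unit_uniform)"
  proof (intro Bochner_Integration.integral_cong refl)
    fix \<theta> :: real
    have "e_exp (of_int (h - k) * \<theta>) = e_exp (of_int h * \<theta>) * cnj (e_exp (of_int k * \<theta>))" for h k
      by (simp add: cnj_e_exp left_diff_distrib flip: e_exp_add)
    thus "of_real ((norm (\<Sum>h\<in>H. a h * e_exp (of_int h * \<theta>)))\<^sup>2) =
        (\<Sum>h\<in>H. \<Sum>k\<in>H. a h * cnj (a k) * e_exp (of_int (h - k) * \<theta>))"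
      unfolding complex_norm_square by (simp add: sum_product mult_ac)
  qed
  also have "\<dots> = (\<Sum>h\<in>H. \<Sum>k\<in>H. a h * cnj (a k) * (if h - k = 0 then 1 else 0))"
    by (subst Bochner_Integration.integral_sum,
        (intro unit_uniform_integrable continuous_intros)[1])+
       (simp only: integral_mult_right_zero integral_e_exp)
  also have "\<dots> = (\<Sum>h\<in>H. a h * cnj (a h))"
    using assms by (intro sum.cong refl) (simp add: if_distrib cong: if_cong)
  also have "\<dots> = of_real (\<Sum>h\<in>H. (norm (a h))\<^sup>2)" by (simp add: complex_norm_square flip: of_real_power)
  finally show ?thesis using of_real_eq_iff by blast
qed

text \<open>\<open>S\<close> is an upper bound for the set of frequencies, since coefficients may be
  0. The predicate is thereby stable under sums and products without any tracking of
  cancellations.\<close>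

definition trig_spectrum :: "int set \<Rightarrow> (real \<Rightarrow> complex) \<Rightarrow> bool" where
  "trig_spectrum S f \<longleftrightarrow> (\<exists>a. \<forall>\<theta>. f \<theta> = (\<Sum>h\<in>S. a h * e_exp (of_int h * \<theta>)))"

lemma trig_spectrum_mono:
  assumes "trig_spectrum S f" "S \<subseteq> S'" "finite S'"
  shows "trig_spectrum S' f"
proof -
  obtain a where a: "\<And>\<theta>. f \<theta> = (\<Sum>h\<in>S. a h * e_exp (of_int h * \<theta>))"
    using assms(1) by (auto simp: trig_spectrum_def)
  have "f \<theta> = (\<Sum>h\<in>S'. (if h \<in> S then a h else 0) * e_exp (of_int h * \<theta>))" for \<theta>
    unfolding a using assms by (intro sum.mono_neutral_cong_left) auto
  thus ?thesis unfolding trig_spectrum_def by (intro exI[of _ "\<lambda>h. if h \<in> S then a h else 0"]) blast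
qed

lemma trig_spectrum_scale: "trig_spectrum S f \<Longrightarrow> trig_spectrum S (\<lambda>\<theta>. c * f \<theta>)"
  unfolding trig_spectrum_def
proof (elim exE)
  fix a assume "\<forall>\<theta>. f \<theta> = (\<Sum>h\<in>S. a h * e_exp (of_int h * \<theta>))"
  thus "\<exists>a. \<forall>\<theta>. c * f \<theta> = (\<Sum>h\<in>S. a h * e_exp (of_int h * \<theta>))"
    by (intro exI[of _ "\<lambda>h. c * a h"]) (simp add: sum_distrib_left mult_ac)
qed

lemma trig_spectrum_add:
  assumes "trig_spectrum S f" "trig_spectrum S g"
  shows "trig_spectrum S (\<lambda>\<theta>. f \<theta> + g \<theta>)"
proof -
  obtain a b where "\<And>\<theta>. f \<theta> = (\<Sum>h\<in>S. a h * e_exp (of_int h * \<theta>))"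
     "\<And>\<theta>. g \<theta> = (\<Sum>h\<in>S. b h * e_exp (of_int h * \<theta>))"
    using assms by (auto simp: trig_spectrum_def)
  hence "\<forall>\<theta>. f \<theta> + g \<theta> = (\<Sum>h\<in>S. (a h + b h) * e_exp (of_int h * \<theta>))"
    by (simp add: sum.distrib distrib_right)
  thus ?thesis unfolding trig_spectrum_def by (rule exI[of _ "\<lambda>h. a h + b h"])
qed

lemma trig_spectrum_e_exp: "finite S \<Longrightarrow> h \<in> S \<Longrightarrow> trig_spectrum S (\<lambda>\<theta>. e_exp (of_int h * \<theta>))"
  unfolding trig_spectrum_def
  by (intro exI[of _ "\<lambda>k. if k = h then 1 else 0"]) (simp add: if_distrib[of "\<lambda>x. x * _"] cong: if_cong)

lemma trig_spectrum_sum: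
  assumes "finite I" "\<And>i. i \<in> I \<Longrightarrow> trig_spectrum S (f i)"
  shows "trig_spectrum S (\<lambda>\<theta>. \<Sum>i\<in>I. f i \<theta>)"
  using assms
proof (induction I rule: finite_induct)
  case empty
  have "\<forall>\<theta>. (\<Sum>i\<in>{}. f i \<theta>) = (\<Sum>h\<in>S. 0 * e_exp (of_int h * \<theta>))" by simp
  thus ?case unfolding trig_spectrum_def by (rule exI[of _ "\<lambda>_. 0"])
next
  case (insert i I)
  thus ?case by (simp add: trig_spectrum_add)
qed

lemma trig_spectrum_mult:
  assumes "trig_spectrum S f" "trig_spectrum S' g" "finite R"
    and "\<And>h k. h \<in> S \<Longrightarrow> k \<in> S' \<Longrightarrow> h + k \<in> R" "finite S" "finite S'"
  shows "trig_spectrum R (\<lambda>\<theta>. f \<theta> * g \<theta>)"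
proof -
  obtain a b where ab: "\<And>\<theta>. f \<theta> = (\<Sum>h\<in>S. a h * e_exp (of_int h * \<theta>))"
     "\<And>\<theta>. g \<theta> = (\<Sum>h\<in>S'. b h * e_exp (of_int h * \<theta>))"
    using assms by (auto simp: trig_spectrum_def)
  have "(\<lambda>\<theta>. f \<theta> * g \<theta>) = (\<lambda>\<theta>. \<Sum>h\<in>S. \<Sum>k\<in>S'. (a h * b k) * e_exp (of_int (h + k) * \<theta>))"
    by (simp add: ab sum_product e_exp_add ring_distribs mult.assoc mult.left_commute)
  moreover have "trig_spectrum R \<dots>"
    using assms by (intro trig_spectrum_sum trig_spectrum_scale trig_spectrum_e_exp) auto
  ultimately show ?thesis by simp
qed

lemma trig_spectrum_remove_mean:
  assumes "trig_spectrum S f" "finite S"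
  shows "trig_spectrum (S - {0}) (\<lambda>\<theta>. f \<theta> - (\<integral>\<theta>. f \<theta> \<partial>unit_uniform))"
proof -
  \<comment> \<open>Frequency 0 is forced into the index set so that the mean can be read off as the
    coefficient \<open>a 0\<close>.\<close>
  have "trig_spectrum (insert 0 S) f" using assms by (auto intro: trig_spectrum_mono)
  then obtain a where a: "f = (\<lambda>\<theta>. \<Sum>h\<in>insert 0 S. a h * e_exp (of_int h * \<theta>))"
    by (auto simp: trig_spectrum_def)
  have "(\<integral>\<theta>. f \<theta> \<partial>unit_uniform) = (\<Sum>h\<in>insert 0 S. a h * (if h = 0 then 1 else 0))"
    unfolding a
    by (subst Bochner_Integration.integral_sum, (intro unit_uniform_integrable continuous_intros)[1])
       (simp only: integral_mult_right_zero integral_e_exp)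
  also have "\<dots> = a 0" using assms by (simp add: if_distrib cong: if_cong)
  finally have m: "(\<integral>\<theta>. f \<theta> \<partial>unit_uniform) = a 0" .
  have "f \<theta> = a 0 + (\<Sum>h\<in>S - {0}. a h * e_exp (of_int h * \<theta>))" for \<theta>
    unfolding a using assms by (subst sum.insert_remove) auto
  hence "\<forall>\<theta>. f \<theta> - (\<integral>\<theta>. f \<theta> \<partial>unit_uniform) = (\<Sum>h\<in>S - {0}. a h * e_exp (of_int h * \<theta>))"
    using m by simp
  thus ?thesis unfolding trig_spectrum_def by blast
qed

text \<open>Parseval reduces the claim to one inequality per frequency. At each of them at most
  \<kappa> functions have a coefficient, so Cauchy-Schwarz costs the factor \<kappa> instead of the
  number of functions; \<kappa> = 1 is plain orthogonality.\<close>

lemma integral_almost_disjoint_spectra: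
  fixes f :: "nat \<Rightarrow> real \<Rightarrow> complex"
  assumes I: "finite I" and S: "\<And>i. i \<in> I \<Longrightarrow> finite (S i)"
    and f: "\<And>i. i \<in> I \<Longrightarrow> trig_spectrum (S i) (f i)"
    and overlap: "\<And>h. card {i \<in> I. h \<in> S i} \<le> \<kappa>"
  shows "(\<integral>\<theta>. (norm (\<Sum>i\<in>I. f i \<theta>))\<^sup>2 \<partial>unit_uniform)
     \<le> real \<kappa> * (\<Sum>i\<in>I. \<integral>\<theta>. (norm (f i \<theta>))\<^sup>2 \<partial>unit_uniform)"
proof -
  define H where "H = (\<Union>i\<in>I. S i)"
  have fin: "finite H" using I S by (auto simp: H_def)
  have "\<forall>i\<in>I. \<exists>a. \<forall>\<theta>. f i \<theta> = (\<Sum>h\<in>S i. a h * e_exp (of_int h * \<theta>))"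
    using f by (auto simp: trig_spectrum_def)
  then obtain a0 where a0: "\<And>i \<theta>. i \<in> I \<Longrightarrow> f i \<theta> = (\<Sum>h\<in>S i. a0 i h * e_exp (of_int h * \<theta>))"
    by metis
  define a where "a i h = (if h \<in> S i then a0 i h else 0)" for i h
  have a: "f i \<theta> = (\<Sum>h\<in>H. a i h * e_exp (of_int h * \<theta>))" if "i \<in> I" for i \<theta>
    unfolding a0[OF that] using fin that
    by (intro sum.mono_neutral_cong_left) (auto simp: a_def H_def)
  have "(\<integral>\<theta>. (norm (\<Sum>i\<in>I. f i \<theta>))\<^sup>2 \<partial>unit_uniform)
    = (\<integral>\<theta>. (norm (\<Sum>h\<in>H. (\<Sum>i\<in>I. a i h) * e_exp (of_int h * \<theta>)))\<^sup>2 \<partial>unit_uniform)"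
    by (subst sum_distrib_right, subst sum.swap) (simp add: a)
  also have "\<dots> = (\<Sum>h\<in>H. (norm (\<Sum>i\<in>I. a i h))\<^sup>2)" by (rule parseval_finite[OF fin])
  also have "\<dots> \<le> (\<Sum>h\<in>H. real \<kappa> * (\<Sum>i\<in>I. (norm (a i h))\<^sup>2))"
  proof (rule sum_mono)
    fix h
    let ?J = "{i \<in> I. h \<in> S i}"
    have "(norm (\<Sum>i\<in>I. a i h))\<^sup>2 = (norm (\<Sum>i\<in>?J. a i h))\<^sup>2"
      using I by (subst sum.mono_neutral_left[of I ?J, symmetric]) (auto simp: a_def)
    also have "\<dots> \<le> (\<Sum>i\<in>?J. 1 * norm (a i h))\<^sup>2"
      by (intro power_mono) (auto intro: norm_sum)
    also have "\<dots> \<le> (\<Sum>i\<in>?J. 1\<^sup>2) * (\<Sum>i\<in>?J. (norm (a i h))\<^sup>2)"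
      by (rule Cauchy_Schwarz_ineq_sum)
    also have "\<dots> \<le> real \<kappa> * (\<Sum>i\<in>I. (norm (a i h))\<^sup>2)"
      using overlap[of h] I by (intro mult_mono sum_mono2) (auto intro: sum_nonneg)
    finally show "(norm (\<Sum>i\<in>I. a i h))\<^sup>2 \<le> real \<kappa> * (\<Sum>i\<in>I. (norm (a i h))\<^sup>2)" .
  qed
  also have "\<dots> = real \<kappa> * (\<Sum>i\<in>I. \<Sum>h\<in>H. (norm (a i h))\<^sup>2)"
    by (simp add: sum_distrib_left) (rule sum.swap)
  also have "\<dots> = real \<kappa> * (\<Sum>i\<in>I. \<integral>\<theta>. (norm (f i \<theta>))\<^sup>2 \<partial>unit_uniform)"
    by (simp add: a parseval_finite[OF fin])
  finally show ?thesis .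
qed

section \<open>Quadruples with square product\<close>

lemma card_divisors_prime_power_mult_le:
  fixes p m :: nat
  assumes "prime p" "m > 0"
  shows "card {d. d dvd p ^ e * m} \<le> (e + 1) * card {d. d dvd m}"
proof -
  have "{d. d dvd p ^ e * m} \<subseteq> (\<lambda>(i, d). p ^ i * d) ` ({..e} \<times> {d. d dvd m})"
  proof
    fix d assume "d \<in> {d. d dvd p ^ e * m}"
    then obtain b c where "d = b * c" "b dvd p ^ e" "c dvd m" using division_decomp by blast
    then show "d \<in> (\<lambda>(i, d). p ^ i * d) ` ({..e} \<times> {d. d dvd m})"
      using divides_primepow_nat[OF assms(1), of b e] by auto
  qed
  hence "card {d. d dvd p ^ e * m} \<le> card ((\<lambda>(i, d). p ^ i * d) ` ({..e} \<times> {d. d dvd m}))"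
    using assms(2) by (intro card_mono finite_imageI finite_cartesian_product finite_divisors_nat) auto
  also have "\<dots> \<le> card ({..e} \<times> {d. d dvd m})"
    using assms(2) by (intro card_image_le finite_cartesian_product finite_divisors_nat) auto
  finally show ?thesis by (simp add: card_cartesian_product)
qed

text \<open>A prime power p^e in n multiplies the number of divisors by at most e + 1. For p \<ge>
  2^(1/\<epsilon>) this is at most p^(e \<epsilon>), because e + 1 \<le> 2^e. Each smaller prime
  costs an extra factor \<open>K\<close>, uniform in e, and there are at most \<open>B\<close> of
  them.\<close>

lemma divisor_bound:
  assumes "\<epsilon> > 0"
  obtains C :: real where "C \<ge> 1" "\<And>n::nat. n > 0 \<Longrightarrow> real (card {d. d dvd n}) \<le> C * real n powr \<epsilon>"
proof -
  define B where "B = nat \<lceil>2 powr (1 / \<epsilon>)\<rceil>"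
  \<comment> \<open>Chosen so that e + 1 \<le> K (1 + e \<epsilon> ln 2); the inequality 1 + x \<le>
    exp x then turns the right-hand side into K 2^(e \<epsilon>).\<close>
  define K where "K = max 1 (1 / (\<epsilon> * ln 2))"
  have K1: "K \<ge> 1" by (simp add: K_def)
  have large: "real e + 1 \<le> (real p ^ e) powr \<epsilon>" if "p \<ge> B" for p e :: nat
  proof -
    have "2 powr (1 / \<epsilon>) \<le> real p" using that by (simp add: B_def)
    hence "(2 powr (1 / \<epsilon>)) powr \<epsilon> \<le> real p powr \<epsilon>" using assms by (intro powr_mono2) auto
    hence 2: "2 \<le> real p powr \<epsilon>" using assms by (simp add: powr_powr)
    have "real e + 1 \<le> 2 ^ e"
      using less_exp[of e] by (metis Suc_leI add.commute of_nat_Suc of_nat_le_iff of_nat_numeral of_nat_power)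
    also have "\<dots> \<le> (real p powr \<epsilon>) ^ e" using 2 by (intro power_mono) auto
    also have "\<dots> = (real p ^ e) powr \<epsilon>"
      using 2 by (cases "p = 0") (auto simp: powr_powr mult.commute simp flip: powr_realpow)
    finally show ?thesis .
  qed
  have small: "real e + 1 \<le> K * (real p ^ e) powr \<epsilon>" if "p \<ge> 2" for p e :: nat
  proof -
    have "real e + 1 \<le> K * (1 + real e * (\<epsilon> * ln 2))"
    proof -
      have "1 \<le> K * (\<epsilon> * ln 2)" using assms by (auto simp: K_def max_def field_simps)
      hence "real e * 1 \<le> real e * (K * (\<epsilon> * ln 2))" by (intro mult_left_mono) auto
      thus ?thesis using K1 by (simp add: algebra_simps)
    qed
    also have "\<dots> \<le> K * exp (real e * (\<epsilon> * ln 2))" using K1 by (intro mult_left_mono exp_ge_add_one_self) auto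
    also have "exp (real e * (\<epsilon> * ln 2)) = ((2::real) ^ e) powr \<epsilon>" by (simp add: powr_def ln_realpow mult_ac)
    also have "K * \<dots> \<le> K * (real p ^ e) powr \<epsilon>"
      using K1 assms that by (intro mult_left_mono powr_mono2 power_mono) auto
    finally show ?thesis .
  qed
  \<comment> \<open>The exponent of \<open>K\<close> counts the small primes dividing n. The
    induction strips the full power of one prime, so that this count drops by one if the prime is
    small and stays the same otherwise.\<close>
  have main: "real (card {d. d dvd n}) \<le> K ^ card {p \<in> prime_factors n. p < B} * real n powr \<epsilon>" if "n > 0" for n :: nat
    using that
  proof (induction n rule: less_induct)
    case (less n)
    show ?case
    proof (cases "n = 1")
      case True thus ?thesis by simp
    next
      case False
      then obtain p where p: "prime p" "p dvd n" using prime_factor_nat by blast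
      define e where "e = multiplicity p n"
      obtain m where m: "n = p ^ e * m" "\<not> p dvd m"
        using multiplicity_decompose'[of n p] p less.prems by (metis e_def not_prime_unit not_gr_zero)
      have e: "e > 0" using p less.prems by (simp add: e_def prime_multiplicity_gt_zero_iff)
      have m0: "m > 0" using m less.prems by (cases m) auto
      have "1 < p ^ e" using e p by (intro one_less_power prime_gt_1_nat)
      hence mn: "m < n" using m m0 by simp
      have pf: "prime_factors n = insert p (prime_factors m)" "p \<notin> prime_factors m"
      proof -
        show "p \<notin> prime_factors m" using m(2) by (simp add: in_prime_factors_iff)
        have "q dvd p ^ e * m \<longleftrightarrow> q = p \<or> q dvd m" if "prime q" for q
          using that p(1) e by (metis dvd_power prime_dvd_mult_iff prime_dvd_power primes_dvd_imp_eq)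
        thus "prime_factors n = insert p (prime_factors m)"
          using less.prems m0 p e unfolding m(1) by (auto simp: in_prime_factors_iff)
      qed
      let ?k = "card {q \<in> prime_factors m. q < B}"
      have IH: "real (card {d. d dvd m}) \<le> K ^ ?k * real m powr \<epsilon>" using less.IH[OF mn m0] .
      have "real (card {d. d dvd n}) \<le> real ((e + 1) * card {d. d dvd m})"
        unfolding m(1) using card_divisors_prime_power_mult_le[OF p(1) m0] of_nat_le_iff by blast
      also have "\<dots> \<le> (real e + 1) * (K ^ ?k * real m powr \<epsilon>)"
        unfolding of_nat_mult using IH by (intro mult_mono) auto
      finally have *: "real (card {d. d dvd n}) \<le> (real e + 1) * (K ^ ?k * real m powr \<epsilon>)" .
      have n: "real n powr \<epsilon> = (real p ^ e) powr \<epsilon> * real m powr \<epsilon>"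
        by (simp add: m(1) powr_mult)
      show ?thesis
      proof (cases "p < B")
        case True
        have "{q \<in> prime_factors n. q < B} = insert p {q \<in> prime_factors m. q < B}"
          using pf True by auto
        hence c: "card {q \<in> prime_factors n. q < B} = Suc ?k" using pf by simp
        have "(real e + 1) * (K ^ ?k * real m powr \<epsilon>) \<le> (K * (real p ^ e) powr \<epsilon>) * (K ^ ?k * real m powr \<epsilon>)"
          using small[of p e] prime_ge_2_nat[OF p(1)] K1 by (intro mult_right_mono) auto
        thus ?thesis using * unfolding c n by (simp add: mult_ac)
      next
        case False
        hence c: "{q \<in> prime_factors n. q < B} = {q \<in> prime_factors m. q < B}" using pf by auto
        have "(real e + 1) * (K ^ ?k * real m powr \<epsilon>) \<le> ((real p ^ e) powr \<epsilon>) * (K ^ ?k * real m powr \<epsilon>)"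
          using large[of p e] False K1 by (intro mult_right_mono) auto
        thus ?thesis using * unfolding c n by (simp add: mult_ac)
      qed
    qed
  qed
  show ?thesis
  proof (rule that[of "K ^ B"])
    show "K ^ B \<ge> 1" using K1 by simp
    fix n :: nat assume n: "n > 0"
    have "card {p \<in> prime_factors n. p < B} \<le> card {..<B}" by (intro card_mono) auto
    hence "K ^ card {p \<in> prime_factors n. p < B} \<le> K ^ B" using K1 by (intro power_increasing) auto
    hence "K ^ card {p \<in> prime_factors n. p < B} * real n powr \<epsilon> \<le> K ^ B * real n powr \<epsilon>" by (intro mult_right_mono) auto
    thus "real (card {d. d dvd n}) \<le> K ^ B * real n powr \<epsilon>" using main[OF n] by linarith
  qed
qed

lemma sum_inverse_le_ln: "n \<ge> 1 \<Longrightarrow> (\<Sum>g=1..n. 1 / real g) \<le> 1 + ln (real n)"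
proof (induction n rule: dec_induct)
  case (step n)
  have "ln (real n / real (Suc n)) \<le> real n / real (Suc n) - 1" using step by (intro ln_le_minus_one) auto
  moreover have "ln (real n / real (Suc n)) = ln (real n) - ln (real (Suc n))" using step by (simp add: ln_div)
  moreover have "real n / real (Suc n) - 1 = - (1 / real (Suc n))" by (simp add: field_simps)
  ultimately show ?case using step by simp
qed auto

text \<open>The index quadruples of a fourth moment that no sign flip at a prime can annihilate.
  Steinhaus values alone would leave only a b = c d, but symmetry under negation sees just the
  parity of exponents.\<close>

definition square_quads :: "nat set \<Rightarrow> (nat \<times> nat \<times> nat \<times> nat) set" where
  "square_quads A = {(a, b, c, d). a \<in> A \<and> b \<in> A \<and> c \<in> A \<and> d \<in> A \<and> is_square (a * b * c * d)}"

lemma square_quads_mono: "A \<subseteq> B \<Longrightarrow> square_quads A \<subseteq> square_quads B"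
  by (auto simp: square_quads_def)

lemma finite_square_quads: "finite A \<Longrightarrow> finite (square_quads A)"
  by (rule finite_subset[of _ "A \<times> A \<times> A \<times> A"]) (auto simp: square_quads_def)

text \<open>If \<open>a b c d\<close> is a square and \<open>g = gcd (a b) (c d)\<close>, then \<open>a b = g u\<^sup>2\<close> and
  \<open>c d = g v\<^sup>2\<close>, so that the quadruple is determined by \<open>g\<close>, \<open>u\<close>, \<open>v\<close> and a divisor of each
  of the two products.\<close>

lemma square_quads_subset:
  "square_quads {1..M} \<subseteq> (\<Union>g\<in>{1..M\<^sup>2}. \<Union>u\<in>{u. u \<ge> 1 \<and> g * u\<^sup>2 \<le> M\<^sup>2}. \<Union>v\<in>{v. v \<ge> 1 \<and> g * v\<^sup>2 \<le> M\<^sup>2}.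
     (\<lambda>(a, c). (a, g * u\<^sup>2 div a, c, g * v\<^sup>2 div c)) ` ({a. a dvd g * u\<^sup>2} \<times> {c. c dvd g * v\<^sup>2}))"
proof clarify
  fix a b c d assume "(a, b, c, d) \<in> square_quads {1..M}"
  hence r: "a \<ge> 1" "a \<le> M" "b \<ge> 1" "b \<le> M" "c \<ge> 1" "c \<le> M" "d \<ge> 1" "d \<le> M"
    and sq: "is_square (a * b * c * d)" by (auto simp: square_quads_def)
  define g where "g = gcd (a * b) (c * d)"
  have g0: "g > 0" using r by (simp add: g_def)
  obtain x y where xy: "a * b = g * x" "c * d = g * y" "coprime x y"
    unfolding g_def using r
    by (metis gcd_coprime_exists gcd_eq_0_iff mult.commute mult_is_0 not_one_le_zero)
  have "a * b * c * d = g ^ 2 * (x * y)"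
    using xy by (metis (no_types, lifting) mult.assoc mult.left_commute power2_eq_square)
  hence "is_square (x * y)"
    using sq g0 is_nth_power_mult_cancel_left[of 2 "g ^ 2" "x * y"] by auto
  hence "is_square x" "is_square y"
    using is_nth_power_mult_coprime_nat_iff[OF xy(3), of 2] by auto
  then obtain u v where uv: "x = u\<^sup>2" "y = v\<^sup>2" by (auto elim!: is_nth_powerE)
  have ab: "a * b \<le> M\<^sup>2" "c * d \<le> M\<^sup>2" using r by (auto simp: power2_eq_square intro!: mult_mono)
  have u0: "u \<ge> 1" "v \<ge> 1" using xy uv r by (auto intro!: Suc_leI gr0I)
  have "g \<le> g * u\<^sup>2" using u0 by simp
  hence g: "g \<in> {1..M\<^sup>2}" using g0 order.trans[OF _ ab(1)[unfolded xy uv]] by simp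
  have e1: "g * u\<^sup>2 = a * b" "g * v\<^sup>2 = c * d" using xy uv by simp_all
  have hu: "u \<in> {u. u \<ge> 1 \<and> g * u\<^sup>2 \<le> M\<^sup>2}" and hv: "v \<in> {v. v \<ge> 1 \<and> g * v\<^sup>2 \<le> M\<^sup>2}"
    using u0 ab by (simp_all add: e1)
  show "(a, b, c, d) \<in> (\<Union>g\<in>{1..M\<^sup>2}. \<Union>u\<in>{u. u \<ge> 1 \<and> g * u\<^sup>2 \<le> M\<^sup>2}. \<Union>v\<in>{v. v \<ge> 1 \<and> g * v\<^sup>2 \<le> M\<^sup>2}.
     (\<lambda>(a, c). (a, g * u\<^sup>2 div a, c, g * v\<^sup>2 div c)) ` ({a. a dvd g * u\<^sup>2} \<times> {c. c dvd g * v\<^sup>2}))"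
    by (rule UN_I[OF g], rule UN_I[OF hu], rule UN_I[OF hv], rule image_eqI[of _ _ "(a, c)"])
       (use r in \<open>simp_all add: e1\<close>)
qed

text \<open>For fixed g there are at most M^2 / g pairs (u, v), the sum over g is harmonic, and
  recovering a and c costs two divisor counts. The count thus exceeds the order M^2 of the pairwise
  equal quadruples by an arbitrarily small power only.\<close>

lemma card_square_quads_le:
  assumes "\<epsilon> > 0"
  obtains C :: real where "C \<ge> 0" "\<And>M::nat. M \<ge> 1 \<Longrightarrow> real (card (square_quads {1..M})) \<le> C * real M powr (2 + \<epsilon>)"
proof -
  \<comment> \<open>Each of the two divisor counts concerns a number up to M^2 and costs M^(2
    \<delta>); the logarithm costs M^\<delta>. Together this is 5 \<delta>.\<close>
  define \<delta> where "\<delta> = \<epsilon> / 5"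
  have d0: "\<delta> > 0" using assms by (simp add: \<delta>_def)
  obtain K :: real where K: "K \<ge> 1" "\<And>n::nat. n > 0 \<Longrightarrow> real (card {d. d dvd n}) \<le> K * real n powr \<delta>"
    using divisor_bound[OF d0] by blast
  show ?thesis
  proof (rule that[of "K\<^sup>2 * (1 + 2 / \<delta>)"])
    show "0 \<le> K\<^sup>2 * (1 + 2 / \<delta>)" using d0 by simp
    fix M :: nat assume M: "M \<ge> 1"
    define D where "D = K * real M powr (2 * \<delta>)"
    define W where "W g = {u::nat. u \<ge> 1 \<and> g * u\<^sup>2 \<le> M\<^sup>2}" for g
    have D0: "D \<ge> 0" using K by (simp add: D_def)
    have Wsub: "W g \<subseteq> {1..nat \<lfloor>real M / sqrt (real g)\<rfloor>}" if "g \<ge> 1" for g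
    proof
      fix u assume u: "u \<in> W g"
      hence "real g * (real u)\<^sup>2 \<le> (real M)\<^sup>2"
        unfolding W_def by (simp flip: of_nat_power of_nat_mult)
      hence "(real u * sqrt (real g))\<^sup>2 \<le> (real M)\<^sup>2" by (simp add: power_mult_distrib mult.commute)
      hence "real u * sqrt (real g) \<le> real M" by (rule power2_le_imp_le) simp
      hence "real u \<le> real M / sqrt (real g)" using that by (simp add: field_simps)
      thus "u \<in> {1..nat \<lfloor>real M / sqrt (real g)\<rfloor>}" using u by (auto simp: W_def le_nat_floor)
    qed
    have finW: "finite (W g)" if "g \<ge> 1" for g using Wsub[OF that] finite_subset by blast
    have cardW: "(real (card (W g)))\<^sup>2 \<le> (real M)\<^sup>2 * (1 / real g)" if "g \<ge> 1" for g
    proof -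
      have "card (W g) \<le> nat \<lfloor>real M / sqrt (real g)\<rfloor>" using card_mono[OF _ Wsub[OF that]] by simp
      hence "real (card (W g)) \<le> real (nat \<lfloor>real M / sqrt (real g)\<rfloor>)" by (rule of_nat_mono)
      also have "\<dots> \<le> real M / sqrt (real g)" by (rule of_nat_floor) simp
      finally have "real (card (W g)) \<le> real M / sqrt (real g)" .
      hence "(real (card (W g)))\<^sup>2 \<le> (real M / sqrt (real g))\<^sup>2" by (intro power_mono) auto
      thus ?thesis using that by (simp add: power_divide)
    qed
    have div: "real (card {a. a dvd g * u\<^sup>2}) \<le> D" if "g \<ge> 1" "u \<in> W g" for g u
    proof -
      have "real (card {a. a dvd g * u\<^sup>2}) \<le> K * real (g * u\<^sup>2) powr \<delta>"
        using that by (intro K(2)) (auto simp: W_def)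
      also have "\<dots> \<le> K * real (M\<^sup>2) powr \<delta>"
        using that K d0 by (intro mult_left_mono powr_mono2 of_nat_mono) (auto simp: W_def)
      also have "real (M\<^sup>2) powr \<delta> = real M powr (2 * \<delta>)"
        using M by (simp add: powr_powr flip: powr_numeral)
      finally show ?thesis by (simp add: D_def)
    qed
    let ?F = "\<lambda>g u v. (\<lambda>(a, c). (a, g * u\<^sup>2 div a, c, g * v\<^sup>2 div c)) ` ({a. a dvd g * u\<^sup>2} \<times> {c. c dvd g * v\<^sup>2})"
    have finF: "finite (?F g u v)" if "g \<ge> 1" "u \<in> W g" "v \<in> W g" for g u v
      using that by (intro finite_imageI finite_cartesian_product finite_divisors_nat) (auto simp: W_def)
    have cF: "real (card (?F g u v)) \<le> D\<^sup>2" if "g \<ge> 1" "u \<in> W g" "v \<in> W g" for g u v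
    proof -
      have "card (?F g u v) \<le> card ({a. a dvd g * u\<^sup>2} \<times> {c. c dvd g * v\<^sup>2})"
        using that by (intro card_image_le finite_cartesian_product finite_divisors_nat) (auto simp: W_def)
      hence "real (card (?F g u v)) \<le> real (card {a. a dvd g * u\<^sup>2}) * real (card {c. c dvd g * v\<^sup>2})"
        by (simp add: card_cartesian_product flip: of_nat_mult)
      also have "\<dots> \<le> D * D" using that D0 by (intro mult_mono div) auto
      finally show ?thesis by (simp add: power2_eq_square)
    qed
    have "real (card (square_quads {1..M})) \<le> real (card (\<Union>g\<in>{1..M\<^sup>2}. \<Union>u\<in>W g. \<Union>v\<in>W g. ?F g u v))"
    proof (intro of_nat_mono card_mono)
      show "square_quads {1..M} \<subseteq> (\<Union>g\<in>{1..M\<^sup>2}. \<Union>u\<in>W g. \<Union>v\<in>W g. ?F g u v)"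
        unfolding W_def by (rule square_quads_subset)
      show "finite (\<Union>g\<in>{1..M\<^sup>2}. \<Union>u\<in>W g. \<Union>v\<in>W g. ?F g u v)"
        by (intro finite_UN_I finite_atLeastAtMost finW finF) simp_all
    qed
    also have "\<dots> \<le> real (\<Sum>g\<in>{1..M\<^sup>2}. \<Sum>u\<in>W g. \<Sum>v\<in>W g. card (?F g u v))"
      by (intro of_nat_mono order.trans[OF card_UN_le] sum_mono finite_atLeastAtMost finW order.refl) simp_all
    also have "\<dots> \<le> (\<Sum>g\<in>{1..M\<^sup>2}. \<Sum>u\<in>W g. \<Sum>v\<in>W g. D\<^sup>2)"
      unfolding of_nat_sum by (intro sum_mono cF) auto
    also have "\<dots> = (\<Sum>g\<in>{1..M\<^sup>2}. (real (card (W g)))\<^sup>2 * D\<^sup>2)" by (simp add: power2_eq_square mult.assoc)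
    also have "\<dots> \<le> (\<Sum>g\<in>{1..M\<^sup>2}. (real M)\<^sup>2 * (1 / real g) * D\<^sup>2)"
      using cardW by (intro sum_mono mult_right_mono) auto
    also have "\<dots> = (real M)\<^sup>2 * D\<^sup>2 * (\<Sum>g=1..M\<^sup>2. 1 / real g)" by (simp add: sum_distrib_left mult_ac)
    also have "\<dots> \<le> (real M)\<^sup>2 * D\<^sup>2 * ((1 + 2 / \<delta>) * real M powr \<delta>)"
    proof (intro mult_left_mono)
      have "(\<Sum>g=1..M\<^sup>2. 1 / real g) \<le> 1 + ln (real (M\<^sup>2))" using M by (intro sum_inverse_le_ln) simp
      also have "ln (real (M\<^sup>2)) = 2 * ln (real M)" using M by (simp add: ln_realpow)
      also have "\<dots> \<le> 2 * (real M powr \<delta> / \<delta>)" using M d0 by (intro mult_left_mono ln_powr_bound) auto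
      also have "1 + \<dots> \<le> real M powr \<delta> + 2 * (real M powr \<delta> / \<delta>)" using M d0 by (simp add: ge_one_powr_ge_zero)
      finally show "(\<Sum>g=1..M\<^sup>2. 1 / real g) \<le> (1 + 2 / \<delta>) * real M powr \<delta>" by (simp add: algebra_simps)
    qed auto
    also have "\<dots> = K\<^sup>2 * (1 + 2 / \<delta>) * ((real M)\<^sup>2 * (real M powr (2 * \<delta>))\<^sup>2 * real M powr \<delta>)"
      by (simp add: D_def power_mult_distrib mult_ac)
    also have "(real M)\<^sup>2 * (real M powr (2 * \<delta>))\<^sup>2 * real M powr \<delta> = real M powr (2 + \<epsilon>)"
    proof -
      have "(real M)\<^sup>2 = real M powr 2" using M by simp
      moreover have "(real M powr (2 * \<delta>))\<^sup>2 = real M powr (4 * \<delta>)" by (simp add: power2_eq_square flip: powr_add)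
      ultimately have "(real M)\<^sup>2 * (real M powr (2 * \<delta>))\<^sup>2 * real M powr \<delta> = real M powr (2 + 4 * \<delta> + \<delta>)"
        by (simp only: powr_add)
      also have "2 + 4 * \<delta> + \<delta> = 2 + \<epsilon>" by (simp add: \<delta>_def)
      finally show ?thesis .
    qed
    finally show "real (card (square_quads {1..M})) \<le> K\<^sup>2 * (1 + 2 / \<delta>) * real M powr (2 + \<epsilon>)" .
  qed
qed

section \<open>Integers with a large prime factor\<close>

lemma card_multiples: "card {n \<in> {1..N}. d dvd n} = N div d" if "d > 0" for d N :: nat
proof -
  have "{n \<in> {1..N}. d dvd n} = (\<lambda>k. d * k) ` {1..N div d}"
    using that by (auto simp: image_iff less_eq_div_iff_mult_less_eq mult.commute elim!: dvdE)
  moreover have "inj_on (\<lambda>k. d * k) {1..N div d}" using that by (auto intro!: inj_onI)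
  ultimately show ?thesis by (simp add: card_image)
qed

text \<open>As in Legendre's formula the sum equals that of N div p^k over k \<ge> 1, and a
  geometric series with ratio at most 1/2 is at most twice its first term.\<close>

lemma sum_multiplicity_le:
  fixes p N :: nat
  assumes "prime p"
  shows "(\<Sum>n=1..N. real (multiplicity p n)) \<le> 2 * real N / real p"
proof -
  have p2: "p \<ge> 2" using assms by (rule prime_ge_2_nat)
  have m: "real (multiplicity p n) = (\<Sum>k=1..N. if p ^ k dvd n then 1 else 0)" if "n \<in> {1..N}" for n
  proof -
    have "multiplicity p n \<le> N"
    proof -
      have "multiplicity p n < p ^ multiplicity p n" using p2 by (intro power_gt_expt) simp
      also have "p ^ multiplicity p n \<le> n" using that by (intro dvd_imp_le multiplicity_dvd) auto
      finally show ?thesis using that by simp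
    qed
    hence "{k \<in> {1..N}. p ^ k dvd n} = {1..multiplicity p n}"
      using that p2 by (auto simp: power_dvd_iff_le_multiplicity)
    thus ?thesis by (simp add: sum.If_cases Int_def)
  qed
  have geo: "(\<Sum>k=1..L. (1 / real p) ^ k) \<le> 2 / real p" for L
  proof -
    define x where "x = 1 / real p"
    have x: "0 < x" "x \<le> 1/2" using p2 by (auto simp: x_def field_simps)
    \<comment> \<open>The subtracted term is what lets the induction close; its step uses x \<le>
      1/2.\<close>
    have "(\<Sum>k=1..L. x ^ k) \<le> 2 * x - 2 * x * x ^ L"
    proof (induction L)
      case 0 thus ?case using x by simp
    next
      case (Suc L)
      have "x ^ L * x * x \<le> x ^ L * x * (1/2)" using x by (intro mult_left_mono) auto
      thus ?case using Suc by (simp add: algebra_simps)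
    qed
    also have "\<dots> \<le> 2 * x" using x by simp
    finally show ?thesis by (simp add: x_def)
  qed
  have "(\<Sum>n=1..N. real (multiplicity p n)) = (\<Sum>n=1..N. \<Sum>k=1..N. if p ^ k dvd n then 1 else 0)"
    by (intro sum.cong refl m)
  also have "\<dots> = (\<Sum>k=1..N. \<Sum>n=1..N. if p ^ k dvd n then 1 else 0)" by (rule sum.swap)
  also have "\<dots> = (\<Sum>k=1..N. real (card {n \<in> {1..N}. p ^ k dvd n}))"
    by (simp add: sum.If_cases Int_def)
  also have "\<dots> = (\<Sum>k=1..N. real (N div p ^ k))" using p2 by (subst card_multiples) auto
  also have "\<dots> \<le> (\<Sum>k=1..N. real N * (1 / real p) ^ k)"
  proof (rule sum_mono)
    fix k
    show "real (N div p ^ k) \<le> real N * (1 / real p) ^ k"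
      using of_nat_div_le_of_nat[of N "p ^ k", where 'a = real] by (simp add: power_one_over)
  qed
  also have "\<dots> \<le> real N * (2 / real p)"
    unfolding sum_distrib_left[symmetric] by (intro mult_left_mono geo) auto
  finally show ?thesis by (simp add: mult.commute)
qed

lemma ln_eq_sum_prime_factors:
  fixes n :: nat
  assumes "n > 0"
  shows "ln (real n) = (\<Sum>p\<in>prime_factors n. real (multiplicity p n) * ln (real p))"
proof -
  have "real n = (\<Prod>p\<in>prime_factors n. real p ^ multiplicity p n)"
    using prod_prime_factors[of n] assms by (simp flip: of_nat_power of_nat_prod)
  hence "ln (real n) = ln (\<Prod>p\<in>prime_factors n. real p ^ multiplicity p n)" by simp
  also have "\<dots> = (\<Sum>p\<in>prime_factors n. ln (real p ^ multiplicity p n))"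
    by (intro ln_prod) (auto simp: prime_gt_0_nat in_prime_factors_iff)
  also have "\<dots> = (\<Sum>p\<in>prime_factors n. real (multiplicity p n) * ln (real p))"
    by (intro sum.cong refl ln_realpow)
  finally show ?thesis .
qed

text \<open>An upper bound of Mertens type. The sum of (y div p) ln p over p \<le> y counts every
  prime divisor of every n \<le> y once, with weight ln p, hence is at most y ln y; and y div p
  \<ge> y / (2 p) because p \<le> y.\<close>

lemma sum_ln_prime_over_prime_le:
  assumes "y \<ge> 1"
  shows "(\<Sum>p | prime p \<and> p \<le> y. ln (real p) / real p) \<le> 2 * ln (real y)"
proof -
  let ?P = "{p. prime p \<and> p \<le> y}"
  have fin: "finite ?P" by (rule finite_subset[of _ "{..y}"]) auto
  have "(\<Sum>p\<in>?P. ln (real p) * (real y / (2 * real p))) \<le> (\<Sum>p\<in>?P. ln (real p) * real (y div p))"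
  proof (intro sum_mono mult_left_mono)
    fix p assume p: "p \<in> ?P"
    hence p0: "p \<ge> 2" by (auto intro: prime_ge_2_nat)
    have "y < p * (y div p) + p" using p0 by (metis add_strict_left_mono mod_less_divisor mult_div_mod_eq not_gr_zero not_numeral_le_zero)
    also have "\<dots> \<le> p * (y div p) + p * (y div p)" using p p0 by (simp add: div_greater_zero_iff Suc_le_eq)
    finally have "real y \<le> real (p * (y div p) + p * (y div p))" by linarith
    thus "real y / (2 * real p) \<le> real (y div p)" using p0 by (simp add: field_simps)
    show "0 \<le> ln (real p)" using p0 by simp
  qed
  also have "\<dots> = (\<Sum>p\<in>?P. \<Sum>n=1..y. if p dvd n then ln (real p) else 0)"
    by (intro sum.cong refl) (use card_multiples[of _ y] in \<open>auto simp: sum.If_cases Int_def prime_gt_0_nat\<close>)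
  also have "\<dots> = (\<Sum>n=1..y. \<Sum>p\<in>?P. if p dvd n then ln (real p) else 0)" by (rule sum.swap)
  also have "\<dots> \<le> (\<Sum>n=1..y. ln (real y))"
  proof (rule sum_mono)
    fix n assume n: "n \<in> {1..y}"
    have "(\<Sum>p\<in>?P. if p dvd n then ln (real p) else 0) = (\<Sum>p\<in>{p\<in>?P. p dvd n}. ln (real p))"
      using fin by (simp add: sum.If_cases Int_def)
    also have "{p\<in>?P. p dvd n} = prime_factors n"
      using n by (auto simp: in_prime_factors_iff intro: order.trans[OF dvd_imp_le])
    also have "(\<Sum>p\<in>prime_factors n. ln (real p)) \<le> (\<Sum>p\<in>prime_factors n. real (multiplicity p n) * ln (real p))"
    proof (rule sum_mono)
      fix p assume p: "p \<in> prime_factors n"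
      hence "multiplicity p n \<ge> 1" using n by (auto simp: in_prime_factors_iff Suc_le_eq prime_multiplicity_gt_zero_iff)
      moreover have "p \<ge> 1" using p by (auto simp: in_prime_factors_iff prime_ge_1_nat)
      ultimately show "ln (real p) \<le> real (multiplicity p n) * ln (real p)"
        using mult_right_mono[of 1 "real (multiplicity p n)" "ln (real p)"] by simp
    qed
    also have "\<dots> = ln (real n)" using n by (intro ln_eq_sum_prime_factors[symmetric]) auto
    also have "\<dots> \<le> ln (real y)" using n by simp
    finally show "(\<Sum>p\<in>?P. if p dvd n then ln (real p) else 0) \<le> ln (real y)" .
  qed
  also have "\<dots> = real y * ln (real y)" by simp
  also have "(\<Sum>p\<in>?P. ln (real p) * (real y / (2 * real p))) = (real y / 2) * (\<Sum>p\<in>?P. ln (real p) / real p)"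
    by (simp add: sum_distrib_left mult_ac)
  finally have "real y * (\<Sum>p\<in>?P. ln (real p) / real p) \<le> real y * (2 * ln (real y))" by simp
  thus ?thesis using assms by simp
qed

text \<open>The sum of ln n over these n is spread over the primes up to y and is at most 4 N ln y.
  Each n above sqrt N contributes at least half of ln N, so there are few of them. For y =
  N^\<delta> the second term is 8 \<delta> N.\<close>

lemma card_smooth_le:
  fixes N y :: nat
  assumes "y \<ge> 1" "N \<ge> 2"
  shows "real (card {n \<in> {1..N}. \<forall>q\<in>prime_factors n. q \<le> y})
     \<le> sqrt (real N) + 8 * real N * ln (real y) / ln (real N)"
proof -
  let ?S = "{n \<in> {1..N}. \<forall>q\<in>prime_factors n. q \<le> y}"
  let ?P = "{p. prime p \<and> p \<le> y}"
  have finP: "finite ?P" by (rule finite_subset[of _ "{..y}"]) auto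
  have lnp: "0 \<le> ln (real p)" if "prime p" for p using prime_ge_1_nat[OF that] by simp
  have lnN: "ln (real N) > 0" using assms by simp
  have "(\<Sum>n\<in>?S. ln (real n)) \<le> (\<Sum>n\<in>?S. \<Sum>p\<in>?P. real (multiplicity p n) * ln (real p))"
  proof (rule sum_mono)
    fix n assume n: "n \<in> ?S"
    have "ln (real n) = (\<Sum>p\<in>prime_factors n. real (multiplicity p n) * ln (real p))"
      using n by (intro ln_eq_sum_prime_factors) auto
    also have "\<dots> \<le> (\<Sum>p\<in>?P. real (multiplicity p n) * ln (real p))"
      using n finP by (intro sum_mono2) (auto simp: in_prime_factors_iff intro!: mult_nonneg_nonneg lnp)
    finally show "ln (real n) \<le> (\<Sum>p\<in>?P. real (multiplicity p n) * ln (real p))" .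
  qed
  also have "\<dots> \<le> (\<Sum>n=1..N. \<Sum>p\<in>?P. real (multiplicity p n) * ln (real p))"
    by (intro sum_mono2 sum_nonneg mult_nonneg_nonneg) (auto intro!: lnp)
  also have "\<dots> = (\<Sum>p\<in>?P. (\<Sum>n=1..N. real (multiplicity p n)) * ln (real p))"
    by (subst sum.swap) (simp add: sum_distrib_right)
  also have "\<dots> \<le> (\<Sum>p\<in>?P. 2 * real N / real p * ln (real p))"
    using sum_multiplicity_le by (intro sum_mono mult_right_mono) (auto intro!: lnp)
  also have "\<dots> = 2 * real N * (\<Sum>p\<in>?P. ln (real p) / real p)" by (simp add: sum_distrib_left mult_ac)
  also have "\<dots> \<le> 2 * real N * (2 * ln (real y))"
    by (intro mult_left_mono sum_ln_prime_over_prime_le assms) auto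
  finally have up: "(\<Sum>n\<in>?S. ln (real n)) \<le> 4 * real N * ln (real y)" by simp
  let ?L = "{n \<in> ?S. sqrt (real N) < real n}"
  have "real (card ?L) * (ln (real N) / 2) = (\<Sum>n\<in>?L. ln (sqrt (real N)))" using assms by (simp add: ln_sqrt)
  also have "\<dots> \<le> (\<Sum>n\<in>?L. ln (real n))" using assms by (intro sum_mono ln_mono) auto
  also have "\<dots> \<le> (\<Sum>n\<in>?S. ln (real n))" by (intro sum_mono2) auto
  finally have "real (card ?L) * (ln (real N) / 2) \<le> 4 * real N * ln (real y)" using up by linarith
  hence L: "real (card ?L) \<le> 8 * real N * ln (real y) / ln (real N)" using lnN by (simp add: field_simps)
  have "?S \<subseteq> {1..nat \<lfloor>sqrt (real N)\<rfloor>} \<union> ?L"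
    using le_nat_floor[of _ "sqrt (real N)"] not_less by (auto, blast)
  hence "card ?S \<le> card ({1..nat \<lfloor>sqrt (real N)\<rfloor>} \<union> ?L)" by (intro card_mono) auto
  also have "\<dots> \<le> nat \<lfloor>sqrt (real N)\<rfloor> + card ?L" using card_Un_le[of "{1..nat \<lfloor>sqrt (real N)\<rfloor>}" ?L] by simp
  finally have "real (card ?S) \<le> real (nat \<lfloor>sqrt (real N)\<rfloor>) + real (card ?L)" by linarith
  also have "real (nat \<lfloor>sqrt (real N)\<rfloor>) \<le> sqrt (real N)" by (rule of_nat_floor) simp
  finally show ?thesis using L by linarith
qed

lemma sum_inverse_squares_le:
  assumes "y \<ge> 1" "finite P" "\<And>p. p \<in> P \<Longrightarrow> y < p"
  shows "(\<Sum>p\<in>P. 1 / (real p)\<^sup>2) \<le> 1 / real y"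
proof -
  have tele: "(\<Sum>k\<in>{y<..y+L}. 1 / (real k)\<^sup>2) \<le> 1 / real y - 1 / real (y + L)" for L
  proof (induction L)
    case (Suc L)
    have "{y<..y+Suc L} = insert (y + Suc L) {y<..y+L}" by auto
    hence "(\<Sum>k\<in>{y<..y+Suc L}. 1 / (real k)\<^sup>2) = 1 / (real (y + Suc L))\<^sup>2 + (\<Sum>k\<in>{y<..y+L}. 1 / (real k)\<^sup>2)" by simp
    moreover have "1 / (real (y + Suc L))\<^sup>2 \<le> 1 / real (y + L) - 1 / real (y + Suc L)"
    proof -
      define z where "z = real (y + L)"
      have "z > 0" using assms(1) by (simp add: z_def)
      hence "1 / (z + 1)\<^sup>2 \<le> 1 / z - 1 / (z + 1)"
        by (simp add: divide_simps power2_eq_square)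
      thus ?thesis by (simp add: z_def add_ac)
    qed
    ultimately show ?case using Suc by linarith
  qed auto
  have "P \<subseteq> {y<..y + Max (insert 0 P)}"
    using assms by (auto intro!: trans_le_add2 Max_ge)
  hence "(\<Sum>p\<in>P. 1 / (real p)\<^sup>2) \<le> (\<Sum>k\<in>{y<..y+Max (insert 0 P)}. 1 / (real k)\<^sup>2)"
    by (intro sum_mono2) auto
  also have "\<dots> \<le> 1 / real y - 1 / real (y + Max (insert 0 P))" by (rule tele)
  also have "\<dots> \<le> 1 / real y" by simp
  finally show ?thesis .
qed

text \<open>If k distinct primes above y \<ge> j divide n, then j^k \<le> n. This bounds,
  independently of j, how many increments can share a nonzero frequency.\<close>

lemma card_large_prime_divisors:
  fixes n y j A :: nat
  assumes "n > 0" "n \<le> j ^ A" "j \<ge> 2" "j \<le> y"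
  shows "card {p \<in> prime_factors n. y < p} \<le> A"
proof -
  let ?Q = "{p \<in> prime_factors n. y < p}"
  have "j ^ card ?Q = (\<Prod>p\<in>?Q. j)" by simp
  also have "\<dots> \<le> (\<Prod>p\<in>?Q. p ^ multiplicity p n)"
  proof (rule prod_mono, safe)
    fix p assume p: "p \<in> prime_factors n" "y < p"
    have "multiplicity p n \<ge> 1" using p assms by (auto simp: in_prime_factors_iff Suc_le_eq prime_multiplicity_gt_zero_iff)
    hence "p ^ 1 \<le> p ^ multiplicity p n" using p by (intro power_increasing) auto
    thus "j \<le> p ^ multiplicity p n" using p assms by simp
  qed
  also have "\<dots> \<le> (\<Prod>p\<in>prime_factors n. p ^ multiplicity p n)"
    by (intro dvd_imp_le prod_dvd_prod_subset prod_pos) (auto simp: in_prime_factors_iff prime_gt_0_nat)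
  also have "\<dots> = n" using prod_prime_factors[of n] assms by simp
  finally have "j ^ card ?Q \<le> n" .
  from power_le_imp_le_exp[OF _ order.trans[OF this assms(2)]] show ?thesis using assms(3) by simp
qed

section \<open>Factorization by the largest prime factor\<close>

definition large_primes :: "nat \<Rightarrow> nat \<Rightarrow> nat set" where
  "large_primes N y = {p. prime p \<and> y < p \<and> p \<le> N}"

text \<open>The strict inequality makes p the largest prime factor of p m and a simple one, so that
  X (p m) is linear in X p and otherwise involves smaller primes only.\<close>

definition cofactors :: "nat \<Rightarrow> nat \<Rightarrow> nat set" where
  "cofactors N p = {m. m \<ge> 1 \<and> p * m \<le> N \<and> (\<forall>q\<in>prime_factors m. q < p)}"

lemma finite_large_primes [simp]: "finite (large_primes N y)"
  by (rule finite_subset[of _ "{..N}"]) (auto simp: large_primes_def)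

lemma cofactors_subset: "p > 0 \<Longrightarrow> cofactors N p \<subseteq> {1..N div p}"
  by (auto simp: cofactors_def less_eq_div_iff_mult_less_eq mult.commute)

lemma finite_cofactors: "p > 0 \<Longrightarrow> finite (cofactors N p)"
  using cofactors_subset finite_subset by blast

text \<open>p is recovered as the largest prime factor of p m: a larger prime from a second
  factorization would have to divide m.\<close>

lemma inj_on_prime_times_cofactor:
  "inj_on (\<lambda>(p, m). p * m) (SIGMA p:large_primes N y. cofactors N p)"
proof (rule inj_onI, clarify)
  have *: "p = q" if "p \<in> large_primes N y" "q \<in> large_primes N y" "m \<in> cofactors N p" "k \<in> cofactors N q"
    and eq: "p * m = q * k" and "p \<le> q" for p q m k
  proof (rule ccontr)
    assume "p \<noteq> q"
    have "q dvd p * m" using eq by simp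
    moreover have "\<not> q dvd p" using that \<open>p \<noteq> q\<close> primes_dvd_imp_eq[of q p] by (auto simp: large_primes_def)
    ultimately have "q dvd m" using that prime_dvd_mult_iff[of q p m] by (auto simp: large_primes_def)
    hence "q \<in> prime_factors m" using that by (auto simp: large_primes_def cofactors_def in_prime_factors_iff)
    thus False using that by (auto simp: cofactors_def)
  qed
  fix p m q k assume "p \<in> large_primes N y" "m \<in> cofactors N p" "q \<in> large_primes N y" "k \<in> cofactors N q" "p * m = q * k"
  moreover from this have "p = q" using *[of p q m k] *[of q p k m] by (cases "p \<le> q") auto
  ultimately show "p = q \<and> m = k" by (auto simp: large_primes_def)
qed

text \<open>The integers up to N whose largest prime factor exceeds y and divides them exactly once;
  they are the ones retained in the martingale.\<close>

definition covered :: "nat \<Rightarrow> nat \<Rightarrow> nat set" where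
  "covered N y = (\<lambda>(p, m). p * m) ` (SIGMA p:large_primes N y. cofactors N p)"

lemma covered_subset: "covered N y \<subseteq> {1..N}"
  by (auto simp: covered_def cofactors_def large_primes_def prime_gt_0_nat Suc_le_eq)

text \<open>An integer is missed when all its prime factors are at most y, or when its largest prime
  factor p > y occurs at least twice. The second kind is counted by the sum of N / p^2 over p >
  y.\<close>

lemma card_uncovered_le:
  fixes N y :: nat
  assumes "y \<ge> 1" "N \<ge> 2"
  shows "real (card ({1..N} - covered N y))
     \<le> sqrt (real N) + 8 * real N * ln (real y) / ln (real N) + real N / real y"
proof -
  let ?S = "{n \<in> {1..N}. \<forall>q\<in>prime_factors n. q \<le> y}"
  have sub: "{1..N} - covered N y \<subseteq> ?S \<union> (\<Union>p\<in>large_primes N y. {n \<in> {1..N}. p\<^sup>2 dvd n})"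
  proof
    fix n assume n: "n \<in> {1..N} - covered N y"
    show "n \<in> ?S \<union> (\<Union>p\<in>large_primes N y. {n \<in> {1..N}. p\<^sup>2 dvd n})"
    proof (cases "n \<in> ?S")
      case False
      then obtain q where q: "q \<in> prime_factors n" "y < q" using n by auto
      define p where "p = Max (prime_factors n)"
      have p: "p \<in> prime_factors n" unfolding p_def using q by (intro Max_in) auto
      have "q \<le> p" unfolding p_def using q by (intro Max_ge) auto
      hence py: "y < p" using q by simp
      have pp: "prime p" "p dvd n" using p by (auto simp: in_prime_factors_iff)
      have pN: "p \<in> large_primes N y" using pp py n dvd_imp_le[OF pp(2)] by (auto simp: large_primes_def)
      obtain m where m: "n = p * m" using pp by (elim dvdE)
      have m0: "m \<ge> 1" using m n by (cases m) auto
      have "m \<notin> cofactors N p"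
      proof
        assume "m \<in> cofactors N p"
        hence "n \<in> covered N y" unfolding covered_def m using pN by (auto intro!: image_eqI[of _ _ "(p, m)"])
        thus False using n by simp
      qed
      \<comment> \<open>r divides n, so it cannot exceed the largest prime factor p. Hence r = p,
        and p^2 divides n.\<close>
      then obtain r where r: "r \<in> prime_factors m" "r \<ge> p" using m0 m n by (auto simp: cofactors_def not_less)
      have "r \<in> prime_factors n" using r n m by (auto simp: in_prime_factors_iff)
      hence "r \<le> p" unfolding p_def by (intro Max_ge) auto
      hence "p dvd m" using r by (auto simp: in_prime_factors_iff)
      hence "p\<^sup>2 dvd n" unfolding m power2_eq_square by (intro mult_dvd_mono) auto
      thus ?thesis using pN n by auto
    qed auto
  qed
  have "real (card ({1..N} - covered N y)) \<le> real (card (?S \<union> (\<Union>p\<in>large_primes N y. {n \<in> {1..N}. p\<^sup>2 dvd n})))"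
    by (intro of_nat_mono card_mono sub) auto
  also have "\<dots> \<le> real (card ?S + (\<Sum>p\<in>large_primes N y. card {n \<in> {1..N}. p\<^sup>2 dvd n}))"
    by (intro of_nat_mono order.trans[OF card_Un_le] add_mono card_UN_le) auto
  also have "\<dots> = real (card ?S) + (\<Sum>p\<in>large_primes N y. real (card {n \<in> {1..N}. p\<^sup>2 dvd n}))" by simp
  also have "(\<Sum>p\<in>large_primes N y. real (card {n \<in> {1..N}. p\<^sup>2 dvd n})) \<le> (\<Sum>p\<in>large_primes N y. real N * (1 / (real p)\<^sup>2))"
  proof (rule sum_mono)
    fix p assume "p \<in> large_primes N y"
    hence "p\<^sup>2 > 0" by (auto simp: large_primes_def)
    hence "real (card {n \<in> {1..N}. p\<^sup>2 dvd n}) = real (N div p\<^sup>2)" by (simp only: card_multiples)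
    also have "\<dots> \<le> real N / real (p\<^sup>2)" by (rule of_nat_div_le_of_nat)
    finally show "real (card {n \<in> {1..N}. p\<^sup>2 dvd n}) \<le> real N * (1 / (real p)\<^sup>2)" by simp
  qed
  also have "\<dots> \<le> real N * (1 / real y)"
    unfolding sum_distrib_left[symmetric]
    by (intro mult_left_mono sum_inverse_squares_le assms) (auto simp: large_primes_def)
  finally show ?thesis using card_smooth_le[OF assms] by simp
qed

lemma card_covered: "card (covered N y) = (\<Sum>p\<in>large_primes N y. card (cofactors N p))"
  unfolding covered_def card_image[OF inj_on_prime_times_cofactor]
  by (intro card_SigmaI finite_large_primes ballI finite_cofactors) (auto simp: large_primes_def prime_gt_0_nat)

section \<open>Symmetric random multiplicative functions\<close>

lemma borel_measurable_cnj [measurable]: "cnj \<in> borel_measurable borel"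
  by (intro borel_measurable_continuous_onI continuous_intros)

text \<open>Taking the real part adds the frequencies - n with conjugate coefficients and halves all
  coefficients. As every n is positive, the two families are disjoint and avoid 0, so the mean
  vanishes and the energy is exactly halved.\<close>

lemma trig_spectrum_Re:
  fixes b :: "nat \<Rightarrow> complex"
  assumes "finite B" "\<And>n. n \<in> B \<Longrightarrow> n > 0"
  shows "trig_spectrum (int ` B \<union> (\<lambda>n. - int n) ` B)
           (\<lambda>\<theta>. of_real (Re (\<Sum>n\<in>B. b n * e_exp (real n * \<theta>))))" (is ?spec)
    and "(\<integral>\<theta>. (Re (\<Sum>n\<in>B. b n * e_exp (real n * \<theta>)))\<^sup>2 \<partial>unit_uniform) = (\<Sum>n\<in>B. (norm (b n))\<^sup>2) / 2" (is ?int)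
proof -
  define a where "a h = (if h > 0 then b (nat h) else cnj (b (nat (- h)))) / 2" for h :: int
  let ?H = "int ` B \<union> (\<lambda>n. - int n) ` B"
  have disj: "int ` B \<inter> (\<lambda>n. - int n) ` B = {}" using assms(2) by fastforce
  have inj: "inj_on int B" "inj_on (\<lambda>n. - int n) B" by (auto intro!: inj_onI)
  have split: "(\<Sum>h\<in>?H. f h) = (\<Sum>n\<in>B. f (int n)) + (\<Sum>n\<in>B. f (- int n))" for f :: "int \<Rightarrow> 'b :: comm_monoid_add"
    using assms(1) disj inj by (simp add: sum.union_disjoint sum.reindex)
  have a1: "a (int n) = b n / 2" "a (- int n) = cnj (b n) / 2" if "n \<in> B" for n
    using assms(2)[OF that] by (auto simp: a_def)
  have rep: "of_real (Re (\<Sum>n\<in>B. b n * e_exp (real n * \<theta>))) = (\<Sum>h\<in>?H. a h * e_exp (of_int h * \<theta>))" for \<theta>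
  proof -
    have "of_real (Re (\<Sum>n\<in>B. b n * e_exp (real n * \<theta>)))
       = (\<Sum>n\<in>B. b n / 2 * e_exp (real n * \<theta>)) + (\<Sum>n\<in>B. cnj (b n) / 2 * e_exp (- (real n * \<theta>)))"
    proof -
      have "complex_of_real (Re z) = z / 2 + cnj z / 2" for z by (simp add: complex_eq_iff)
      thus ?thesis by (simp only: cnj_sum sum_divide_distrib complex_cnj_mult cnj_e_exp times_divide_eq_left)
    qed
    also have "\<dots> = (\<Sum>h\<in>?H. a h * e_exp (of_int h * \<theta>))"
      unfolding split using a1 by (auto intro!: arg_cong2[of _ _ _ _ "(+)"] sum.cong)
    finally show ?thesis .
  qed
  show ?spec unfolding trig_spectrum_def using rep by blast
  have "(\<integral>\<theta>. (Re (\<Sum>n\<in>B. b n * e_exp (real n * \<theta>)))\<^sup>2 \<partial>unit_uniform)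
      = (\<integral>\<theta>. (norm (\<Sum>h\<in>?H. a h * e_exp (of_int h * \<theta>)))\<^sup>2 \<partial>unit_uniform)"
    unfolding rep[symmetric] norm_of_real by simp
  also have "\<dots> = (\<Sum>h\<in>?H. (norm (a h))\<^sup>2)" using assms(1) by (intro parseval_finite) auto
  also have "\<dots> = (\<Sum>n\<in>B. (norm (b n))\<^sup>2 / 4) + (\<Sum>n\<in>B. (norm (b n))\<^sup>2 / 4)"
    unfolding split
    by (intro arg_cong2[of _ _ _ _ "(+)"] sum.cong refl) (simp_all add: a1 norm_divide power_divide)
  also have "\<dots> = (\<Sum>n\<in>B. (norm (b n))\<^sup>2) / 2" by (simp flip: sum_divide_distrib)
  finally show ?int .
qed

lemma (in prob_space) square_expectation_le:
  fixes f :: "'a \<Rightarrow> real"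
  assumes "integrable M f" "integrable M (\<lambda>x. (f x)\<^sup>2)"
  shows "(expectation f)\<^sup>2 \<le> expectation (\<lambda>x. (f x)\<^sup>2)"
    and "expectation (\<lambda>x. (f x - expectation f)\<^sup>2) \<le> expectation (\<lambda>x. (f x)\<^sup>2)"
  using variance_eq[OF assms] variance_positive[of f] by auto

text \<open>The common ground of the two models. The measure preserving maps \<open>T p\<close>
  replace conditional expectations: what \<open>T p\<close> leaves unchanged acts as the past, and a
  factor that \<open>T p\<close> reverses has mean 0 against it.\<close>

locale symmetric_multiplicative = prob_space M for M :: "'a measure" +
  fixes X :: "nat \<Rightarrow> 'a \<Rightarrow> complex" and T :: "nat \<Rightarrow> 'a \<Rightarrow> 'a"
  assumes X_measurable [measurable]: "\<And>n. X n \<in> borel_measurable M"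
    and norm_X: "\<And>n \<omega>. \<omega> \<in> space M \<Longrightarrow> norm (X n \<omega>) = 1"
    and X_mult: "\<And>m n \<omega>. m \<ge> 1 \<Longrightarrow> n \<ge> 1 \<Longrightarrow> \<omega> \<in> space M \<Longrightarrow> X (m * n) \<omega> = X m \<omega> * X n \<omega>"
    and T_measurable: "\<And>p. prime p \<Longrightarrow> T p \<in> measurable M M"
    and T_distr: "\<And>p. prime p \<Longrightarrow> distr M M (T p) = M"
    and X_flip: "\<And>p n \<omega>. prime p \<Longrightarrow> n \<ge> 1 \<Longrightarrow> \<omega> \<in> space M \<Longrightarrow>
      X n (T p \<omega>) = (- 1) ^ multiplicity p n * X n \<omega>"
begin

text \<open>Some prime has odd total exponent in a b c d. The flip at it preserves the measure and
  reverses the product; the conjugations do not matter because the sign is real.\<close>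

lemma expectation_quad:
  assumes "a \<ge> 1" "b \<ge> 1" "c \<ge> 1" "d \<ge> 1" "\<not> is_square (a * b * c * d)"
  shows "expectation (\<lambda>\<omega>. X a \<omega> * X b \<omega> * cnj (X c \<omega>) * cnj (X d \<omega>)) = 0"
proof -
  obtain p where p: "prime p" "odd (multiplicity p (a * b * c * d))"
    using assms(5) is_nth_power_conv_multiplicity_nat[of 2 "a * b * c * d"] by auto
  have "multiplicity p (a * b * c * d) = multiplicity p a + multiplicity p b + multiplicity p c + multiplicity p d"
    using assms p by (simp add: prime_elem_multiplicity_mult_distrib)
  hence odd: "odd (multiplicity p a + multiplicity p b + multiplicity p c + multiplicity p d)" using p by simp
  let ?f = "\<lambda>\<omega>. X a \<omega> * X b \<omega> * cnj (X c \<omega>) * cnj (X d \<omega>)"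
  have flip: "?f (T p \<omega>) = - ?f \<omega>" if "\<omega> \<in> space M" for \<omega>
  proof -
    have "?f (T p \<omega>) = (- 1) ^ (multiplicity p a + multiplicity p b + multiplicity p c + multiplicity p d) * ?f \<omega>"
      using that assms p by (simp add: X_flip power_add)
    thus ?thesis using odd by simp
  qed
  have "expectation ?f = expectation (\<lambda>\<omega>. ?f (T p \<omega>))"
    using integral_distr[OF T_measurable[OF p(1)], of ?f] T_distr[OF p(1)] by simp
  also have "\<dots> = expectation (\<lambda>\<omega>. - ?f \<omega>)" by (intro Bochner_Integration.integral_cong refl flip)
  also have "\<dots> = - expectation ?f" by simp
  finally show ?thesis by simp
qed

text \<open>In the expansion the quadruples with non-square product vanish and the others are at
  most 1 in modulus. The coefficients \<open>u\<close> are arbitrary in the unit disc, which makes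
  the bound uniform in \<theta>.\<close>

lemma fourth_moment_le:
  fixes u :: "nat \<Rightarrow> complex"
  assumes fin: "finite A" and pos: "\<And>n. n \<in> A \<Longrightarrow> n \<ge> 1" and u: "\<And>n. norm (u n) \<le> 1"
  shows "expectation (\<lambda>\<omega>. norm (\<Sum>n\<in>A. X n \<omega> * u n) ^ 4) \<le> real (card (square_quads A))"
proof -
  let ?f = "\<lambda>a b c d \<omega>. X a \<omega> * X b \<omega> * cnj (X c \<omega>) * cnj (X d \<omega>)"
  let ?w = "\<lambda>a b c d. u a * u b * cnj (u c) * cnj (u d)"
  have int: "integrable M (?f a b c d)" for a b c d
    by (rule integrable_const_bound[of _ 1]) (auto simp: norm_mult norm_X)
  have exp: "complex_of_real (norm (\<Sum>n\<in>A. X n \<omega> * u n) ^ 4)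
     = (\<Sum>a\<in>A. \<Sum>b\<in>A. \<Sum>c\<in>A. \<Sum>d\<in>A. ?w a b c d * ?f a b c d \<omega>)" for \<omega>
  proof -
    define z where "z = (\<Sum>n\<in>A. X n \<omega> * u n)"
    have "complex_of_real (norm z ^ 4) = (of_real ((norm z)\<^sup>2))\<^sup>2" by (simp flip: power_mult)
    also have "\<dots> = (z * cnj z)\<^sup>2" by (simp only: complex_norm_square)
    also have "\<dots> = z * (z * (cnj z * cnj z))" by (simp add: power2_eq_square mult_ac)
    also have "\<dots> = (\<Sum>a\<in>A. \<Sum>b\<in>A. \<Sum>c\<in>A. \<Sum>d\<in>A. X a \<omega> * u a * (X b \<omega> * u b * (cnj (X c \<omega> * u c) * cnj (X d \<omega> * u d))))"
      unfolding z_def cnj_sum sum_product by (simp only: sum_distrib_left sum_distrib_right)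
    finally show ?thesis by (simp add: z_def mult_ac)
  qed
  have "complex_of_real (expectation (\<lambda>\<omega>. norm (\<Sum>n\<in>A. X n \<omega> * u n) ^ 4))
     = expectation (\<lambda>\<omega>. \<Sum>a\<in>A. \<Sum>b\<in>A. \<Sum>c\<in>A. \<Sum>d\<in>A. ?w a b c d * ?f a b c d \<omega>)"
    unfolding exp[symmetric] by (rule integral_complex_of_real[symmetric])
  also have "\<dots> = (\<Sum>a\<in>A. \<Sum>b\<in>A. \<Sum>c\<in>A. \<Sum>d\<in>A. ?w a b c d * expectation (?f a b c d))"
    using int by (simp add: Bochner_Integration.integral_sum)
  finally have "expectation (\<lambda>\<omega>. norm (\<Sum>n\<in>A. X n \<omega> * u n) ^ 4)
      = Re (\<Sum>a\<in>A. \<Sum>b\<in>A. \<Sum>c\<in>A. \<Sum>d\<in>A. ?w a b c d * expectation (?f a b c d))"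
    by (metis Re_complex_of_real)
  also have "\<dots> \<le> norm (\<Sum>a\<in>A. \<Sum>b\<in>A. \<Sum>c\<in>A. \<Sum>d\<in>A. ?w a b c d * expectation (?f a b c d))"
    by (rule complex_Re_le_cmod)
  also have "\<dots> \<le> (\<Sum>a\<in>A. \<Sum>b\<in>A. \<Sum>c\<in>A. \<Sum>d\<in>A. if is_square (a * b * c * d) then 1 else 0)"
  proof (intro sum_norm_le)
    fix a b c d assume A: "a \<in> A" "b \<in> A" "c \<in> A" "d \<in> A"
    show "norm (?w a b c d * expectation (?f a b c d)) \<le> (if is_square (a * b * c * d) then 1 else 0)"
    proof (cases "is_square (a * b * c * d)")
      case True
      have "norm (expectation (?f a b c d)) \<le> expectation (\<lambda>_. 1)"
        by (rule norm_integral_le) (auto simp: norm_mult norm_X)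
      hence "norm (expectation (?f a b c d)) \<le> 1" by (simp add: prob_space)
      moreover have "norm (?w a b c d) \<le> 1"
        using u by (auto simp: norm_mult intro!: mult_le_one)
      ultimately show ?thesis using True by (simp only: norm_mult[of "?w a b c d"]) (auto intro!: mult_le_one)
    next
      case False
      thus ?thesis using expectation_quad[of a b c d] A pos by simp
    qed
  qed
  also have "\<dots> = (\<Sum>(a, b, c, d)\<in>A \<times> A \<times> A \<times> A. if is_square (a * b * c * d) then 1 else 0)"
    by (simp add: sum.cartesian_product)
  also have "\<dots> = (\<Sum>x\<in>A \<times> A \<times> A \<times> A. if x \<in> square_quads A then 1 else 0)"
    by (intro sum.cong refl) (auto simp: square_quads_def split: if_splits)
  also have "\<dots> = real (card ({x \<in> A \<times> A \<times> A \<times> A. x \<in> square_quads A}))"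
    using fin by (simp add: sum.If_cases Int_def)
  also have "{x \<in> A \<times> A \<times> A \<times> A. x \<in> square_quads A} = square_quads A" by (auto simp: square_quads_def)
  finally show ?thesis .
qed

text \<open>The part of Re (cnj t * P_N) carried by the integers whose largest prime factor is p,
  occurring once. Here Re (cnj t * z) is the real inner product of t and z in the plane.\<close>

definition increment :: "complex \<Rightarrow> nat \<Rightarrow> nat \<Rightarrow> 'a \<Rightarrow> real \<Rightarrow> real" where
  "increment t N p \<omega> \<theta> = Re (\<Sum>n\<in>(*) p ` cofactors N p. cnj t / sqrt (real N) * X n \<omega> * e_exp (real n * \<theta>))"

lemma increment_measurable [measurable]:
  assumes [measurable]: "f \<in> measurable L M" "g \<in> borel_measurable L"
  shows "(\<lambda>x. increment t N p (f x) (g x)) \<in> borel_measurable L"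
  unfolding increment_def by measurable

lemma increment_continuous [continuous_intros]:
  "continuous_on S f \<Longrightarrow> continuous_on S (\<lambda>x. increment t N p \<omega> (f x))"
  unfolding increment_def by (intro continuous_intros)

lemma increment_eq:
  assumes "prime p" "\<omega> \<in> space M"
  shows "increment t N p \<omega> \<theta> = Re (cnj t / sqrt (real N) * X p \<omega> * (\<Sum>m\<in>cofactors N p. X m \<omega> * e_exp (real (p * m) * \<theta>)))"
proof -
  have inj: "inj_on ((*) p) (cofactors N p)" using assms prime_gt_0_nat[of p] by (auto intro!: inj_onI)
  show ?thesis
    unfolding increment_def sum.reindex[OF inj] o_def sum_distrib_left
  proof (intro arg_cong[of _ _ Re] sum.cong refl)
    fix m assume "m \<in> cofactors N p"
    hence "X (p * m) \<omega> = X p \<omega> * X m \<omega>"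
      using assms by (intro X_mult) (auto simp: cofactors_def prime_gt_0_nat Suc_le_eq)
    thus "cnj t / sqrt (real N) * X (p * m) \<omega> * e_exp (real (p * m) * \<theta>) =
        cnj t / sqrt (real N) * X p \<omega> * (X m \<omega> * e_exp (real (p * m) * \<theta>))" by simp
  qed
qed

text \<open>A crude bound that serves boundedness and integrability; it does not enter the
  quantitative estimates.\<close>

lemma abs_increment_le:
  assumes "prime p" "\<omega> \<in> space M" "N \<ge> 1"
  shows "\<bar>increment t N p \<omega> \<theta>\<bar> \<le> norm t * real N"
proof -
  have "\<bar>increment t N p \<omega> \<theta>\<bar> \<le> norm (\<Sum>n\<in>(*) p ` cofactors N p. cnj t / sqrt (real N) * X n \<omega> * e_exp (real n * \<theta>))"
    unfolding increment_def by (rule abs_Re_le_cmod)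
  also have "\<dots> \<le> (\<Sum>n\<in>(*) p ` cofactors N p. norm t)"
  proof (rule sum_norm_le)
    fix n
    have "1 \<le> sqrt (real N)" using assms by simp
    hence "norm t / sqrt (real N) \<le> norm t / 1" by (intro divide_left_mono) auto
    thus "norm (cnj t / sqrt (real N) * X n \<omega> * e_exp (real n * \<theta>)) \<le> norm t"
      using assms by (simp add: norm_mult norm_divide norm_X)
  qed
  also have "\<dots> = real (card ((*) p ` cofactors N p)) * norm t" by simp
  also have "\<dots> \<le> real N * norm t"
  proof (intro mult_right_mono of_nat_mono)
    have "(*) p ` cofactors N p \<subseteq> {1..N}" using assms by (auto simp: cofactors_def prime_gt_0_nat Suc_le_eq)
    from card_mono[OF _ this] show "card ((*) p ` cofactors N p) \<le> N" by simp
  qed auto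
  finally show ?thesis by (simp add: mult.commute)
qed

text \<open>The unimodular X p factors out and leaves a sum over cofactors up to N div p. The
  resulting saving of about 1 / p^2 makes the sum over p small.\<close>

lemma fourth_moment_increment:
  assumes "prime p" "N \<ge> 1"
  shows "expectation (\<lambda>\<omega>. increment t N p \<omega> \<theta> ^ 4) \<le> norm t ^ 4 * (real (card (square_quads {1..N div p})) / (real N)\<^sup>2)"
proof -
  have p0: "p > 0" using assms prime_gt_0_nat by blast
  let ?g = "\<lambda>\<omega>. norm (\<Sum>m\<in>cofactors N p. X m \<omega> * e_exp (real (p * m) * \<theta>)) ^ 4"
  have int: "integrable M ?g"
  proof (rule integrable_const_bound[of _ "real (card (cofactors N p)) ^ 4"])
    have "norm (\<Sum>m\<in>cofactors N p. X m \<omega> * e_exp (real (p * m) * \<theta>)) \<le> real (card (cofactors N p))"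
      if "\<omega> \<in> space M" for \<omega>
      using sum_norm_le[of "cofactors N p" "\<lambda>m. X m \<omega> * e_exp (real (p * m) * \<theta>)" "\<lambda>_. 1"] that
      by (simp add: norm_mult norm_X)
    thus "AE \<omega> in M. norm (?g \<omega>) \<le> real (card (cofactors N p)) ^ 4"
      by (intro AE_I2) (auto intro!: power_mono)
  qed measurable
  have "expectation (\<lambda>\<omega>. increment t N p \<omega> \<theta> ^ 4) \<le> expectation (\<lambda>\<omega>. (norm t ^ 4 / (real N)\<^sup>2) * ?g \<omega>)"
  proof (rule integral_mono')
    fix \<omega> assume w: "\<omega> \<in> space M"
    have "\<bar>increment t N p \<omega> \<theta>\<bar> ^ 4 \<le> norm (cnj t / sqrt (real N) * X p \<omega> * (\<Sum>m\<in>cofactors N p. X m \<omega> * e_exp (real (p * m) * \<theta>))) ^ 4"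
      unfolding increment_eq[OF assms(1) w] by (intro power_mono abs_Re_le_cmod) auto
    also have "\<dots> = (norm t ^ 4 / (real N)\<^sup>2) * ?g \<omega>"
    proof -
      have "sqrt (real N) ^ 4 = ((sqrt (real N))\<^sup>2)\<^sup>2" by (simp only: flip: power_mult) simp
      also have "\<dots> = (real N)\<^sup>2" by simp
      finally have "sqrt (real N) ^ 4 = (real N)\<^sup>2" .
      thus ?thesis using w by (simp add: norm_mult norm_divide norm_X power_mult_distrib power_divide)
    qed
    finally show "increment t N p \<omega> \<theta> ^ 4 \<le> (norm t ^ 4 / (real N)\<^sup>2) * ?g \<omega>" by (simp add: power_even_abs)
  qed (use int in auto)
  also have "\<dots> = (norm t ^ 4 / (real N)\<^sup>2) * expectation ?g" by simp
  also have "\<dots> \<le> (norm t ^ 4 / (real N)\<^sup>2) * real (card (square_quads {1..N div p}))"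
  proof (rule mult_left_mono)
    have "expectation ?g \<le> real (card (square_quads (cofactors N p)))"
      using finite_cofactors[OF p0] by (intro fourth_moment_le) (auto simp: cofactors_def)
    also have "\<dots> \<le> real (card (square_quads {1..N div p}))"
      by (intro of_nat_mono card_mono finite_square_quads square_quads_mono cofactors_subset p0) auto
    finally show "expectation ?g \<le> real (card (square_quads {1..N div p}))" .
  qed auto
  finally show ?thesis by simp
qed

lemma increment_spectrum:
  assumes "prime p"
  shows "trig_spectrum {h. \<bar>h\<bar> \<le> int N \<and> h \<noteq> 0 \<and> int p dvd h} (\<lambda>\<theta>. of_real (increment t N p \<omega> \<theta>))"
proof -
  let ?B = "(*) p ` cofactors N p"
  have p0: "p > 0" using assms prime_gt_0_nat by blast
  have "trig_spectrum (int ` ?B \<union> (\<lambda>n. - int n) ` ?B) (\<lambda>\<theta>. of_real (increment t N p \<omega> \<theta>))"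
    unfolding increment_def using finite_cofactors[OF p0] p0
    by (intro trig_spectrum_Re) (auto simp: cofactors_def)
  thus ?thesis
  proof (rule trig_spectrum_mono)
    have "int (p * m) \<le> int N" if "m \<in> cofactors N p" for m using that by (auto simp: cofactors_def simp del: of_nat_mult)
    thus "int ` ?B \<union> (\<lambda>n. - int n) ` ?B \<subseteq> {h. \<bar>h\<bar> \<le> int N \<and> h \<noteq> 0 \<and> int p dvd h}"
      using p0 by (auto simp: cofactors_def abs_mult)
    show "finite {h. \<bar>h\<bar> \<le> int N \<and> h \<noteq> 0 \<and> int p dvd h}"
      by (rule finite_subset[of _ "{- int N..int N}"]) auto
  qed
qed

text \<open>All coefficients have the same modulus whatever \<omega> is. The mean of the quadratic
  variation over \<theta> is therefore deterministic and equals a multiple of the number of retained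
  integers.\<close>

lemma integral_increment_square:
  assumes "prime p" "\<omega> \<in> space M"
  shows "(\<integral>\<theta>. (increment t N p \<omega> \<theta>)\<^sup>2 \<partial>unit_uniform) = (norm t)\<^sup>2 / 2 * (real (card (cofactors N p)) / real N)"
proof -
  let ?B = "(*) p ` cofactors N p"
  have p0: "p > 0" using assms prime_gt_0_nat by blast
  have "(\<integral>\<theta>. (increment t N p \<omega> \<theta>)\<^sup>2 \<partial>unit_uniform) = (\<Sum>n\<in>?B. (norm (cnj t / sqrt (real N) * X n \<omega>))\<^sup>2) / 2"
    unfolding increment_def using finite_cofactors[OF p0] p0
    by (intro trig_spectrum_Re(2)) (auto simp: cofactors_def)
  also have "\<dots> = (\<Sum>n\<in>?B. (norm t)\<^sup>2 / real N) / 2"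
    using assms by (simp add: norm_mult norm_divide norm_X power_divide)
  also have "\<dots> = real (card ?B) * ((norm t)\<^sup>2 / real N) / 2" by simp
  also have "card ?B = card (cofactors N p)" using p0 by (intro card_image inj_onI) auto
  finally show ?thesis by (simp add: field_simps)
qed

text \<open>All prime factors of a cofactor of p lie below p. Hence a prime q > p divides no index
  of the increment at p, and q divides each index of its own increment exactly once.\<close>

lemma increment_flip:
  assumes "prime q" "\<omega> \<in> space M"
  shows "p < q \<Longrightarrow> prime p \<Longrightarrow> increment t N p (T q \<omega>) \<theta> = increment t N p \<omega> \<theta>"
    and "increment t N q (T q \<omega>) \<theta> = - increment t N q \<omega> \<theta>"
proof -
  have mult0: "multiplicity q m = 0" if "m \<in> cofactors N p" "p \<le> q" for m p
  proof (rule not_dvd_imp_multiplicity_0, rule notI)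
    assume "q dvd m"
    hence "q \<in> prime_factors m" using that assms by (auto simp: cofactors_def in_prime_factors_iff)
    thus False using that by (auto simp: cofactors_def)
  qed
  show "increment t N p (T q \<omega>) \<theta> = increment t N p \<omega> \<theta>" if p: "p < q" "prime p"
    unfolding increment_def
  proof (intro arg_cong[of _ _ Re] sum.cong refl)
    fix n assume "n \<in> (*) p ` cofactors N p"
    then obtain m where m: "n = p * m" "m \<in> cofactors N p" by auto
    have n1: "n \<ge> 1" using m p by (auto simp: cofactors_def prime_gt_0_nat Suc_le_eq)
    have "multiplicity q p = 0" using p assms(1) by (simp add: prime_multiplicity_other)
    hence "multiplicity q n = 0"
      using mult0[OF m(2)] p m assms by (simp add: prime_elem_multiplicity_mult_distrib cofactors_def prime_gt_0_nat)
    thus "cnj t / sqrt (real N) * X n (T q \<omega>) * e_exp (real n * \<theta>) = cnj t / sqrt (real N) * X n \<omega> * e_exp (real n * \<theta>)"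
      using X_flip[OF assms(1) n1 assms(2)] by simp
  qed
  have "increment t N q (T q \<omega>) \<theta> = Re (\<Sum>n\<in>(*) q ` cofactors N q. - (cnj t / sqrt (real N) * X n \<omega> * e_exp (real n * \<theta>)))"
    unfolding increment_def
  proof (intro arg_cong[of _ _ Re] sum.cong refl)
    fix n assume "n \<in> (*) q ` cofactors N q"
    then obtain m where m: "n = q * m" "m \<in> cofactors N q" by auto
    have n1: "n \<ge> 1" using m assms by (auto simp: cofactors_def prime_gt_0_nat Suc_le_eq)
    have "multiplicity q n = 1"
      using mult0[OF m(2)] m assms by (simp add: prime_elem_multiplicity_mult_distrib cofactors_def prime_gt_0_nat)
    thus "cnj t / sqrt (real N) * X n (T q \<omega>) * e_exp (real n * \<theta>) = - (cnj t / sqrt (real N) * X n \<omega> * e_exp (real n * \<theta>))"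
      using X_flip[OF assms(1) n1 assms(2)] by simp
  qed
  thus "increment t N q (T q \<omega>) \<theta> = - increment t N q \<omega> \<theta>" by (simp add: increment_def sum_negf)
qed

end

section \<open>Two independent points and the second moment of the empirical characteristic
  function\<close>

abbreviation (input) square_uniform :: "(real \<times> real) measure" where
  "square_uniform \<equiv> unit_uniform \<Otimes>\<^sub>M unit_uniform"

interpretation square_uniform: pair_prob_space unit_uniform unit_uniform ..

lemma square_uniform_integral:
  fixes f :: "real \<times> real \<Rightarrow> 'b :: {banach, second_countable_topology}"
  assumes [measurable]: "f \<in> borel_measurable (borel \<Otimes>\<^sub>M borel)" and "\<And>x y. norm (f (x, y)) \<le> C"
  shows "integrable square_uniform f"
    and "(\<integral>z. f z \<partial>square_uniform) = (\<integral>x. \<integral>y. f (x, y) \<partial>unit_uniform \<partial>unit_uniform)"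
    and "(\<integral>z. f z \<partial>square_uniform) = (\<integral>y. \<integral>x. f (x, y) \<partial>unit_uniform \<partial>unit_uniform)"
proof -
  have [measurable]: "f \<in> borel_measurable square_uniform"
    using assms(1) by (simp cong: measurable_cong_sets)
  show 1: "integrable square_uniform f"
    by (rule square_uniform.P.integrable_const_bound[of _ C]) (use assms(2) in \<open>auto intro!: AE_I2\<close>)
  show "(\<integral>z. f z \<partial>square_uniform) = (\<integral>x. \<integral>y. f (x, y) \<partial>unit_uniform \<partial>unit_uniform)"
    using square_uniform.integral_fst'[OF 1] by simp
  show "(\<integral>z. f z \<partial>square_uniform) = (\<integral>y. \<integral>x. f (x, y) \<partial>unit_uniform \<partial>unit_uniform)"
    using square_uniform.integral_snd[of "\<lambda>x y. f (x, y)"] 1 by simp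
qed

context symmetric_multiplicative
begin

text \<open>The flips act on both points simultaneously, so a linear combination of increments is
  again a martingale increment in the same sense. The weights (1, 0) and (1, -1) will give the mean
  of the empirical characteristic function and of its squared modulus. The constant 16 is 8 + 8 from
  (x + z)^4 \<le> 8 (x^4 + z^4).\<close>

lemma char_two_points:
  fixes t :: complex and a b \<theta> \<theta>' V :: real
  assumes N: "N \<ge> 1" and ab: "\<bar>a\<bar> \<le> 1" "\<bar>b\<bar> \<le> 1" and V: "V \<ge> 0"
  defines "\<zeta> \<equiv> \<lambda>p \<omega>. a * increment t N p \<omega> \<theta> + b * increment t N p \<omega> \<theta>'"
  shows "norm (expectation (\<lambda>\<omega>. exp (\<i> * of_real (\<Sum>p\<in>large_primes N y. \<zeta> p \<omega>))) - of_real (exp (- V / 2)))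
    \<le> 2 * (16 * norm t ^ 4 * (\<Sum>p\<in>large_primes N y. real (card (square_quads {1..N div p})) / (real N)\<^sup>2)
         + 2 * expectation (\<lambda>\<omega>. \<bar>(\<Sum>p\<in>large_primes N y. (\<zeta> p \<omega>)\<^sup>2) - V\<bar>))"
proof -
  \<comment> \<open>Indices that are not large primes carry the increment 0, and non-prime ones the
    identity as flip; the sign condition holds there because 0 = - 0.\<close>
  define \<xi> where "\<xi> k \<omega> = (if k \<in> large_primes N y then \<zeta> k \<omega> else 0)" for k \<omega>
  define S where "S k = (if prime k then T k else id)" for k
  have sum: "(\<Sum>k<N+1. f k (\<xi> k \<omega>)) = (\<Sum>p\<in>large_primes N y. f p (\<zeta> p \<omega>))"
    if "\<And>k. f k 0 = 0" for f :: "nat \<Rightarrow> real \<Rightarrow> real" and \<omega>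
    using that by (intro sum.mono_neutral_cong_right) (auto simp: \<xi>_def large_primes_def)
  have sub: "large_primes N y \<subseteq> {..<N+1}" by (auto simp: large_primes_def)
  have prim: "prime p" if "p \<in> large_primes N y" for p using that by (simp add: large_primes_def)
  have bd: "\<bar>\<xi> k \<omega>\<bar> \<le> 2 * (norm t * real N)" if "\<omega> \<in> space M" for k \<omega>
  proof -
    have "\<bar>\<zeta> k \<omega>\<bar> \<le> 2 * (norm t * real N)" if "prime k"
    proof -
      have "\<bar>\<zeta> k \<omega>\<bar> \<le> \<bar>a\<bar> * \<bar>increment t N k \<omega> \<theta>\<bar> + \<bar>b\<bar> * \<bar>increment t N k \<omega> \<theta>'\<bar>"
        unfolding \<zeta>_def by (metis abs_mult abs_triangle_ineq)
      also have "\<dots> \<le> 1 * (norm t * real N) + 1 * (norm t * real N)"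
        using ab N \<open>\<omega> \<in> space M\<close> that by (intro add_mono mult_mono abs_increment_le) auto
      finally show ?thesis by linarith
    qed
    thus ?thesis by (auto simp: \<xi>_def prim)
  qed
  have meas [measurable]: "\<zeta> k \<in> borel_measurable M" for k unfolding \<zeta>_def by measurable
  have "norm (expectation (\<lambda>\<omega>. exp (\<i> * of_real (\<Sum>k<N+1. \<xi> k \<omega>))) - of_real (exp (- V / 2)))
    \<le> 2 * ((\<Sum>k<N+1. expectation (\<lambda>\<omega>. \<xi> k \<omega> ^ 4)) + 2 * expectation (\<lambda>\<omega>. \<bar>(\<Sum>k<N+1. (\<xi> k \<omega>)\<^sup>2) - V\<bar>))"
  proof (rule char_flip_martingale[OF _ bd _ _ _ _ V])
    show "\<xi> k \<in> borel_measurable M" for k unfolding \<xi>_def by simp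
    show "S k \<in> measurable M M" for k using T_measurable by (auto simp: S_def)
    show "distr M M (S k) = M" for k using T_distr by (auto simp: S_def id_def distr_id)
    show "\<xi> j (S k \<omega>) = \<xi> j \<omega>" if "j < k" "\<omega> \<in> space M" for j k \<omega>
      using that by (auto simp: \<xi>_def S_def \<zeta>_def increment_flip prim)
    show "\<xi> k (S k \<omega>) = - \<xi> k \<omega>" if "\<omega> \<in> space M" for k \<omega>
      using that by (auto simp: \<xi>_def S_def \<zeta>_def increment_flip prim)
  qed
  also have "(\<Sum>k<N+1. expectation (\<lambda>\<omega>. \<xi> k \<omega> ^ 4)) = (\<Sum>p\<in>large_primes N y. expectation (\<lambda>\<omega>. \<zeta> p \<omega> ^ 4))"
    by (intro sum.mono_neutral_cong_right sub) (auto simp: \<xi>_def)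
  also have "(\<lambda>\<omega>. \<bar>(\<Sum>k<N+1. (\<xi> k \<omega>)\<^sup>2) - V\<bar>) = (\<lambda>\<omega>. \<bar>(\<Sum>p\<in>large_primes N y. (\<zeta> p \<omega>)\<^sup>2) - V\<bar>)"
    by (subst sum[of "\<lambda>_ x. x\<^sup>2"]) auto
  also have "(\<lambda>\<omega>. exp (\<i> * of_real (\<Sum>k<N+1. \<xi> k \<omega>))) = (\<lambda>\<omega>. exp (\<i> * of_real (\<Sum>p\<in>large_primes N y. \<zeta> p \<omega>)))"
    by (subst sum[of "\<lambda>_ x. x"]) auto
  also have "(\<Sum>p\<in>large_primes N y. expectation (\<lambda>\<omega>. \<zeta> p \<omega> ^ 4))
     \<le> (\<Sum>p\<in>large_primes N y. 16 * norm t ^ 4 * (real (card (square_quads {1..N div p})) / (real N)\<^sup>2))"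
  proof (rule sum_mono)
    fix p assume "p \<in> large_primes N y"
    hence p: "prime p" by (rule prim)
    have int: "integrable M (\<lambda>\<omega>. increment t N p \<omega> \<theta> ^ 4)" for \<theta>
      by (rule integrable_const_bound[of _ "(norm t * real N) ^ 4"])
         (use power_mono[OF abs_increment_le[OF p _ N], of _ t \<theta> 4] in \<open>auto simp: power_even_abs\<close>)
    have "expectation (\<lambda>\<omega>. \<zeta> p \<omega> ^ 4) \<le> expectation (\<lambda>\<omega>. 8 * (increment t N p \<omega> \<theta> ^ 4 + increment t N p \<omega> \<theta>' ^ 4))"
    proof (rule integral_mono')
      show "integrable M (\<lambda>\<omega>. 8 * (increment t N p \<omega> \<theta> ^ 4 + increment t N p \<omega> \<theta>' ^ 4))" using int by simp
      fix \<omega>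
      have ineq: "(a * x + b * z) ^ 4 \<le> 8 * (x ^ 4 + z ^ 4)" for x z :: real
      proof -
        have sq: "(u + v)\<^sup>2 \<le> 2 * (u\<^sup>2 + v\<^sup>2)" for u v :: real
          using zero_le_power2[of "u - v"] by (simp add: power2_eq_square algebra_simps)
        have ab2: "a\<^sup>2 \<le> 1" "b\<^sup>2 \<le> 1" using ab by (simp_all add: abs_square_le_1)
        have "(a * x + b * z)\<^sup>2 \<le> 2 * ((a * x)\<^sup>2 + (b * z)\<^sup>2)" by (rule sq)
        also have "\<dots> \<le> 2 * (x\<^sup>2 + z\<^sup>2)"
          using mult_right_mono[OF ab2(1), of "x\<^sup>2"] mult_right_mono[OF ab2(2), of "z\<^sup>2"] by (simp add: power_mult_distrib)
        finally have "((a * x + b * z)\<^sup>2)\<^sup>2 \<le> (2 * (x\<^sup>2 + z\<^sup>2))\<^sup>2" by (intro power_mono) auto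
        also have "\<dots> = 4 * (x\<^sup>2 + z\<^sup>2)\<^sup>2" by (simp only: power_mult_distrib) simp
        also have "\<dots> \<le> 4 * (2 * ((x\<^sup>2)\<^sup>2 + (z\<^sup>2)\<^sup>2))" by (intro mult_left_mono sq) auto
        finally show ?thesis by simp
      qed
      show "\<zeta> p \<omega> ^ 4 \<le> 8 * (increment t N p \<omega> \<theta> ^ 4 + increment t N p \<omega> \<theta>' ^ 4)" unfolding \<zeta>_def by (rule ineq)
    qed auto
    also have "\<dots> = 8 * (expectation (\<lambda>\<omega>. increment t N p \<omega> \<theta> ^ 4) + expectation (\<lambda>\<omega>. increment t N p \<omega> \<theta>' ^ 4))"
      using int by simp
    also have "\<dots> \<le> 8 * (norm t ^ 4 * (real (card (square_quads {1..N div p})) / (real N)\<^sup>2)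
        + norm t ^ 4 * (real (card (square_quads {1..N div p})) / (real N)\<^sup>2))"
      by (intro mult_left_mono add_mono fourth_moment_increment p N) auto
    finally show "expectation (\<lambda>\<omega>. \<zeta> p \<omega> ^ 4) \<le> 16 * norm t ^ 4 * (real (card (square_quads {1..N div p})) / (real N)\<^sup>2)"
      by simp
  qed
  also have "\<dots> = 16 * norm t ^ 4 * (\<Sum>p\<in>large_primes N y. real (card (square_quads {1..N div p})) / (real N)\<^sup>2)"
    by (simp only: sum_distrib_left)
  finally show ?thesis by simp
qed

text \<open>The expanded square consists of a diagonal part in each variable and a cross term. Once
  the means are removed, each is a sum over p of polynomials whose frequencies are nonzero multiples
  of p, so at most \<kappa> of them overlap. The estimate is for fixed \<omega>. The constant is 3 +
  3 + 12, where 12 carries the factor 2 of the cross term squared.\<close>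

lemma quadratic_variation_deviation:
  fixes t :: complex and a b :: real and N y :: nat
  assumes N: "N \<ge> 1" and ab: "\<bar>a\<bar> \<le> 1" "\<bar>b\<bar> \<le> 1" and w: "\<omega> \<in> space M"
    and \<kappa>: "\<And>h. 0 < h \<Longrightarrow> h \<le> 2 * N \<Longrightarrow> card {p \<in> prime_factors h. y < p} \<le> \<kappa>"
  defines "v \<equiv> (\<Sum>p\<in>large_primes N y. (norm t)\<^sup>2 / 2 * (real (card (cofactors N p)) / real N))"
  shows "(\<integral>z. ((\<Sum>p\<in>large_primes N y. (a * increment t N p \<omega> (fst z) + b * increment t N p \<omega> (snd z))\<^sup>2) - (a\<^sup>2 + b\<^sup>2) * v)\<^sup>2 \<partial>square_uniform)
    \<le> 18 * real \<kappa> * (\<Sum>p\<in>large_primes N y. \<integral>\<theta>. increment t N p \<omega> \<theta> ^ 4 \<partial>unit_uniform)"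
proof -
  define f where "f p \<theta> = increment t N p \<omega> \<theta>" for p \<theta>
  define v0 where "v0 p = (\<integral>\<theta>. (f p \<theta>)\<^sup>2 \<partial>unit_uniform)" for p
  let ?I = "large_primes N y"
  define G where "G = (\<Sum>p\<in>?I. \<integral>\<theta>. f p \<theta> ^ 4 \<partial>unit_uniform)"
  define C where "C = norm t * real N"
  have prim: "prime p" if "p \<in> ?I" for p using that by (simp add: large_primes_def)
  have cont [continuous_intros]: "continuous_on S g \<Longrightarrow> continuous_on S (\<lambda>x. f p (g x))" for S g p
    unfolding f_def by (intro continuous_intros)
  have meas [measurable]: "f p \<in> borel_measurable borel" for p
    by (intro borel_measurable_continuous_onI continuous_intros)
  have fC: "\<bar>f p \<theta>\<bar> \<le> C" if "p \<in> ?I" for p \<theta>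
    unfolding f_def C_def using that w N by (intro abs_increment_le prim)
  have C0: "C \<ge> 0" by (simp add: C_def)
  have fC2: "(f p \<theta>)\<^sup>2 \<le> C\<^sup>2" if "p \<in> ?I" for p \<theta>
    using power_mono[OF fC[OF that], of \<theta> 2] by simp
  have v: "v = (\<Sum>p\<in>?I. v0 p)"
    unfolding v_def v0_def f_def using w by (intro sum.cong refl integral_increment_square[symmetric] prim)
  \<comment> \<open>Squaring doubles the range of frequencies, hence 2 N. Frequency 0 is excluded
    because it is the one divisible by all p; the subtraction of \<open>v0 p\<close> removes
    it.\<close>
  define Sp where "Sp p = {h. \<bar>h\<bar> \<le> 2 * int N \<and> h \<noteq> 0 \<and> int p dvd h}" for p
  have finSp: "finite (Sp p)" for p
    by (rule finite_subset[of _ "{- 2 * int N..2 * int N}"]) (auto simp: Sp_def)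
  have overlap: "card {p \<in> ?I. h \<in> Sp p} \<le> \<kappa>" for h
  proof (cases "h \<noteq> 0 \<and> \<bar>h\<bar> \<le> 2 * int N")
    case True
    have "{p \<in> ?I. h \<in> Sp p} \<subseteq> {p \<in> prime_factors (nat \<bar>h\<bar>). y < p}"
      using True by (auto simp: Sp_def large_primes_def in_prime_factors_iff nat_dvd_iff)
    hence "card {p \<in> ?I. h \<in> Sp p} \<le> card {p \<in> prime_factors (nat \<bar>h\<bar>). y < p}" by (intro card_mono) auto
    also have "\<dots> \<le> \<kappa>" using True by (intro \<kappa>) auto
    finally show ?thesis .
  next
    case False
    hence "{p \<in> ?I. h \<in> Sp p} = {}" by (auto simp: Sp_def)
    thus ?thesis by (simp only: card.empty)
  qed
  have spec: "trig_spectrum (Sp p) (\<lambda>\<theta>. of_real (f p \<theta>))" if "p \<in> ?I" for p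
    using increment_spectrum[OF prim[OF that], of N t \<omega>] unfolding f_def
    by (rule trig_spectrum_mono) (auto simp: finSp, auto simp: Sp_def)
  have spec2: "trig_spectrum (Sp p) (\<lambda>\<theta>. of_real ((f p \<theta>)\<^sup>2 - v0 p))" if "p \<in> ?I" for p
  proof -
    let ?S = "{h. \<bar>h\<bar> \<le> int N \<and> h \<noteq> 0 \<and> int p dvd h}"
    have s: "trig_spectrum ?S (\<lambda>\<theta>. of_real (f p \<theta>))"
      using increment_spectrum[OF prim[OF that], of N t \<omega>] unfolding f_def .
    have fin: "finite ?S" by (rule finite_subset[of _ "{- int N..int N}"]) auto
    have "trig_spectrum (insert 0 (Sp p)) (\<lambda>\<theta>. of_real (f p \<theta>) * of_real (f p \<theta>))"
      by (rule trig_spectrum_mult[OF s s]) (use fin finSp in \<open>auto simp: Sp_def\<close>)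
    from trig_spectrum_remove_mean[OF this]
    have "trig_spectrum (insert 0 (Sp p) - {0}) (\<lambda>\<theta>. of_real ((f p \<theta>)\<^sup>2) - (\<integral>\<theta>. of_real ((f p \<theta>)\<^sup>2) \<partial>unit_uniform))"
      using finSp by (simp add: power2_eq_square)
    moreover have "(\<integral>\<theta>. complex_of_real ((f p \<theta>)\<^sup>2) \<partial>unit_uniform) = of_real (v0 p)"
      unfolding v0_def by (rule integral_complex_of_real)
    moreover have "insert 0 (Sp p) - {0} = Sp p" by (auto simp: Sp_def)
    ultimately show ?thesis by simp
  qed
  define D where "D \<theta> = (\<Sum>p\<in>?I. (f p \<theta>)\<^sup>2 - v0 p)" for \<theta>
  define E where "E \<theta> \<theta>' = (\<Sum>p\<in>?I. f p \<theta> * f p \<theta>')" for \<theta> \<theta>'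
  have mD [measurable]: "D \<in> borel_measurable borel" unfolding D_def by measurable
  have mE [measurable]: "(\<lambda>z. E (fst z) (snd z)) \<in> borel_measurable (borel \<Otimes>\<^sub>M borel)" unfolding E_def by measurable
  have D2: "(\<integral>\<theta>. (D \<theta>)\<^sup>2 \<partial>unit_uniform) \<le> real \<kappa> * G"
  proof -
    have "(\<integral>\<theta>. (D \<theta>)\<^sup>2 \<partial>unit_uniform) = (\<integral>\<theta>. (norm (\<Sum>p\<in>?I. complex_of_real ((f p \<theta>)\<^sup>2 - v0 p)))\<^sup>2 \<partial>unit_uniform)"
      unfolding of_real_sum[symmetric] norm_of_real D_def by simp
    also have "\<dots> \<le> real \<kappa> * (\<Sum>p\<in>?I. \<integral>\<theta>. (norm (complex_of_real ((f p \<theta>)\<^sup>2 - v0 p)))\<^sup>2 \<partial>unit_uniform)"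
      by (rule integral_almost_disjoint_spectra[OF _ finSp spec2 overlap]) auto
    also have "\<dots> \<le> real \<kappa> * G"
      unfolding G_def
    proof (intro mult_left_mono sum_mono)
      fix p assume p: "p \<in> ?I"
      have "(\<integral>\<theta>. (norm (complex_of_real ((f p \<theta>)\<^sup>2 - v0 p)))\<^sup>2 \<partial>unit_uniform) = (\<integral>\<theta>. ((f p \<theta>)\<^sup>2 - v0 p)\<^sup>2 \<partial>unit_uniform)"
        unfolding norm_of_real by simp
      also have "\<dots> \<le> (\<integral>\<theta>. ((f p \<theta>)\<^sup>2)\<^sup>2 \<partial>unit_uniform)"
        unfolding v0_def
        by (intro unit_uniform.square_expectation_le unit_uniform_integrable continuous_intros)
      finally show "(\<integral>\<theta>. (norm (complex_of_real ((f p \<theta>)\<^sup>2 - v0 p)))\<^sup>2 \<partial>unit_uniform) \<le> (\<integral>\<theta>. f p \<theta> ^ 4 \<partial>unit_uniform)"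
        by simp
    qed auto
    finally show ?thesis .
  qed
  \<comment> \<open>With \<theta>' fixed, the products are scalar multiples of the increments in
    \<theta>, which already have mean 0, so near-orthogonality in \<theta> applies directly.\<close>
  have E1: "(\<integral>\<theta>. (E \<theta> \<theta>')\<^sup>2 \<partial>unit_uniform) \<le> real \<kappa> * (\<Sum>p\<in>?I. (f p \<theta>')\<^sup>2 * v0 p)" for \<theta>'
  proof -
    have "(\<integral>\<theta>. (E \<theta> \<theta>')\<^sup>2 \<partial>unit_uniform) = (\<integral>\<theta>. (norm (\<Sum>p\<in>?I. complex_of_real (f p \<theta>') * of_real (f p \<theta>)))\<^sup>2 \<partial>unit_uniform)"
      unfolding of_real_sum[symmetric] of_real_mult[symmetric] norm_of_real E_def by (simp add: mult.commute)
    also have "\<dots> \<le> real \<kappa> * (\<Sum>p\<in>?I. \<integral>\<theta>. (norm (complex_of_real (f p \<theta>') * of_real (f p \<theta>)))\<^sup>2 \<partial>unit_uniform)"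
      by (rule integral_almost_disjoint_spectra[OF _ finSp trig_spectrum_scale[OF spec] overlap]) auto
    also have "(\<Sum>p\<in>?I. \<integral>\<theta>. (norm (complex_of_real (f p \<theta>') * of_real (f p \<theta>)))\<^sup>2 \<partial>unit_uniform) = (\<Sum>p\<in>?I. (f p \<theta>')\<^sup>2 * v0 p)"
      by (simp add: norm_mult power_mult_distrib v0_def)
    finally show ?thesis .
  qed
  have bdD: "\<bar>D \<theta>\<bar> \<le> (\<Sum>p\<in>?I. C\<^sup>2 + \<bar>v0 p\<bar>)" for \<theta>
    unfolding D_def using fC2 by (intro order.trans[OF sum_abs] sum_mono) (smt (verit) zero_le_power2)
  have bdE: "\<bar>E \<theta> \<theta>'\<bar> \<le> (\<Sum>p\<in>?I. C * C)" for \<theta> \<theta>'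
    unfolding E_def using fC C0 by (intro order.trans[OF sum_abs] sum_mono) (auto simp: abs_mult intro!: mult_mono)
  have E2: "(\<integral>z. (E (fst z) (snd z))\<^sup>2 \<partial>square_uniform) \<le> real \<kappa> * G"
  proof -
    have "(\<integral>z. (E (fst z) (snd z))\<^sup>2 \<partial>square_uniform) = (\<integral>\<theta>'. \<integral>\<theta>. (E \<theta> \<theta>')\<^sup>2 \<partial>unit_uniform \<partial>unit_uniform)"
      using square_uniform_integral(3)[of "\<lambda>z. (E (fst z) (snd z))\<^sup>2" "(\<Sum>p\<in>?I. C * C)\<^sup>2"] power_mono[OF bdE, where n = 2] by simp
    also have "\<dots> \<le> (\<integral>\<theta>'. real \<kappa> * (\<Sum>p\<in>?I. (f p \<theta>')\<^sup>2 * v0 p) \<partial>unit_uniform)"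
    proof (rule integral_mono'[OF _ E1])
      show "integrable unit_uniform (\<lambda>\<theta>'. real \<kappa> * (\<Sum>p\<in>?I. (f p \<theta>')\<^sup>2 * v0 p))"
        by (intro unit_uniform_integrable continuous_intros)
      show "0 \<le> real \<kappa> * (\<Sum>p\<in>?I. (f p \<theta>')\<^sup>2 * v0 p)" for \<theta>'
        by (intro mult_nonneg_nonneg sum_nonneg) (auto simp: v0_def)
    qed
    also have "\<dots> = real \<kappa> * (\<Sum>p\<in>?I. v0 p * v0 p)"
      by (subst integral_mult_right_zero, subst Bochner_Integration.integral_sum)
         (auto intro!: unit_uniform_integrable continuous_intros simp: v0_def)
    also have "\<dots> \<le> real \<kappa> * G"
      unfolding G_def
    proof (intro mult_left_mono sum_mono)
      fix p assume p: "p \<in> ?I"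
      have "v0 p * v0 p \<le> (\<integral>\<theta>. ((f p \<theta>)\<^sup>2)\<^sup>2 \<partial>unit_uniform)"
        unfolding v0_def power2_eq_square[of "integral\<^sup>L _ _", symmetric]
        by (intro unit_uniform.square_expectation_le unit_uniform_integrable continuous_intros)
      thus "v0 p * v0 p \<le> (\<integral>\<theta>. f p \<theta> ^ 4 \<partial>unit_uniform)" by simp
    qed auto
    finally show ?thesis .
  qed
  have D2': "(\<integral>z. (D (fst z))\<^sup>2 \<partial>square_uniform) \<le> real \<kappa> * G" "(\<integral>z. (D (snd z))\<^sup>2 \<partial>square_uniform) \<le> real \<kappa> * G"
     "integrable square_uniform (\<lambda>z. (D (fst z))\<^sup>2)" "integrable square_uniform (\<lambda>z. (D (snd z))\<^sup>2)"
     "integrable square_uniform (\<lambda>z. (E (fst z) (snd z))\<^sup>2)"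
    using square_uniform_integral(1,2)[of "\<lambda>z. (D (fst z))\<^sup>2" "(\<Sum>p\<in>?I. C\<^sup>2 + \<bar>v0 p\<bar>)\<^sup>2"]
      square_uniform_integral(1,2)[of "\<lambda>z. (D (snd z))\<^sup>2" "(\<Sum>p\<in>?I. C\<^sup>2 + \<bar>v0 p\<bar>)\<^sup>2"]
      square_uniform_integral(1)[of "\<lambda>z. (E (fst z) (snd z))\<^sup>2" "(\<Sum>p\<in>?I. C * C)\<^sup>2"]
      power_mono[OF bdE, where n = 2] power_mono[OF bdD, where n = 2] D2
    by (simp_all add: unit_uniform.prob_space)
  let ?Q = "\<lambda>z. (\<Sum>p\<in>?I. (a * f p (fst z) + b * f p (snd z))\<^sup>2) - (a\<^sup>2 + b\<^sup>2) * v"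
  have "(\<integral>z. (?Q z)\<^sup>2 \<partial>square_uniform) \<le>
      (\<integral>z. 3 * (D (fst z))\<^sup>2 + 3 * (D (snd z))\<^sup>2 + 12 * (E (fst z) (snd z))\<^sup>2 \<partial>square_uniform)"
  proof (rule integral_mono')
    show "integrable square_uniform (\<lambda>z. 3 * (D (fst z))\<^sup>2 + 3 * (D (snd z))\<^sup>2 + 12 * (E (fst z) (snd z))\<^sup>2)"
      using D2' by simp
    fix z :: "real \<times> real"
    have e: "?Q z = a\<^sup>2 * D (fst z) + b\<^sup>2 * D (snd z) + 2 * (a * b) * E (fst z) (snd z)"
      unfolding v D_def E_def
      by (simp add: power2_eq_square algebra_simps sum.distrib sum_distrib_left sum_subtractf)
    have cube: "(x + y + u)\<^sup>2 \<le> 3 * x\<^sup>2 + 3 * y\<^sup>2 + 3 * u\<^sup>2" for x y u :: real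
      using zero_le_power2[of "x - y"] zero_le_power2[of "y - u"] zero_le_power2[of "x - u"]
      by (simp add: power2_eq_square algebra_simps)
    have le: "(c * x)\<^sup>2 \<le> x\<^sup>2" if "\<bar>c\<bar> \<le> 1" for c x :: real
      using that mult_right_mono[of "c\<^sup>2" 1 "x\<^sup>2"] by (simp add: power_mult_distrib abs_square_le_1)
    have abs: "\<bar>a\<^sup>2\<bar> \<le> 1" "\<bar>b\<^sup>2\<bar> \<le> 1" "\<bar>a * b\<bar> \<le> 1"
      using ab by (simp_all add: abs_square_le_1 abs_mult mult_le_one)
    have "(?Q z)\<^sup>2 \<le> 3 * (a\<^sup>2 * D (fst z))\<^sup>2 + 3 * (b\<^sup>2 * D (snd z))\<^sup>2 + 3 * (2 * (a * b) * E (fst z) (snd z))\<^sup>2"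
      unfolding e by (rule cube)
    also have "(2 * (a * b) * E (fst z) (snd z))\<^sup>2 = 4 * (a * b * E (fst z) (snd z))\<^sup>2" by (simp add: power_mult_distrib)
    finally show "(?Q z)\<^sup>2 \<le> 3 * (D (fst z))\<^sup>2 + 3 * (D (snd z))\<^sup>2 + 12 * (E (fst z) (snd z))\<^sup>2"
      using le[OF abs(1), of "D (fst z)"] le[OF abs(2), of "D (snd z)"] le[OF abs(3), of "E (fst z) (snd z)"] by linarith
  qed auto
  also have "\<dots> = 3 * (\<integral>z. (D (fst z))\<^sup>2 \<partial>square_uniform) + 3 * (\<integral>z. (D (snd z))\<^sup>2 \<partial>square_uniform)
      + 12 * (\<integral>z. (E (fst z) (snd z))\<^sup>2 \<partial>square_uniform)"
    using D2' by simp
  also have "\<dots> \<le> 18 * real \<kappa> * G" using D2' E2 by linarith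
  finally show ?thesis unfolding G_def f_def .
qed


text \<open>The characteristic function at t of the retained part of the random polynomial, as a
  function of a uniform \<theta> with \<omega> fixed.\<close>

definition covered_char :: "complex \<Rightarrow> nat \<Rightarrow> nat \<Rightarrow> 'a \<Rightarrow> complex" where
  "covered_char t N y \<omega> = (\<integral>\<theta>. exp (\<i> * of_real (\<Sum>p\<in>large_primes N y. increment t N p \<omega> \<theta>)) \<partial>unit_uniform)"

lemma covered_char_measurable [measurable]: "covered_char t N y \<in> borel_measurable M"
proof -
  have "(\<lambda>(\<omega>, \<theta>). exp (\<i> * complex_of_real (\<Sum>p\<in>large_primes N y. increment t N p \<omega> \<theta>))) \<in> borel_measurable (M \<Otimes>\<^sub>M unit_uniform)"
    unfolding case_prod_beta by measurable
  from unit_uniform.borel_measurable_lebesgue_integral[OF this]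
  show ?thesis by (simp add: covered_char_def[abs_def])
qed

lemma norm_covered_char_le: "norm (covered_char t N y \<omega>) \<le> 1"
  using norm_integral_le[of unit_uniform "\<lambda>_. 1" "\<lambda>\<theta>. exp (\<i> * complex_of_real (\<Sum>p\<in>large_primes N y. increment t N p \<omega> \<theta>))"]
  by (simp add: covered_char_def norm_exp unit_uniform.prob_space)

text \<open>With c = exp (- v / 2), the mean of the characteristic function is near c and the mean
  of its squared modulus near c^2, since the difference of two independent points has variance 2 v.
  Expanding the square of the distance to c leaves the error three times, which turns the constant 2
  into 6.\<close>

lemma char_variance_le:
  fixes t :: complex and N y \<kappa> :: nat and \<eta> :: real
  assumes N: "N \<ge> 1" and \<eta>: "\<eta> > 0"
    and \<kappa>: "\<And>h. 0 < h \<Longrightarrow> h \<le> 2 * N \<Longrightarrow> card {p \<in> prime_factors h. y < p} \<le> \<kappa>"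
  defines "v \<equiv> (\<Sum>p\<in>large_primes N y. (norm t)\<^sup>2 / 2 * (real (card (cofactors N p)) / real N))"
    and "F \<equiv> (\<Sum>p\<in>large_primes N y. real (card (square_quads {1..N div p})) / (real N)\<^sup>2)"
  shows "expectation (\<lambda>\<omega>. (norm (covered_char t N y \<omega> - of_real (exp (- v / 2))))\<^sup>2)
     \<le> 6 * (16 * norm t ^ 4 * F + \<eta> + 18 * real \<kappa> * (norm t ^ 4 * F) / \<eta>)"
proof -
  let ?I = "large_primes N y"
  define C where "C = norm t * real N"
  define err where "err = 2 * (16 * norm t ^ 4 * F + \<eta> + 18 * real \<kappa> * (norm t ^ 4 * F) / \<eta>)"
  have prim: "prime p" if "p \<in> ?I" for p using that by (simp add: large_primes_def)
  have C0: "C \<ge> 0" by (simp add: C_def)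
  have incC: "\<bar>increment t N p \<omega> \<theta>\<bar> \<le> C" if "p \<in> ?I" "\<omega> \<in> space M" for p \<omega> \<theta>
    unfolding C_def using that N by (intro abs_increment_le prim)
  have v0: "v \<ge> 0" unfolding v_def by (intro sum_nonneg) auto
  interpret PW: pair_prob_space M square_uniform ..
  interpret PU: pair_prob_space M unit_uniform ..
  define G where "G \<omega> = (\<Sum>p\<in>?I. \<integral>\<theta>. increment t N p \<omega> \<theta> ^ 4 \<partial>unit_uniform)" for \<omega>
  have inc4: "\<bar>increment t N p \<omega> \<theta> ^ 4\<bar> \<le> C ^ 4" if "p \<in> ?I" "\<omega> \<in> space M" for p \<omega> \<theta>
    using power_mono[OF incC[OF that], where n = 4] by (simp add: power_even_abs)
  have intPU: "integrable (M \<Otimes>\<^sub>M unit_uniform) (\<lambda>(\<omega>, \<theta>). increment t N p \<omega> \<theta> ^ 4)" if "p \<in> ?I" for p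
    by (rule PU.P.integrable_const_bound[of _ "C ^ 4"])
       (use inc4[OF that] in \<open>auto intro!: AE_I2 simp: space_pair_measure split: prod.splits\<close>)
  have intG0: "integrable M (\<lambda>\<omega>. \<integral>\<theta>. increment t N p \<omega> \<theta> ^ 4 \<partial>unit_uniform)" if "p \<in> ?I" for p
    using PU.integrable_fst'[OF intPU[OF that]] by simp
  have intG: "integrable M G" unfolding G_def using intG0 by (intro Bochner_Integration.integrable_sum) auto
  have EG: "expectation G \<le> norm t ^ 4 * F"
  proof -
    have "expectation G = (\<Sum>p\<in>?I. expectation (\<lambda>\<omega>. \<integral>\<theta>. increment t N p \<omega> \<theta> ^ 4 \<partial>unit_uniform))"
      unfolding G_def using intG0 by (rule Bochner_Integration.integral_sum)
    also have "\<dots> = (\<Sum>p\<in>?I. \<integral>\<theta>. expectation (\<lambda>\<omega>. increment t N p \<omega> \<theta> ^ 4) \<partial>unit_uniform)"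
      using PU.Fubini_integral[OF intPU] by (intro sum.cong refl) simp
    also have "\<dots> \<le> (\<Sum>p\<in>?I. \<integral>\<theta>. norm t ^ 4 * (real (card (square_quads {1..N div p})) / (real N)\<^sup>2) \<partial>unit_uniform)"
      by (intro sum_mono integral_mono' fourth_moment_increment prim N) auto
    also have "\<dots> = norm t ^ 4 * F" by (simp add: F_def sum_distrib_left unit_uniform.prob_space)
    finally show ?thesis .
  qed
  have main: "norm (expectation (\<lambda>\<omega>. \<integral>z. exp (\<i> * of_real (\<Sum>p\<in>?I. a * increment t N p \<omega> (fst z) + b * increment t N p \<omega> (snd z))) \<partial>square_uniform)
      - of_real (exp (- ((a\<^sup>2 + b\<^sup>2) * v) / 2))) \<le> err" if ab: "\<bar>a\<bar> \<le> 1" "\<bar>b\<bar> \<le> 1" for a b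
  proof -
    define \<zeta> where "\<zeta> p \<omega> z = a * increment t N p \<omega> (fst z) + b * increment t N p \<omega> (snd z)" for p \<omega> and z :: "real \<times> real"
    define g where "g \<omega> z = exp (\<i> * complex_of_real (\<Sum>p\<in>?I. \<zeta> p \<omega> z))" for \<omega> z
    define V where "V = (a\<^sup>2 + b\<^sup>2) * v"
    define h where "h \<omega> z = \<bar>(\<Sum>p\<in>?I. (\<zeta> p \<omega> z)\<^sup>2) - V\<bar>" for \<omega> z
    have V0: "V \<ge> 0" using v0 by (simp add: V_def)
    have m\<zeta> [measurable]: "(\<lambda>x. \<zeta> p (fst x) (snd x)) \<in> borel_measurable (M \<Otimes>\<^sub>M square_uniform)" for p
      unfolding \<zeta>_def by measurable
    have mg: "(\<lambda>(\<omega>, z). g \<omega> z) \<in> borel_measurable (M \<Otimes>\<^sub>M square_uniform)"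
      unfolding g_def case_prod_beta by measurable
    have mh: "(\<lambda>(\<omega>, z). h \<omega> z) \<in> borel_measurable (M \<Otimes>\<^sub>M square_uniform)"
      unfolding h_def case_prod_beta by measurable
    have ig: "integrable (M \<Otimes>\<^sub>M square_uniform) (\<lambda>(\<omega>, z). g \<omega> z)"
      by (rule PW.P.integrable_const_bound[of _ 1, OF _ mg]) (auto simp: g_def norm_exp)
    define B where "B = (\<Sum>p\<in>?I. (2 * C)\<^sup>2) + V"
    have hB: "h \<omega> z \<le> B" if "\<omega> \<in> space M" for \<omega> z
    proof -
      have "(\<zeta> p \<omega> z)\<^sup>2 \<le> (2 * C)\<^sup>2" if p: "p \<in> ?I" for p
      proof -
        have "\<bar>\<zeta> p \<omega> z\<bar> \<le> \<bar>a\<bar> * \<bar>increment t N p \<omega> (fst z)\<bar> + \<bar>b\<bar> * \<bar>increment t N p \<omega> (snd z)\<bar>"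
          unfolding \<zeta>_def by (metis abs_mult abs_triangle_ineq)
        also have "\<dots> \<le> 1 * C + 1 * C"
          using ab C0 \<open>\<omega> \<in> space M\<close> p by (intro add_mono mult_mono incC) auto
        finally have "\<bar>\<zeta> p \<omega> z\<bar> \<le> \<bar>2 * C\<bar>" by simp
        thus ?thesis by (simp only: abs_le_square_iff)
      qed
      hence "(\<Sum>p\<in>?I. (\<zeta> p \<omega> z)\<^sup>2) \<le> (\<Sum>p\<in>?I. (2 * C)\<^sup>2)" by (intro sum_mono)
      moreover have "(\<Sum>p\<in>?I. (\<zeta> p \<omega> z)\<^sup>2) \<ge> 0" by (intro sum_nonneg) auto
      ultimately show ?thesis using V0 unfolding h_def B_def by linarith
    qed
    have h0: "h \<omega> z \<ge> 0" for \<omega> z by (simp add: h_def)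
    have ih: "integrable (M \<Otimes>\<^sub>M square_uniform) (\<lambda>(\<omega>, z). h \<omega> z)"
      by (rule PW.P.integrable_const_bound[of _ B, OF _ mh])
         (use hB h0 in \<open>auto intro!: AE_I2 simp: space_pair_measure split: prod.splits\<close>)
    have inth: "(\<integral>z. h \<omega> z \<partial>square_uniform) \<le> (\<eta> + 18 * real \<kappa> * G \<omega> / \<eta>) / 2" if w: "\<omega> \<in> space M" for \<omega>
    proof -
      have [measurable]: "h \<omega> \<in> borel_measurable square_uniform"
        using measurable_Pair2[OF mh w] by simp
      have i2: "integrable square_uniform (\<lambda>z. (h \<omega> z)\<^sup>2)"
        by (rule square_uniform.P.integrable_const_bound[of _ "B\<^sup>2"])
           (use hB[OF w] h0 in \<open>auto intro!: AE_I2 power_mono\<close>)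
      \<comment> \<open>The inequality h \<le> (\<eta> + h^2 / \<eta>) / 2 passes from the first to
        the second moment. The scale \<eta> stays free and is tuned to j when N = j^A.\<close>
      have "(\<integral>z. h \<omega> z \<partial>square_uniform) \<le> (\<integral>z. (\<eta> + (h \<omega> z)\<^sup>2 / \<eta>) / 2 \<partial>square_uniform)"
      proof (rule integral_mono')
        show "integrable square_uniform (\<lambda>z. (\<eta> + (h \<omega> z)\<^sup>2 / \<eta>) / 2)" using i2 by simp
        fix z
        have "0 \<le> (h \<omega> z - \<eta>)\<^sup>2 / \<eta>" using \<eta> by simp
        also have "\<dots> = (h \<omega> z)\<^sup>2 / \<eta> - 2 * h \<omega> z + \<eta>" using \<eta> by (simp add: power2_eq_square field_simps)
        finally show "h \<omega> z \<le> (\<eta> + (h \<omega> z)\<^sup>2 / \<eta>) / 2" by simp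
        show "0 \<le> (\<eta> + (h \<omega> z)\<^sup>2 / \<eta>) / 2" using \<eta> by simp
      qed
      also have "\<dots> = (\<eta> + (\<integral>z. (h \<omega> z)\<^sup>2 \<partial>square_uniform) / \<eta>) / 2"
        using i2 by (simp add: square_uniform.P.prob_space)
      also have "\<dots> \<le> (\<eta> + 18 * real \<kappa> * G \<omega> / \<eta>) / 2"
        using quadratic_variation_deviation[OF N ab w \<kappa>, where t = t] \<eta>
        by (intro divide_right_mono add_left_mono) (auto simp: h_def \<zeta>_def V_def v_def G_def)
      finally show ?thesis .
    qed
    have "(\<integral>z. expectation (\<lambda>\<omega>. h \<omega> z) \<partial>square_uniform) = expectation (\<lambda>\<omega>. \<integral>z. h \<omega> z \<partial>square_uniform)"
      by (rule PW.Fubini_integral[OF ih])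
    also have "\<dots> \<le> expectation (\<lambda>\<omega>. (\<eta> + 18 * real \<kappa> * G \<omega> / \<eta>) / 2)"
      using PW.integrable_fst'[OF ih] intG inth by (intro integral_mono) auto
    also have "\<dots> = (\<eta> + 18 * real \<kappa> * expectation G / \<eta>) / 2" using intG by (simp add: prob_space)
    also have "\<dots> \<le> (\<eta> + 18 * real \<kappa> * (norm t ^ 4 * F) / \<eta>) / 2"
      using EG \<eta> by (intro divide_right_mono add_left_mono mult_left_mono) auto
    finally have Eh: "(\<integral>z. expectation (\<lambda>\<omega>. h \<omega> z) \<partial>square_uniform) \<le> \<dots>" .
    have ihz: "integrable square_uniform (\<lambda>z. expectation (\<lambda>\<omega>. h \<omega> z))"
      using PW.integrable_snd[OF ih] .
    have igz: "integrable square_uniform (\<lambda>z. expectation (\<lambda>\<omega>. g \<omega> z))"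
      using PW.integrable_snd[OF ig] .
    have "norm (expectation (\<lambda>\<omega>. \<integral>z. g \<omega> z \<partial>square_uniform) - of_real (exp (- V / 2)))
      = norm (\<integral>z. expectation (\<lambda>\<omega>. g \<omega> z) - of_real (exp (- V / 2)) \<partial>square_uniform)"
      using igz by (simp add: PW.Fubini_integral[OF ig] square_uniform.P.prob_space)
    also have "\<dots> \<le> (\<integral>z. 2 * (16 * norm t ^ 4 * F + 2 * expectation (\<lambda>\<omega>. h \<omega> z)) \<partial>square_uniform)"
    proof (rule norm_integral_le)
      show "integrable square_uniform (\<lambda>z. 2 * (16 * norm t ^ 4 * F + 2 * expectation (\<lambda>\<omega>. h \<omega> z)))" using ihz by simp
      show "norm (expectation (\<lambda>\<omega>. g \<omega> z) - of_real (exp (- V / 2))) \<le> 2 * (16 * norm t ^ 4 * F + 2 * expectation (\<lambda>\<omega>. h \<omega> z))" for z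
        unfolding g_def h_def \<zeta>_def F_def by (rule char_two_points[OF N ab V0])
    qed
    also have "\<dots> = 2 * (16 * norm t ^ 4 * F + 2 * (\<integral>z. expectation (\<lambda>\<omega>. h \<omega> z) \<partial>square_uniform))"
      using ihz by (simp add: square_uniform.P.prob_space)
    also have "\<dots> \<le> err"
    proof -
      have "2 * (x + 2 * e) \<le> 2 * (x + \<eta> + r)" if "e \<le> (\<eta> + r) / 2" for x e r :: real
        using that by simp
      from this[OF Eh] show ?thesis unfolding err_def .
    qed
    finally show ?thesis unfolding g_def \<zeta>_def V_def .
  qed
  define \<Phi> where "\<Phi> = covered_char t N y"
  define s where "s \<omega> \<theta> = (\<Sum>p\<in>?I. increment t N p \<omega> \<theta>)" for \<omega> \<theta>
  have conts [continuous_intros]: "continuous_on S f \<Longrightarrow> continuous_on S (\<lambda>x. s \<omega> (f x))" for S f \<omega>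
    unfolding s_def by (intro continuous_intros)
  have msw [measurable]: "s \<omega> \<in> borel_measurable borel" for \<omega>
    by (intro borel_measurable_continuous_onI continuous_intros)
  have \<Phi>s: "\<Phi> \<omega> = (\<integral>\<theta>. exp (\<i> * of_real (s \<omega> \<theta>)) \<partial>unit_uniform)" for \<omega> by (simp add: \<Phi>_def covered_char_def s_def)
  have m\<Phi> [measurable]: "\<Phi> \<in> borel_measurable M" unfolding \<Phi>_def by measurable
  have norm\<Phi>: "norm (\<Phi> \<omega>) \<le> 1" for \<omega> unfolding \<Phi>_def by (rule norm_covered_char_le)
  have int\<Phi>: "integrable M \<Phi>" by (rule integrable_const_bound[of _ 1]) (use norm\<Phi> in auto)
  have int\<Phi>2: "integrable M (\<lambda>\<omega>. (norm (\<Phi> \<omega>))\<^sup>2)"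
    by (rule integrable_const_bound[of _ 1]) (use norm\<Phi> in \<open>auto simp: abs_square_le_1\<close>)
  have one: "(\<integral>z. exp (\<i> * of_real (\<Sum>p\<in>?I. 1 * increment t N p \<omega> (fst z) + 0 * increment t N p \<omega> (snd z))) \<partial>square_uniform) = \<Phi> \<omega>" for \<omega>
    using square_uniform_integral(2)[of "\<lambda>z. exp (\<i> * of_real (s \<omega> (fst z)))" 1]
    by (simp add: \<Phi>s norm_exp unit_uniform.prob_space flip: s_def)
  \<comment> \<open>The weight -1 conjugates the exponential at the second point, so the product
    structure yields \<Phi> times its conjugate.\<close>
  have two: "(\<integral>z. exp (\<i> * of_real (\<Sum>p\<in>?I. 1 * increment t N p \<omega> (fst z) + (- 1) * increment t N p \<omega> (snd z))) \<partial>square_uniform)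
     = of_real ((norm (\<Phi> \<omega>))\<^sup>2)" for \<omega>
  proof -
    have "(\<integral>z. exp (\<i> * of_real (\<Sum>p\<in>?I. 1 * increment t N p \<omega> (fst z) + (- 1) * increment t N p \<omega> (snd z))) \<partial>square_uniform)
      = (\<integral>z. exp (\<i> * of_real (s \<omega> (fst z))) * cnj (exp (\<i> * of_real (s \<omega> (snd z)))) \<partial>square_uniform)"
      by (simp add: s_def sum_subtractf exp_cnj exp_diff exp_minus right_diff_distrib divide_inverse)
    also have "\<dots> = (\<integral>x. \<integral>y. exp (\<i> * of_real (s \<omega> x)) * cnj (exp (\<i> * of_real (s \<omega> y))) \<partial>unit_uniform \<partial>unit_uniform)"
      by (subst square_uniform_integral(2)[where C = 1]) (auto simp: norm_mult norm_exp)
    also have "\<dots> = \<Phi> \<omega> * cnj (\<Phi> \<omega>)" unfolding \<Phi>s integral_cnj[symmetric] by simp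
    finally show ?thesis by (simp only: complex_norm_square)
  qed
  let ?c = "exp (- v / 2)"
  have r1: "norm (expectation \<Phi> - of_real ?c) \<le> err"
    using main[of 1 0] unfolding one by simp
  have r2: "\<bar>expectation (\<lambda>\<omega>. (norm (\<Phi> \<omega>))\<^sup>2) - exp (- v)\<bar> \<le> err"
  proof -
    have "norm (expectation (\<lambda>\<omega>. complex_of_real ((norm (\<Phi> \<omega>))\<^sup>2)) - of_real (exp (- v))) \<le> err"
      using main[of 1 "-1"] unfolding two by simp
    thus ?thesis unfolding integral_complex_of_real of_real_diff[symmetric] norm_of_real by simp
  qed
  have "expectation (\<lambda>\<omega>. (norm (\<Phi> \<omega> - of_real ?c))\<^sup>2) = expectation (\<lambda>\<omega>. (norm (\<Phi> \<omega>))\<^sup>2 - 2 * ?c * Re (\<Phi> \<omega>) + exp (- v))"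
  proof (intro Bochner_Integration.integral_cong refl)
    fix \<omega>
    have "?c\<^sup>2 = exp (- v)" by (simp add: power2_eq_square flip: exp_add)
    thus "(norm (\<Phi> \<omega> - of_real ?c))\<^sup>2 = (norm (\<Phi> \<omega>))\<^sup>2 - 2 * ?c * Re (\<Phi> \<omega>) + exp (- v)"
      unfolding cmod_power2 by (simp add: power2_eq_square algebra_simps)
  qed
  also have "\<dots> = expectation (\<lambda>\<omega>. (norm (\<Phi> \<omega>))\<^sup>2) - 2 * ?c * Re (expectation \<Phi>) + exp (- v)"
    using int\<Phi> int\<Phi>2 by (simp add: prob_space)
  also have "\<dots> = (expectation (\<lambda>\<omega>. (norm (\<Phi> \<omega>))\<^sup>2) - exp (- v)) - 2 * ?c * Re (expectation \<Phi> - of_real ?c)"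
  proof -
    have "?c * ?c = exp (- v)" by (simp flip: exp_add)
    thus ?thesis by (simp add: algebra_simps)
  qed
  also have "\<dots> \<le> err + 2 * 1 * err"
  proof -
    have "- (?c * Re (expectation \<Phi> - of_real ?c)) \<le> ?c * norm (expectation \<Phi> - of_real ?c)"
      using abs_Re_le_cmod[of "expectation \<Phi> - of_real ?c"] by (simp flip: mult_minus_right)
    also have "\<dots> \<le> 1 * err" using r1 v0 by (intro mult_mono) auto
    finally show ?thesis using r2 by linarith
  qed
  also have "\<dots> = 6 * (16 * norm t ^ 4 * F + \<eta> + 18 * real \<kappa> * (norm t ^ 4 * F) / \<eta>)" by (simp add: err_def)
  finally show ?thesis unfolding \<Phi>_def .
qed

end

section \<open>Almost sure convergence of characteristic functions\<close>

lemma parseval_nat: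
  fixes b :: "nat \<Rightarrow> complex"
  assumes "finite B"
  shows "(\<integral>\<theta>. (norm (\<Sum>n\<in>B. b n * e_exp (real n * \<theta>)))\<^sup>2 \<partial>unit_uniform) = (\<Sum>n\<in>B. (norm (b n))\<^sup>2)"
  using parseval_finite[of "int ` B" "\<lambda>h. b (nat h)"] assms by (simp add: sum.reindex)

text \<open>The joint characteristic function of the real and imaginary parts of f under a uniform
  \<theta>, with t read as a vector of the plane.\<close>

definition char_int :: "complex \<Rightarrow> (real \<Rightarrow> complex) \<Rightarrow> complex" where
  "char_int t f = (\<integral>\<theta>. exp (\<i> * of_real (Re (cnj t * f \<theta>))) \<partial>unit_uniform)"

lemma norm_exp_ii_diff_le: "norm (exp (\<i> * of_real a) - exp (\<i> * of_real b)) \<le> \<bar>a - b\<bar>" for a b :: real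
proof -
  have "exp (\<i> * of_real a) - exp (\<i> * of_real b) = exp (\<i> * of_real b) * (exp (\<i> * of_real (a - b)) - 1)"
    by (simp add: right_diff_distrib exp_diff)
  hence "norm (exp (\<i> * of_real a) - exp (\<i> * of_real b)) = norm (iexp (a - b) - 1)"
    by (simp add: norm_mult norm_exp)
  also have "\<dots> \<le> \<bar>a - b\<bar>"
    using iexp_approx1[of "a - b" 0] by simp
  finally show ?thesis .
qed

lemma integral_norm_le_sqrt:
  fixes f :: "real \<Rightarrow> complex"
  assumes "continuous_on UNIV f"
  shows "(\<integral>\<theta>. norm (f \<theta>) \<partial>unit_uniform) \<le> sqrt (\<integral>\<theta>. (norm (f \<theta>))\<^sup>2 \<partial>unit_uniform)"
  using assms by (intro real_le_rsqrt unit_uniform.square_expectation_le unit_uniform_integrable continuous_intros)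

lemma char_int_diff_le:
  assumes "continuous_on UNIV f" "continuous_on UNIV g"
  shows "norm (char_int t f - char_int t g) \<le> norm t * sqrt (\<integral>\<theta>. (norm (f \<theta> - g \<theta>))\<^sup>2 \<partial>unit_uniform)"
proof -
  have "char_int t f - char_int t g = (\<integral>\<theta>. exp (\<i> * of_real (Re (cnj t * f \<theta>))) - exp (\<i> * of_real (Re (cnj t * g \<theta>))) \<partial>unit_uniform)"
    unfolding char_int_def using assms
    by (intro Bochner_Integration.integral_diff[symmetric] unit_uniform_integrable continuous_intros)
  also have "norm \<dots> \<le> (\<integral>\<theta>. norm t * norm (f \<theta> - g \<theta>) \<partial>unit_uniform)"
  proof (rule norm_integral_le)
    show "integrable unit_uniform (\<lambda>\<theta>. norm t * norm (f \<theta> - g \<theta>))"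
      using assms by (intro unit_uniform_integrable continuous_intros)
    fix \<theta>
    have "norm (exp (\<i> * of_real (Re (cnj t * f \<theta>))) - exp (\<i> * of_real (Re (cnj t * g \<theta>)))) \<le> \<bar>Re (cnj t * f \<theta>) - Re (cnj t * g \<theta>)\<bar>"
      by (rule norm_exp_ii_diff_le)
    also have "\<dots> = \<bar>Re (cnj t * (f \<theta> - g \<theta>))\<bar>" by (simp add: algebra_simps)
    also have "\<dots> \<le> norm (cnj t * (f \<theta> - g \<theta>))" by (rule abs_Re_le_cmod)
    finally show "norm (exp (\<i> * of_real (Re (cnj t * f \<theta>))) - exp (\<i> * of_real (Re (cnj t * g \<theta>)))) \<le> norm t * norm (f \<theta> - g \<theta>)"
      by (simp add: norm_mult)
  qed
  also have "\<dots> \<le> norm t * sqrt (\<integral>\<theta>. (norm (f \<theta> - g \<theta>))\<^sup>2 \<partial>unit_uniform)"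
    using assms by (simp only: integral_mult_right_zero) (intro mult_left_mono integral_norm_le_sqrt continuous_intros norm_ge_zero)
  finally show ?thesis .
qed

text \<open>For unimodular coefficients the polynomials have mean square 1, so this is
  equicontinuity in t, uniformly in N.\<close>

lemma char_int_lipschitz:
  assumes "continuous_on UNIV f"
  shows "norm (char_int t f - char_int s f) \<le> norm (t - s) * sqrt (\<integral>\<theta>. (norm (f \<theta>))\<^sup>2 \<partial>unit_uniform)"
proof -
  have 1: "char_int u f = char_int 1 (\<lambda>\<theta>. cnj u * f \<theta>)" for u by (simp add: char_int_def)
  have "norm (char_int t f - char_int s f) \<le> norm (1::complex) * sqrt (\<integral>\<theta>. (norm (cnj t * f \<theta> - cnj s * f \<theta>))\<^sup>2 \<partial>unit_uniform)"
    unfolding 1[of t] 1[of s] using assms by (intro char_int_diff_le continuous_intros)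
  also have "(\<lambda>\<theta>. (norm (cnj t * f \<theta> - cnj s * f \<theta>))\<^sup>2) = (\<lambda>\<theta>. (norm (t - s))\<^sup>2 * (norm (f \<theta>))\<^sup>2)"
    by (simp add: norm_mult power_mult_distrib fun_eq_iff flip: left_diff_distrib complex_cnj_diff)
  also have "(\<integral>\<theta>. (norm (t - s))\<^sup>2 * (norm (f \<theta>))\<^sup>2 \<partial>unit_uniform) = (norm (t - s))\<^sup>2 * (\<integral>\<theta>. (norm (f \<theta>))\<^sup>2 \<partial>unit_uniform)"
    by (rule integral_mult_right_zero)
  finally show ?thesis by (simp add: real_sqrt_mult)
qed

lemma trig_poly_eq: "trig_poly x N \<theta> = (\<Sum>n\<in>{1..N}. x n / sqrt (real N) * e_exp (real n * \<theta>))"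
  by (simp add: trig_poly_def sum_distrib_left)

lemma continuous_trig_poly [continuous_intros]:
  "continuous_on S f \<Longrightarrow> continuous_on S (\<lambda>\<theta>. trig_poly x N (f \<theta>))"
  unfolding trig_poly_eq by (intro continuous_intros)

lemma trig_poly_norm_square:
  assumes "\<And>n. norm (x n) = 1" "N \<ge> 1"
  shows "(\<integral>\<theta>. (norm (trig_poly x N \<theta>))\<^sup>2 \<partial>unit_uniform) = 1"
  unfolding trig_poly_eq using assms by (subst parseval_nat) (auto simp: norm_divide power_divide)

text \<open>By Parseval the left side is exactly 2 (1 - sqrt (K / N)): the first K coefficients
  change through the normalization, the other N - K are new. It is small when K / N is near 1, as
  between consecutive A-th powers.\<close>

lemma trig_poly_gap:
  assumes x: "\<And>n. norm (x n) = 1" and "1 \<le> K" "K \<le> N"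
  shows "(\<integral>\<theta>. (norm (trig_poly x N \<theta> - trig_poly x K \<theta>))\<^sup>2 \<partial>unit_uniform) \<le> 2 * (1 - real K / real N)"
proof -
  define b where "b n = (if n \<le> K then x n * of_real (1 / sqrt (real N) - 1 / sqrt (real K)) else x n / sqrt (real N))" for n
  have pos: "real K > 0" "real N > 0" using assms by auto
  have "trig_poly x N \<theta> - trig_poly x K \<theta> = (\<Sum>n\<in>{1..N}. b n * e_exp (real n * \<theta>))" for \<theta>
  proof -
    have K: "trig_poly x K \<theta> = (\<Sum>n\<in>{1..N}. (if n \<le> K then x n / sqrt (real K) else 0) * e_exp (real n * \<theta>))"
      unfolding trig_poly_eq using assms by (intro sum.mono_neutral_cong_left) auto
    show ?thesis
      unfolding trig_poly_eq[of x N] K sum_subtractf[symmetric]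
      by (intro sum.cong refl) (simp add: b_def left_diff_distrib right_diff_distrib)
  qed
  hence "(\<integral>\<theta>. (norm (trig_poly x N \<theta> - trig_poly x K \<theta>))\<^sup>2 \<partial>unit_uniform) = (\<Sum>n\<in>{1..N}. (norm (b n))\<^sup>2)"
    by (simp add: parseval_nat)
  also have "\<dots> = (\<Sum>n\<in>{1..K}. (norm (b n))\<^sup>2) + (\<Sum>n\<in>{K<..N}. (norm (b n))\<^sup>2)"
    using assms by (subst sum.union_disjoint[symmetric]) (auto intro!: sum.cong)
  also have "(\<Sum>n\<in>{1..K}. (norm (b n))\<^sup>2) = (\<Sum>n\<in>{1..K}. (1 / sqrt (real N) - 1 / sqrt (real K))\<^sup>2)"
    by (intro sum.cong refl) (simp add: b_def norm_mult x del: of_real_diff of_real_divide)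
  also have "(\<Sum>n\<in>{K<..N}. (norm (b n))\<^sup>2) = (\<Sum>n\<in>{K<..N}. 1 / real N)"
    by (intro sum.cong refl) (simp add: b_def norm_divide x power_divide)
  also have "(\<Sum>n\<in>{1..K}. (1 / sqrt (real N) - 1 / sqrt (real K))\<^sup>2) + (\<Sum>n\<in>{K<..N}. 1 / real N)
     = 2 * (1 - sqrt (real K) / sqrt (real N))"
  proof -
    define k where "k = sqrt (real K)"
    define m where "m = sqrt (real N)"
    have km: "k > 0" "m > 0" "real K = k\<^sup>2" "real N = m\<^sup>2" using pos by (auto simp: k_def m_def)
    have "(\<Sum>n\<in>{1..K}. (1 / m - 1 / k)\<^sup>2) + (\<Sum>n\<in>{K<..N}. 1 / real N) = k\<^sup>2 * (1 / m - 1 / k)\<^sup>2 + (m\<^sup>2 - k\<^sup>2) / m\<^sup>2"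
      using assms km by (simp add: of_nat_diff)
    also have "k\<^sup>2 * (1 / m - 1 / k)\<^sup>2 = (k / m - 1)\<^sup>2"
      using km by (simp add: right_diff_distrib flip: power_mult_distrib)
    also have "(m\<^sup>2 - k\<^sup>2) / m\<^sup>2 = 1 - (k / m)\<^sup>2"
      using km by (simp add: diff_divide_distrib power_divide)
    also have "(z - 1)\<^sup>2 + (1 - z\<^sup>2) = 2 * (1 - z)" for z :: real
      by (simp add: power2_eq_square algebra_simps)
    finally show ?thesis by (simp add: k_def m_def)
  qed
  also have "\<dots> \<le> 2 * (1 - real K / real N)"
  proof -
    define r where "r = sqrt (real K) / sqrt (real N)"
    have "0 \<le> r" "r \<le> 1" using assms pos by (auto simp: r_def)
    hence "r * r \<le> r * 1" by (intro mult_left_mono) auto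
    moreover have "r * r = real K / real N" by (simp add: r_def)
    ultimately show ?thesis by (simp add: r_def)
  qed
  finally show ?thesis .
qed

text \<open>The sum of all squares has finite expectation, hence is finite almost surely, and the
  terms of a convergent series tend to 0.\<close>

lemma (in prob_space) AE_tendsto_0_if_summable:
  fixes Y :: "nat \<Rightarrow> 'a \<Rightarrow> complex"
  assumes [measurable]: "\<And>j. Y j \<in> borel_measurable M" and int: "\<And>j. integrable M (\<lambda>\<omega>. (norm (Y j \<omega>))\<^sup>2)"
    and le: "\<And>j. expectation (\<lambda>\<omega>. (norm (Y j \<omega>))\<^sup>2) \<le> b j" and b: "summable b"
  shows "AE \<omega> in M. (\<lambda>j. Y j \<omega>) \<longlonglongrightarrow> 0"
proof -
  have b0: "b j \<ge> 0" for j using le[of j] by (rule order.trans[rotated]) (auto intro!: integral_nonneg_AE)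
  have "(\<integral>\<^sup>+\<omega>. (\<Sum>j. ennreal ((norm (Y j \<omega>))\<^sup>2)) \<partial>M) = (\<Sum>j. \<integral>\<^sup>+\<omega>. ennreal ((norm (Y j \<omega>))\<^sup>2) \<partial>M)"
    by (rule nn_integral_suminf) measurable
  also have "\<dots> \<le> (\<Sum>j. ennreal (b j))"
    by (intro suminf_le) (auto simp: nn_integral_eq_integral[OF int] intro!: ennreal_leI le)
  also have "\<dots> < \<infinity>" using b b0 by (simp add: suminf_ennreal2 less_top)
  finally have "AE \<omega> in M. (\<Sum>j. ennreal ((norm (Y j \<omega>))\<^sup>2)) \<noteq> \<infinity>"
    by (intro nn_integral_PInf_AE) auto
  thus ?thesis
  proof eventually_elim
    case (elim \<omega>)
    hence "summable (\<lambda>j. (norm (Y j \<omega>))\<^sup>2)" by (intro summable_suminf_not_top) auto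
    hence "(\<lambda>j. (norm (Y j \<omega>))\<^sup>2) \<longlonglongrightarrow> 0" by (rule summable_LIMSEQ_zero)
    hence "(\<lambda>j. sqrt ((norm (Y j \<omega>))\<^sup>2)) \<longlonglongrightarrow> sqrt 0" by (rule tendsto_real_sqrt)
    thus ?case by (simp add: tendsto_norm_zero_iff)
  qed
qed

text \<open>The order of choices matters: A is fixed first, to make \<open>\<delta> A\<close> small,
  and only then j is taken large, to make \<open>e A j\<close> and the gap small. For fixed A the
  ratio (j / (j + 1))^A tends to 1, and every N lies between two consecutive A-th powers.\<close>

lemma tendsto_if_tendsto_along_powers:
  fixes c :: "nat \<Rightarrow> complex" and e :: "nat \<Rightarrow> nat \<Rightarrow> real" and \<delta> :: "nat \<Rightarrow> real"
  assumes powers: "\<And>A j. A \<ge> 1 \<Longrightarrow> j \<ge> 2 \<Longrightarrow> norm (c (j ^ A) - L) \<le> e A j + \<delta> A"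
    and e: "\<And>A. A \<ge> 1 \<Longrightarrow> e A \<longlonglongrightarrow> 0" and \<delta>: "\<delta> \<longlonglongrightarrow> 0"
    and gap: "\<And>K N. 1 \<le> K \<Longrightarrow> K \<le> N \<Longrightarrow> norm (c N - c K) \<le> \<tau> * sqrt (2 * (1 - real K / real N))"
    and \<tau>: "\<tau> \<ge> 0"
  shows "c \<longlonglongrightarrow> L"
proof (rule LIMSEQ_I)
  fix r :: real assume r: "r > 0"
  have "eventually (\<lambda>A. \<delta> A < r / 3) sequentially" using \<delta> r by (intro order_tendstoD) auto
  hence "eventually (\<lambda>A. \<delta> A < r / 3 \<and> A \<ge> 1) sequentially"
    using eventually_ge_at_top[of 1] by eventually_elim auto
  then obtain A where A: "\<delta> A < r / 3" "A \<ge> 1" using eventually_happens' sequentially_bot by blast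
  have "(\<lambda>j. real j / real (Suc j)) \<longlonglongrightarrow> 1" by (rule LIMSEQ_n_over_Suc_n)
  hence "(\<lambda>j. \<tau> * sqrt (2 * (1 - (real j / real (Suc j)) ^ A))) \<longlonglongrightarrow> \<tau> * sqrt (2 * (1 - 1 ^ A))"
    by (intro tendsto_intros)
  hence "eventually (\<lambda>j. \<tau> * sqrt (2 * (1 - (real j / real (Suc j)) ^ A)) < r / 3) sequentially"
    using r by (intro order_tendstoD(2)) auto
  moreover have "eventually (\<lambda>j. e A j < r / 3) sequentially"
    using e[OF A(2)] r by (intro order_tendstoD) auto
  ultimately have "eventually (\<lambda>j. \<tau> * sqrt (2 * (1 - (real j / real (Suc j)) ^ A)) < r / 3 \<and> e A j < r / 3 \<and> j \<ge> 2) sequentially"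
    using eventually_ge_at_top[of 2] by eventually_elim auto
  then obtain J where J: "\<And>j. j \<ge> J \<Longrightarrow> \<tau> * sqrt (2 * (1 - (real j / real (Suc j)) ^ A)) < r / 3"
     "\<And>j. j \<ge> J \<Longrightarrow> e A j < r / 3" "\<And>j. j \<ge> J \<Longrightarrow> j \<ge> 2"
    unfolding eventually_sequentially by blast
  show "\<exists>N0. \<forall>N\<ge>N0. norm (c N - L) < r"
  proof (intro exI[of _ "J ^ A"] allI impI)
    fix N assume N: "J ^ A \<le> N"
    define j where "j = nth_root_nat A N"
    have A0: "A > 0" using A by simp
    have jN: "j ^ A \<le> N" unfolding j_def using A0 by (rule nth_root_nat_power_le)
    have Nj: "N < Suc j ^ A"
      using nth_root_nat_ge[OF A0, of "Suc j" N] unfolding j_def by (meson Suc_n_not_le_n not_le)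
    have jJ: "j \<ge> J" unfolding j_def using N A0 by (intro nth_root_nat_ge)
    have j2: "j \<ge> 2" using J(3)[OF jJ] .
    have K1: "1 \<le> j ^ A" using j2 by simp
    have "norm (c N - c (j ^ A)) \<le> \<tau> * sqrt (2 * (1 - real (j ^ A) / real N))"
      by (rule gap[OF K1 jN])
    also have "\<dots> \<le> \<tau> * sqrt (2 * (1 - (real j / real (Suc j)) ^ A))"
    proof (intro mult_left_mono \<tau> real_sqrt_le_mono diff_left_mono)
      have "(real j / real (Suc j)) ^ A = real (j ^ A) / real (Suc j ^ A)" by (simp add: power_divide)
      also have "\<dots> \<le> real (j ^ A) / real N"
        using Nj jN K1 by (intro divide_left_mono of_nat_mono) auto
      finally show "(real j / real (Suc j)) ^ A \<le> real (j ^ A) / real N" .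
    qed auto
    finally have "norm (c N - c (j ^ A)) < r / 3" using J(1)[OF jJ] by linarith
    moreover have "norm (c (j ^ A) - L) < r / 3 + r / 3"
      using powers[OF A(2) j2] J(2)[OF jJ] A(1) by linarith
    ultimately show "norm (c N - L) < r"
      using norm_triangle_ineq[of "c N - c (j ^ A)" "c (j ^ A) - L"] by simp
  qed
qed

text \<open>With \<epsilon> = 1 / A the count of quadruples exceeds (N / p)^2 by at most a constant
  times N^(1/A) = j. The sum of 1 / p^2 over p > j^5 is at most j^(-5), which leaves j^(-4).\<close>

lemma fourth_moment_sum_le:
  assumes A: "A \<ge> 1"
  obtains C where "C \<ge> 0" "\<And>j. j \<ge> 2 \<Longrightarrow>
    (\<Sum>p\<in>large_primes (j ^ A) (j ^ 5). real (card (square_quads {1..j ^ A div p})) / (real (j ^ A))\<^sup>2) \<le> C / real j ^ 4"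
proof -
  obtain C where C: "C \<ge> 0" "\<And>M::nat. M \<ge> 1 \<Longrightarrow> real (card (square_quads {1..M})) \<le> C * real M powr (2 + 1 / real A)"
    using card_square_quads_le[of "1 / real A"] A by auto
  show ?thesis
  proof (rule that[OF C(1)])
    fix j :: nat assume j: "j \<ge> 2"
    define N where "N = j ^ A"
    have N0: "real N > 0" using j by (simp add: N_def)
    have "(\<Sum>p\<in>large_primes N (j ^ 5). real (card (square_quads {1..N div p})) / (real N)\<^sup>2)
       \<le> (\<Sum>p\<in>large_primes N (j ^ 5). C * real j * (1 / (real p)\<^sup>2))"
    proof (rule sum_mono)
      fix p assume "p \<in> large_primes N (j ^ 5)"
      hence p: "p > 0" "p \<le> N" by (auto simp: large_primes_def prime_gt_0_nat)
      have "N div p \<ge> 1" using p by (simp add: Suc_le_eq div_greater_zero_iff)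
      hence "real (card (square_quads {1..N div p})) \<le> C * real (N div p) powr (2 + 1 / real A)" by (rule C(2))
      also have "\<dots> \<le> C * (real N / real p) powr (2 + 1 / real A)"
        using C(1) by (intro mult_left_mono powr_mono2 of_nat_div_le_of_nat) auto
      also have "\<dots> = C * ((real N / real p)\<^sup>2 * (real N / real p) powr (1 / real A))"
        using p N0 by (simp add: powr_add)
      also have "\<dots> \<le> C * ((real N / real p)\<^sup>2 * real j)"
      proof (intro mult_left_mono C(1))
        have "real N / real p \<le> real N / 1" using p by (intro divide_left_mono) auto
        hence "(real N / real p) powr (1 / real A) \<le> real N powr (1 / real A)" by (intro powr_mono2) auto
        also have "real N powr (1 / real A) = (real j powr real A) powr (1 / real A)"
          using j by (simp add: N_def powr_realpow)
        also have "\<dots> = real j" using j A by (simp add: powr_powr)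
        finally show "(real N / real p) powr (1 / real A) \<le> real j" .
      qed auto
      finally have "real (card (square_quads {1..N div p})) / (real N)\<^sup>2 \<le> C * ((real N / real p)\<^sup>2 * real j) / (real N)\<^sup>2"
        by (intro divide_right_mono) auto
      also have "\<dots> = C * real j * (1 / (real p)\<^sup>2)" using N0 by (simp add: power_divide)
      finally show "real (card (square_quads {1..N div p})) / (real N)\<^sup>2 \<le> C * real j * (1 / (real p)\<^sup>2)" .
    qed
    also have "\<dots> = C * real j * (\<Sum>p\<in>large_primes N (j ^ 5). 1 / (real p)\<^sup>2)" by (rule sum_distrib_left[symmetric])
    also have "\<dots> \<le> C * real j * (1 / real (j ^ 5))"
      using C(1) j by (intro mult_left_mono sum_inverse_squares_le) (auto simp: large_primes_def)
    also have "\<dots> = C / real j ^ 4" using j by (simp add: eval_nat_numeral)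
    finally show "(\<Sum>p\<in>large_primes (j ^ A) (j ^ 5). real (card (square_quads {1..j ^ A div p})) / (real (j ^ A))\<^sup>2) \<le> C / real j ^ 4"
      unfolding N_def .
  qed
qed

context symmetric_multiplicative
begin

lemma sum_increment_eq:
  "(\<Sum>p\<in>large_primes N y. increment t N p \<omega> \<theta>)
     = Re (cnj t * (\<Sum>n\<in>covered N y. X n \<omega> / sqrt (real N) * e_exp (real n * \<theta>)))"
proof -
  let ?f = "\<lambda>n. cnj t / sqrt (real N) * X n \<omega> * e_exp (real n * \<theta>)"
  have "(\<Sum>p\<in>large_primes N y. increment t N p \<omega> \<theta>) = Re (\<Sum>p\<in>large_primes N y. \<Sum>m\<in>cofactors N p. ?f (p * m))"
    unfolding increment_def Re_sum[of "\<lambda>p. \<Sum>m\<in>cofactors N p. ?f (p * m)"]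
    by (intro sum.cong refl arg_cong[of _ _ Re] sum.reindex_cong[of "\<lambda>m. _ * m"] inj_onI)
       (auto simp: large_primes_def)
  also have "(\<Sum>p\<in>large_primes N y. \<Sum>m\<in>cofactors N p. ?f (p * m)) = (\<Sum>(p, m)\<in>(SIGMA p:large_primes N y. cofactors N p). ?f (p * m))"
    by (intro sum.Sigma finite_large_primes ballI finite_cofactors) (auto simp: large_primes_def prime_gt_0_nat)
  also have "\<dots> = (\<Sum>n\<in>covered N y. ?f n)"
    unfolding covered_def sum.reindex[OF inj_on_prime_times_cofactor] by (simp add: case_prod_beta o_def)
  finally show ?thesis by (simp add: sum_distrib_left mult_ac)
qed

text \<open>In \<open>char_variance_le\<close> the choice \<eta> = 1 / j^2 balances the terms: as F
  is O(j^(-4)), each of F, \<eta> and F / \<eta> is O(j^(-2)), a summable bound.\<close>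

lemma covered_char_tendsto:
  assumes A: "A \<ge> 1"
  shows "AE \<omega> in M. (\<lambda>j. covered_char t (j ^ A) (j ^ 5) \<omega>
     - of_real (exp (- ((norm t)\<^sup>2 / 2 * (real (card (covered (j ^ A) (j ^ 5))) / real (j ^ A))) / 2))) \<longlonglongrightarrow> 0"
proof -
  obtain C where C: "C \<ge> 0" "\<And>j. j \<ge> 2 \<Longrightarrow>
    (\<Sum>p\<in>large_primes (j ^ A) (j ^ 5). real (card (square_quads {1..j ^ A div p})) / (real (j ^ A))\<^sup>2) \<le> C / real j ^ 4"
    using fourth_moment_sum_le[OF A] by blast
  define v where "v j = (norm t)\<^sup>2 / 2 * (real (card (covered (j ^ A) (j ^ 5))) / real (j ^ A))" for j
  define Y where "Y j \<omega> = covered_char t (j ^ A) (j ^ 5) \<omega> - of_real (exp (- v j / 2))" for j \<omega>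
  have mY [measurable]: "Y j \<in> borel_measurable M" for j unfolding Y_def by measurable
  have nY: "norm (Y j \<omega>) \<le> 2" for j \<omega>
  proof -
    have "v j \<ge> 0" by (simp add: v_def)
    hence "norm (complex_of_real (exp (- v j / 2))) \<le> 1" unfolding norm_of_real by simp
    thus ?thesis unfolding Y_def
      using norm_triangle_ineq4[of "covered_char t (j ^ A) (j ^ 5) \<omega>" "of_real (exp (- v j / 2))"]
        norm_covered_char_le[of t "j ^ A" "j ^ 5" \<omega>] by linarith
  qed
  define B where "B = 6 * (16 * norm t ^ 4 * C + 1 + 18 * real (A + 1) * (norm t ^ 4 * C))"
  have EY: "expectation (\<lambda>\<omega>. (norm (Y j \<omega>))\<^sup>2) \<le> B / (real j)\<^sup>2" if j: "j \<ge> 2" for j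
  proof -
    define N where "N = j ^ A"
    define F where "F = (\<Sum>p\<in>large_primes N (j ^ 5). real (card (square_quads {1..N div p})) / (real N)\<^sup>2)"
    have F: "F \<le> C / real j ^ 4" using C(2)[OF j] by (simp add: F_def N_def)
    have N1: "N \<ge> 1" using j by (simp add: N_def)
    have v: "v j = (\<Sum>p\<in>large_primes N (j ^ 5). (norm t)\<^sup>2 / 2 * (real (card (cofactors N p)) / real N))"
      by (simp add: v_def N_def[symmetric] card_covered sum_distrib_left sum_divide_distrib)
    have "expectation (\<lambda>\<omega>. (norm (Y j \<omega>))\<^sup>2)
       \<le> 6 * (16 * norm t ^ 4 * F + 1 / (real j)\<^sup>2 + 18 * real (A + 1) * (norm t ^ 4 * F) / (1 / (real j)\<^sup>2))"
      unfolding Y_def N_def[symmetric] v F_def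
    proof (rule char_variance_le[OF N1])
      show "0 < 1 / (real j)\<^sup>2" using j by simp
      fix h :: nat assume h: "0 < h" "h \<le> 2 * N"
      \<comment> \<open>Since j \<ge> 2, frequencies up to 2 N are at most j^(A + 1), so at most A +
        1 large primes divide one of them.\<close>
      have "2 * j ^ A \<le> j * j ^ A" using j by (intro mult_right_mono) auto
      from order.trans[OF h(2)[unfolded N_def] this] have "h \<le> j ^ (A + 1)" by simp
      moreover have "j \<le> j ^ 5" by (rule self_le_power) (use j in auto)
      ultimately show "card {p \<in> prime_factors h. j ^ 5 < p} \<le> A + 1"
        using h(1) j by (intro card_large_prime_divisors)
    qed
    also have "\<dots> = 6 * (16 * norm t ^ 4 * F + 1 / (real j)\<^sup>2 + 18 * real (A + 1) * norm t ^ 4 * (F * (real j)\<^sup>2))"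
      by simp
    also have "\<dots> \<le> 6 * (16 * norm t ^ 4 * (C / (real j)\<^sup>2) + 1 / (real j)\<^sup>2 + 18 * real (A + 1) * norm t ^ 4 * (C / (real j)\<^sup>2))"
    proof -
      have j4: "real j ^ 4 = (real j)\<^sup>2 * (real j)\<^sup>2" by (simp add: eval_nat_numeral)
      have "real j \<ge> 1" using j by simp
      hence j0: "(real j)\<^sup>2 \<ge> 1" by (rule one_le_power)
      have "F * (real j)\<^sup>2 \<le> C / real j ^ 4 * (real j)\<^sup>2" using F by (intro mult_right_mono) auto
      also have "\<dots> = C / (real j)\<^sup>2"
      proof -
        have "C / (q * q) * q = C / q" if "q \<ge> 1" for q :: real using that by simp
        from this[OF j0] show ?thesis unfolding j4 .
      qed
      finally have F2: "F * (real j)\<^sup>2 \<le> C / (real j)\<^sup>2" .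
      have "C / real j ^ 4 = C / (real j)\<^sup>2 / (real j)\<^sup>2" unfolding j4 divide_divide_eq_left ..
      also have "\<dots> \<le> C / (real j)\<^sup>2 / 1" using C(1) j j0 by (intro divide_left_mono) auto
      finally have "C / real j ^ 4 \<le> C / (real j)\<^sup>2" by simp
      hence F1: "F \<le> C / (real j)\<^sup>2" using F by linarith
      show ?thesis by (intro mult_left_mono add_mono F1 F2 order.refl) auto
    qed
    also have "\<dots> = B / (real j)\<^sup>2" by (simp add: B_def add_divide_distrib distrib_left mult.assoc)
    finally show ?thesis .
  qed
  \<comment> \<open>The variance bound is available from j = 2 on; the shift is undone by
    \<open>LIMSEQ_offset\<close>.\<close>
  have "AE \<omega> in M. (\<lambda>j. Y (j + 2) \<omega>) \<longlonglongrightarrow> 0"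
  proof (rule AE_tendsto_0_if_summable)
    show "integrable M (\<lambda>\<omega>. (norm (Y (j + 2) \<omega>))\<^sup>2)" for j
      by (rule integrable_const_bound[of _ "2\<^sup>2"]) (use nY in \<open>auto simp del: power_numeral intro!: power_mono\<close>)
    show "expectation (\<lambda>\<omega>. (norm (Y (j + 2) \<omega>))\<^sup>2) \<le> B * (1 / (real (j + 2))\<^sup>2)" for j
      using EY[of "j + 2"] by simp
    show "summable (\<lambda>j. B * (1 / (real (j + 2))\<^sup>2))"
      using summable_ignore_initial_segment[OF inverse_power_summable[of 2, where 'a = real], of 2]
      by (intro summable_mult) (simp add: divide_inverse)
  qed measurable
  thus ?thesis
  proof eventually_elim
    case (elim \<omega>)
    hence "(\<lambda>j. Y j \<omega>) \<longlonglongrightarrow> 0" by (rule LIMSEQ_offset)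
    thus ?case by (simp only: Y_def v_def)
  qed
qed


text \<open>The uncovered proportion u enters twice: as the squared L2 distance between the
  polynomial and its covered part, and through the variance, which carries the factor 1 - u. It is
  at most s + 40 / A, where 40 = 8 * 5 comes from the smooth integers and ln y / ln N = 5 / A. Only
  s vanishes as j grows.\<close>

lemma char_int_trig_poly_power_bound:
  fixes t :: complex and A j :: nat
  assumes w: "\<omega> \<in> space M" and A: "A \<ge> 1" and j: "j \<ge> 2"
  defines "x \<equiv> \<lambda>n. X n \<omega>" and "s \<equiv> 1 / sqrt (real j) + 1 / real j"
    and "Y \<equiv> covered_char t (j ^ A) (j ^ 5) \<omega>
       - of_real (exp (- ((norm t)\<^sup>2 / 2 * (real (card (covered (j ^ A) (j ^ 5))) / real (j ^ A))) / 2))"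
  shows "norm (char_int t (trig_poly x (j ^ A)) - of_real (exp (- (norm t)\<^sup>2 / 4)))
     \<le> (norm Y + norm t * sqrt s + (norm t)\<^sup>2 * s) + (norm t * sqrt (40 / real A) + (norm t)\<^sup>2 * (40 / real A))"
proof -
  define N where "N = j ^ A"
  define y where "y = j ^ 5"
  define u where "u = real (card ({1..N} - covered N y)) / real N"
  have N2: "N \<ge> 2" unfolding N_def using j A by (meson order.trans self_le_power one_le_numeral less_le_trans zero_less_one)
  have y1: "y \<ge> 1" using j by (simp add: y_def)
  have jN: "j \<le> N" "j \<le> y" unfolding N_def y_def using j A by (auto intro!: self_le_power)
  have xn: "norm (x n) = 1" for n using w by (simp add: x_def norm_X)
  have s0: "s \<ge> 0" by (simp add: s_def)
  have u: "u \<le> s + 40 / real A"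
  proof -
    have ln: "ln (real y) / ln (real N) = 5 / real A"
      using j A by (simp add: y_def N_def ln_realpow)
    have "u \<le> (sqrt (real N) + 8 * real N * ln (real y) / ln (real N) + real N / real y) / real N"
      unfolding u_def by (intro divide_right_mono card_uncovered_le y1 N2) auto
    also have "\<dots> = sqrt (real N) / real N + 8 * (ln (real y) / ln (real N)) + 1 / real y"
      using N2 by (simp add: add_divide_distrib)
    also have "\<dots> = 1 / sqrt (real N) + 40 / real A + 1 / real y"
    proof -
      have "sqrt (real N) / real N = 1 / sqrt (real N)" using N2 by (simp add: divide_simps)
      thus ?thesis unfolding ln by simp
    qed
    also have "1 / sqrt (real N) \<le> 1 / sqrt (real j)" using j jN by (intro divide_left_mono) auto
    also have "1 / real y \<le> 1 / real j" using j jN by (intro divide_left_mono) auto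
    finally show ?thesis by (simp add: s_def)
  qed
  have u0: "u \<ge> 0" by (simp add: u_def)
  define q where "q \<theta> = (\<Sum>n\<in>covered N y. x n / sqrt (real N) * e_exp (real n * \<theta>))" for \<theta>
  have cq: "continuous_on UNIV q" unfolding q_def by (intro continuous_intros)
  have "trig_poly x N \<theta> - q \<theta> = (\<Sum>n\<in>{1..N} - covered N y. x n / sqrt (real N) * e_exp (real n * \<theta>))" for \<theta>
    unfolding trig_poly_eq q_def using covered_subset[of N y] by (simp add: sum_diff)
  hence "(\<integral>\<theta>. (norm (trig_poly x N \<theta> - q \<theta>))\<^sup>2 \<partial>unit_uniform) = u"
    by (simp only: parseval_nat finite_Diff finite_atLeastAtMost)
       (simp add: norm_divide xn power_divide u_def)
  hence 1: "norm (char_int t (trig_poly x N) - char_int t q) \<le> norm t * sqrt u"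
    using char_int_diff_le[OF continuous_trig_poly[OF continuous_on_id] cq, of t x N] by simp
  have 2: "char_int t q = covered_char t N y \<omega>"
    unfolding char_int_def covered_char_def sum_increment_eq q_def x_def ..
  have cov: "real (card (covered N y)) / real N = 1 - u"
  proof -
    have "finite (covered N y)" using covered_subset finite_subset by blast
    hence "card ({1..N} - covered N y) = N - card (covered N y)"
      using covered_subset[of N y] by (simp add: card_Diff_subset)
    moreover have "card (covered N y) \<le> N" using card_mono[OF _ covered_subset[of N y]] by simp
    ultimately show ?thesis using N2 by (simp add: u_def of_nat_diff diff_divide_distrib)
  qed
  have 3: "norm (complex_of_real (exp (- ((norm t)\<^sup>2 / 2 * (1 - u)) / 2)) - of_real (exp (- (norm t)\<^sup>2 / 4))) \<le> (norm t)\<^sup>2 * u"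
  proof -
    define a where "a = (norm t)\<^sup>2 / 4"
    have a0: "a \<ge> 0" by (simp add: a_def)
    have u1: "u \<le> 1" using cov by (smt (verit) divide_nonneg_nonneg of_nat_0_le_iff)
    have "exp (- a) = exp (- a * (1 - u)) * exp (- (a * u))" by (simp add: algebra_simps flip: exp_add)
    hence "exp (- a * (1 - u)) - exp (- a) = exp (- a * (1 - u)) * (1 - exp (- (a * u)))" by (simp add: algebra_simps)
    also have "\<dots> \<le> 1 * (a * u)"
      using exp_ge_add_one_self[of "- (a * u)"] a0 u0 u1
      by (intro mult_mono) (auto simp: mult_nonneg_nonneg mult_nonpos_nonneg)
    finally have up: "exp (- a * (1 - u)) - exp (- a) \<le> a * u" by simp
    have lo: "exp (- a * (1 - u)) - exp (- a) \<ge> 0" using a0 u0 by (simp add: algebra_simps)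
    have "a * u \<le> (norm t)\<^sup>2 * u" using u0 by (intro mult_right_mono) (auto simp: a_def)
    hence "\<bar>exp (- a * (1 - u)) - exp (- a)\<bar> \<le> (norm t)\<^sup>2 * u" using up lo by linarith
    moreover have "- ((norm t)\<^sup>2 / 2 * (1 - u)) / 2 = - a * (1 - u)" "- (norm t)\<^sup>2 / 4 = - a" by (simp_all add: a_def)
    ultimately show ?thesis unfolding of_real_diff[symmetric] norm_of_real by simp
  qed
  have Y: "Y = covered_char t N y \<omega> - of_real (exp (- ((norm t)\<^sup>2 / 2 * (1 - u)) / 2))"
    unfolding Y_def N_def[symmetric] y_def[symmetric] cov ..
  have "norm (char_int t (trig_poly x N) - of_real (exp (- (norm t)\<^sup>2 / 4)))
      \<le> norm t * sqrt u + (norm Y + (norm t)\<^sup>2 * u)"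
  proof -
    have "char_int t (trig_poly x N) - of_real (exp (- (norm t)\<^sup>2 / 4)) =
       (char_int t (trig_poly x N) - char_int t q) + (Y + (complex_of_real (exp (- ((norm t)\<^sup>2 / 2 * (1 - u)) / 2)) - of_real (exp (- (norm t)\<^sup>2 / 4))))"
      unfolding Y 2 by simp
    also have "norm \<dots> \<le> norm t * sqrt u + (norm Y + (norm t)\<^sup>2 * u)"
      by (intro norm_triangle_le add_mono 1 norm_triangle_ineq[THEN order.trans] 3 order.refl)
    finally show ?thesis .
  qed
  moreover have "norm t * sqrt u \<le> norm t * (sqrt s + sqrt (40 / real A))"
  proof (intro mult_left_mono)
    have "sqrt u \<le> sqrt (s + 40 / real A)" using u by simp
    also have "\<dots> \<le> sqrt s + sqrt (40 / real A)" using s0 by (intro sqrt_add_le_add_sqrt) auto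
    finally show "sqrt u \<le> sqrt s + sqrt (40 / real A)" .
  qed auto
  moreover have "(norm t)\<^sup>2 * u \<le> (norm t)\<^sup>2 * (s + 40 / real A)" using u by (intro mult_left_mono) auto
  ultimately show ?thesis unfolding N_def by (simp add: distrib_left)
qed

lemma char_int_trig_poly_tendsto:
  "AE \<omega> in M. (\<lambda>N. char_int t (trig_poly (\<lambda>n. X n \<omega>) N)) \<longlonglongrightarrow> of_real (exp (- (norm t)\<^sup>2 / 4))"
proof -
  define Y where "Y A \<omega> j = covered_char t (j ^ A) (j ^ 5) \<omega>
       - of_real (exp (- ((norm t)\<^sup>2 / 2 * (real (card (covered (j ^ A) (j ^ 5))) / real (j ^ A))) / 2))" for A \<omega> and j :: nat
  define s where "s j = 1 / sqrt (real j) + 1 / real j" for j :: nat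
  have s: "s \<longlonglongrightarrow> 0"
  proof -
    have "(\<lambda>j. sqrt (1 / real j) + 1 / real j) \<longlonglongrightarrow> sqrt 0 + 0"
      by (intro tendsto_add tendsto_real_sqrt lim_1_over_n)
    thus ?thesis by (simp add: s_def[abs_def] real_sqrt_divide)
  qed
  \<comment> \<open>One null set serves all exponents; \<open>Suc A\<close> ranges over the
    exponents that are at least 1.\<close>
  have "AE \<omega> in M. \<forall>A. Y (Suc A) \<omega> \<longlonglongrightarrow> 0"
    unfolding AE_all_countable Y_def by (intro allI covered_char_tendsto) simp
  thus ?thesis
  proof (rule AE_mp, intro AE_I2 impI)
    fix \<omega> assume w: "\<omega> \<in> space M" and Y: "\<forall>A. Y (Suc A) \<omega> \<longlonglongrightarrow> 0"
    have xn: "norm (X n \<omega>) = 1" for n using w by (rule norm_X)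
    show "(\<lambda>N. char_int t (trig_poly (\<lambda>n. X n \<omega>) N)) \<longlonglongrightarrow> of_real (exp (- (norm t)\<^sup>2 / 4))"
    proof (rule tendsto_if_tendsto_along_powers)
      fix A j :: nat assume "A \<ge> 1" "j \<ge> 2"
      thus "norm (char_int t (trig_poly (\<lambda>n. X n \<omega>) (j ^ A)) - of_real (exp (- (norm t)\<^sup>2 / 4)))
        \<le> (norm (Y A \<omega> j) + norm t * sqrt (s j) + (norm t)\<^sup>2 * s j) + (norm t * sqrt (40 / real A) + (norm t)\<^sup>2 * (40 / real A))"
        unfolding Y_def s_def by (rule char_int_trig_poly_power_bound[OF w])
    next
      fix A :: nat assume "A \<ge> 1"
      hence "Y A \<omega> \<longlonglongrightarrow> 0" using Y[rule_format, of "A - 1"] by simp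
      hence "(\<lambda>j. norm (Y A \<omega> j) + norm t * sqrt (s j) + (norm t)\<^sup>2 * s j) \<longlonglongrightarrow> 0 + norm t * sqrt 0 + (norm t)\<^sup>2 * 0"
        by (intro tendsto_intros tendsto_norm_zero s)
      thus "(\<lambda>j. norm (Y A \<omega> j) + norm t * sqrt (s j) + (norm t)\<^sup>2 * s j) \<longlonglongrightarrow> 0" by simp
    next
      have "(\<lambda>A. norm t * sqrt (40 / real A) + (norm t)\<^sup>2 * (40 / real A)) \<longlonglongrightarrow> norm t * sqrt 0 + (norm t)\<^sup>2 * 0"
        by (intro tendsto_intros lim_const_over_n)
      thus "(\<lambda>A. norm t * sqrt (40 / real A) + (norm t)\<^sup>2 * (40 / real A)) \<longlonglongrightarrow> 0" by simp
    next
      fix K N :: nat assume KN: "1 \<le> K" "K \<le> N"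
      have "norm (char_int t (trig_poly (\<lambda>n. X n \<omega>) N) - char_int t (trig_poly (\<lambda>n. X n \<omega>) K))
        \<le> norm t * sqrt (\<integral>\<theta>. (norm (trig_poly (\<lambda>n. X n \<omega>) N \<theta> - trig_poly (\<lambda>n. X n \<omega>) K \<theta>))\<^sup>2 \<partial>unit_uniform)"
        by (intro char_int_diff_le continuous_trig_poly continuous_on_id)
      also have "\<dots> \<le> norm t * sqrt (2 * (1 - real K / real N))"
        using trig_poly_gap[OF xn KN] by (intro mult_left_mono real_sqrt_le_mono) auto
      finally show "norm (char_int t (trig_poly (\<lambda>n. X n \<omega>) N) - char_int t (trig_poly (\<lambda>n. X n \<omega>) K))
        \<le> norm t * sqrt (2 * (1 - real K / real N))" .
    qed auto
  qed
qed

text \<open>Each t has its own null set. A countable dense set of t can share one, and outside it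
  the limit extends to all t because the characteristic functions are 1-Lipschitz in t for every N
  \<ge> 1.\<close>

theorem AE_char_int_trig_poly_tendsto:
  "AE \<omega> in M. \<forall>t. (\<lambda>N. char_int t (trig_poly (\<lambda>n. X n \<omega>) N)) \<longlonglongrightarrow> of_real (exp (- (norm t)\<^sup>2 / 4))"
proof -
  obtain D :: "complex set" where D: "countable D" "\<And>U. open U \<Longrightarrow> U \<noteq> {} \<Longrightarrow> \<exists>d\<in>D. d \<in> U"
    using countable_dense_exists by blast
  have "AE \<omega> in M. \<forall>t\<in>D. (\<lambda>N. char_int t (trig_poly (\<lambda>n. X n \<omega>) N)) \<longlonglongrightarrow> of_real (exp (- (norm t)\<^sup>2 / 4))"
    using D(1) char_int_trig_poly_tendsto by (subst AE_ball_countable) auto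
  thus ?thesis
  proof (rule AE_mp, intro AE_I2 impI allI)
    fix \<omega> t assume w: "\<omega> \<in> space M"
      and lim: "\<forall>t\<in>D. (\<lambda>N. char_int t (trig_poly (\<lambda>n. X n \<omega>) N)) \<longlonglongrightarrow> of_real (exp (- (norm t)\<^sup>2 / 4))"
    define c where "c u N = char_int u (trig_poly (\<lambda>n. X n \<omega>) N)" for u N
    define L where "L u = complex_of_real (exp (- (norm u)\<^sup>2 / 4))" for u :: complex
    have lip: "norm (c u N - c u' N) \<le> norm (u - u')" if "N \<ge> 1" for u u' N
      unfolding c_def
      using char_int_lipschitz[OF continuous_trig_poly[OF continuous_on_id], of u "\<lambda>n. X n \<omega>" N u']
        trig_poly_norm_square[OF norm_X[OF w] that] by simp
    have "c t \<longlonglongrightarrow> L t"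
    proof (rule LIMSEQ_I)
      fix r :: real assume r: "r > 0"
      have "isCont L t" unfolding L_def by (intro continuous_intros) auto
      then obtain \<delta> where \<delta>: "\<delta> > 0" "\<And>u. dist u t < \<delta> \<Longrightarrow> dist (L u) (L t) < r / 3"
        using r unfolding continuous_at_eps_delta by (metis divide_pos_pos zero_less_numeral)
      obtain d where d: "d \<in> D" "d \<in> ball t (min \<delta> (r / 3))"
      proof -
        have "min \<delta> (r / 3) > 0" using \<delta> r by simp
        hence "ball t (min \<delta> (r / 3)) \<noteq> {}" by (simp only: ball_eq_empty not_le)
        thus ?thesis using D(2)[OF open_ball] that by blast
      qed
      have d1: "norm (t - d) < r / 3" "norm (L d - L t) < r / 3"
        using d \<delta>(2)[of d] by (auto simp: dist_norm norm_minus_commute)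
      obtain N0 where N0: "\<And>N. N \<ge> N0 \<Longrightarrow> norm (c d N - L d) < r / 3"
        using LIMSEQ_D[OF lim[rule_format, OF d(1)], of "r / 3"] r unfolding c_def L_def by auto
      show "\<exists>N0. \<forall>N\<ge>N0. norm (c t N - L t) < r"
      proof (intro exI[of _ "max N0 1"] allI impI)
        fix N assume N: "max N0 1 \<le> N"
        have "norm (c t N - c d N) < r / 3" using lip[of N t d] d1 N by auto
        moreover have "norm (c d N - L d) < r / 3" using N0 N by auto
        ultimately show "norm (c t N - L t) < r"
          using norm_triangle_ineq[of "c t N - c d N" "c d N - L d"] norm_triangle_ineq[of "c t N - L d" "L d - L t"] d1
          by simp
      qed
    qed
    thus "(\<lambda>N. char_int t (trig_poly (\<lambda>n. X n \<omega>) N)) \<longlonglongrightarrow> of_real (exp (- (norm t)\<^sup>2 / 4))"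
      by (simp only: c_def[abs_def] L_def)
  qed
qed

end

section \<open>From characteristic functions to rectangles\<close>

text \<open>Apply the Levy continuity theorem to the law of \<open>U n\<close> under the measure with density \<open>g n\<close>.\<close>

lemma weighted_levy:
  fixes P :: "nat \<Rightarrow> 'b measure" and U g :: "nat \<Rightarrow> 'b \<Rightarrow> real"
  assumes P: "\<And>n. prob_space (P n)"
    and U [measurable]: "\<And>n. U n \<in> borel_measurable (P n)"
    and g [measurable]: "\<And>n. g n \<in> borel_measurable (P n)"
    and g_bounds: "\<And>n x. 0 \<le> g n x" "\<And>n x. g n x \<le> C"
    and lim: "\<And>a. (\<lambda>n. \<integral>x. of_real (g n x) * iexp (a * U n x) \<partial>P n) \<longlonglongrightarrow> of_real (m * exp (- a\<^sup>2 / 2))"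
    and I [measurable]: "I \<in> sets borel" and frontier: "emeasure std_normal_distribution (frontier I) = 0"
  shows "(\<lambda>n. \<integral>x. g n x * indicator I (U n x) \<partial>P n) \<longlonglongrightarrow> m * measure std_normal_distribution I"
proof -
  define mass where "mass n = (\<integral>x. g n x \<partial>P n)" for n
  have int: "integrable (P n) (g n)" for n
  proof -
    interpret prob_space "P n" by (rule P)
    show ?thesis by (rule integrable_const_bound[of _ C]) (use g_bounds in auto)
  qed
  have mass: "mass \<longlonglongrightarrow> m"
  proof -
    \<comment> \<open>The hypothesis at a = 0 says that the total masses converge to m.\<close>
    have "(\<lambda>n. complex_of_real (mass n)) \<longlonglongrightarrow> of_real m" using lim[of 0] by (simp add: mass_def)
    thus ?thesis by (simp only: tendsto_of_real_iff)
  qed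
  have mass0: "mass n \<ge> 0" for n unfolding mass_def using g_bounds by (intro integral_nonneg_AE) auto
  have m0: "m \<ge> 0" using mass mass0 by (intro LIMSEQ_le_const) auto
  have le: "(\<integral>x. g n x * indicator I (U n x) \<partial>P n) \<le> mass n" for n
    unfolding mass_def using g_bounds int by (intro integral_mono') (auto simp: indicator_def)
  have ge: "(\<integral>x. g n x * indicator I (U n x) \<partial>P n) \<ge> 0" for n
    using g_bounds by (intro integral_nonneg_AE) auto
  show ?thesis
  \<comment> \<open>A vanishing limit mass cannot be normalized, but the integrals are then squeezed
    between 0 and the masses.\<close>
  proof (cases "m = 0")
    case True
    have "(\<lambda>n. \<integral>x. g n x * indicator I (U n x) \<partial>P n) \<longlonglongrightarrow> 0"
      by (rule tendsto_sandwich[of "\<lambda>_. 0" _ _ mass]) (use le ge mass True in auto)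
    thus ?thesis using True by simp
  next
    case False
    hence "m > 0" using m0 by simp
    hence "eventually (\<lambda>n. mass n > 0) sequentially" using mass by (intro order_tendstoD)
    then obtain n0 where n0: "\<And>n. n \<ge> n0 \<Longrightarrow> mass n > 0" unfolding eventually_sequentially by blast
    \<comment> \<open>The shift by \<open>n0\<close> makes every mass positive, so each weight
      becomes a probability density.\<close>
    define h where "h n x = g (n + n0) x / mass (n + n0)" for n x
    define D where "D n = density (P (n + n0)) (\<lambda>x. ennreal (h n x))" for n
    have hm [measurable]: "h n \<in> borel_measurable (P (n + n0))" for n unfolding h_def by measurable
    have h0: "h n x \<ge> 0" for n x using g_bounds(1) n0[of "n + n0"] by (simp add: h_def)
    have pm: "mass (n + n0) > 0" for n using n0 by simp
    have D: "prob_space (D n)" for n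
    proof
      have "emeasure (D n) (space (D n)) = (\<integral>\<^sup>+x. ennreal (h n x) \<partial>P (n + n0))"
        by (simp add: D_def emeasure_density cong: nn_integral_cong)
      also have "\<dots> = ennreal (\<integral>x. h n x \<partial>P (n + n0))"
        using int[of "n + n0"] h0 by (intro nn_integral_eq_integral) (auto simp: h_def)
      also have "(\<integral>x. h n x \<partial>P (n + n0)) = 1" using pm[of n] by (simp add: h_def mass_def)
      finally show "emeasure (D n) (space (D n)) = 1" by simp
    qed
    have UD [measurable]: "U (n + n0) \<in> borel_measurable (D n)" for n by (simp add: D_def)
    define \<mu> where "\<mu> n = distr (D n) borel (U (n + n0))" for n
    have \<mu>: "real_distribution (\<mu> n)" for n
      unfolding \<mu>_def using prob_space.real_distribution_distr[OF D UD] .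
    have intD: "(\<integral>x. f x \<partial>D n) = (\<integral>x. h n x *\<^sub>R f x \<partial>P (n + n0))" if "f \<in> borel_measurable (P (n + n0))"
      for f :: "'b \<Rightarrow> 'c :: {banach, second_countable_topology}" and n
      unfolding D_def using that h0 by (intro integral_density) auto
    have "weak_conv_m \<mu> std_normal_distribution"
    proof (rule levy_continuity[OF \<mu> real_dist_normal_dist])
      fix a
      have eq: "char (\<mu> n) a = (\<integral>x. of_real (g (n + n0) x) * iexp (a * U (n + n0) x) \<partial>P (n + n0)) / of_real (mass (n + n0))" for n
      proof -
        have "char (\<mu> n) a = (\<integral>x. iexp (a * U (n + n0) x) \<partial>D n)"
          unfolding char_def \<mu>_def by (subst integral_distr) auto
        also have "\<dots> = (\<integral>x. h n x *\<^sub>R iexp (a * U (n + n0) x) \<partial>P (n + n0))" by (rule intD) measurable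
        also have "\<dots> = (\<integral>x. of_real (g (n + n0) x) * iexp (a * U (n + n0) x) / of_real (mass (n + n0)) \<partial>P (n + n0))"
          by (simp add: h_def scaleR_conv_of_real)
        also have "\<dots> = (\<integral>x. of_real (g (n + n0) x) * iexp (a * U (n + n0) x) \<partial>P (n + n0)) / of_real (mass (n + n0))"
          by (rule integral_divide_zero)
        finally show ?thesis .
      qed
      have "(\<lambda>n. (\<integral>x. of_real (g (n + n0) x) * iexp (a * U (n + n0) x) \<partial>P (n + n0)) / of_real (mass (n + n0)))
         \<longlonglongrightarrow> of_real (m * exp (- a\<^sup>2 / 2)) / complex_of_real m"
        using False
        by (intro tendsto_divide tendsto_of_real LIMSEQ_ignore_initial_segment[OF mass]
            LIMSEQ_ignore_initial_segment[OF lim]) auto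
      thus "(\<lambda>n. char (\<mu> n) a) \<longlonglongrightarrow> char std_normal_distribution a"
        using False by (simp add: eq char_std_normal_distribution)
    qed
    hence conv: "(\<lambda>n. measure (\<mu> n) I) \<longlonglongrightarrow> measure std_normal_distribution I"
      using frontier by (intro weak_conv_imp_continuity_set_conv \<mu> real_dist_normal_dist I)
    have eq: "measure (\<mu> n) I * mass (n + n0) = (\<integral>x. g (n + n0) x * indicator I (U (n + n0) x) \<partial>P (n + n0))" for n
    proof -
      interpret real_distribution "\<mu> n" by (rule \<mu>)
      have "measure (\<mu> n) I = (\<integral>x. indicator I x \<partial>\<mu> n)" by simp
      also have "\<dots> = (\<integral>x. indicator I (U (n + n0) x) \<partial>D n)"
        unfolding \<mu>_def by (subst integral_distr) auto
      also have "\<dots> = (\<integral>x. h n x *\<^sub>R indicator I (U (n + n0) x) \<partial>P (n + n0))" by (rule intD) measurable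
      also have "\<dots> = (\<integral>x. g (n + n0) x * indicator I (U (n + n0) x) / mass (n + n0) \<partial>P (n + n0))"
        by (simp add: h_def)
      also have "\<dots> = (\<integral>x. g (n + n0) x * indicator I (U (n + n0) x) \<partial>P (n + n0)) / mass (n + n0)"
        by (rule integral_divide_zero)
      finally show ?thesis using pm[of n] by simp
    qed
    have "(\<lambda>n. measure (\<mu> n) I * mass (n + n0)) \<longlonglongrightarrow> measure std_normal_distribution I * m"
      by (intro tendsto_mult conv LIMSEQ_ignore_initial_segment[OF mass])
    hence "(\<lambda>n. \<integral>x. g (n + n0) x * indicator I (U (n + n0) x) \<partial>P (n + n0)) \<longlonglongrightarrow> measure std_normal_distribution I * m"
      unfolding eq .
    hence "(\<lambda>n. \<integral>x. g n x * indicator I (U n x) \<partial>P n) \<longlonglongrightarrow> measure std_normal_distribution I * m"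
      by (rule LIMSEQ_offset)
    thus ?thesis by (simp add: mult.commute)
  qed
qed

text \<open>The joint law is reached in two one-dimensional steps: the weights \<open>1 + cos (b V)\<close> and
  \<open>1 + sin (b V)\<close> are nonnegative and turn the joint characteristic function into that of \<open>U\<close>,
  and then the weight \<open>indicator I U\<close> turns the result into a statement about \<open>V\<close>.\<close>

lemma joint_levy:
  fixes P :: "nat \<Rightarrow> 'b measure" and U V :: "nat \<Rightarrow> 'b \<Rightarrow> real"
  assumes P: "\<And>n. prob_space (P n)"
    and U [measurable]: "\<And>n. U n \<in> borel_measurable (P n)"
    and V [measurable]: "\<And>n. V n \<in> borel_measurable (P n)"
    and lim: "\<And>a b. (\<lambda>n. \<integral>x. iexp (a * U n x + b * V n x) \<partial>P n) \<longlonglongrightarrow> of_real (exp (- (a\<^sup>2 + b\<^sup>2) / 2))"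
    and I [measurable]: "I \<in> sets borel" and frontier_I: "emeasure std_normal_distribution (frontier I) = 0"
    and J [measurable]: "J \<in> sets borel" and frontier_J: "emeasure std_normal_distribution (frontier J) = 0"
  shows "(\<lambda>n. measure (P n) {x \<in> space (P n). U n x \<in> I \<and> V n x \<in> J})
     \<longlonglongrightarrow> measure std_normal_distribution I * measure std_normal_distribution J"
proof -
  have intb: "integrable (P n) f" if [measurable]: "f \<in> borel_measurable (P n)" and "\<And>x. norm (f x) \<le> 1"
    for f :: "'b \<Rightarrow> complex" and n
  proof -
    interpret prob_space "P n" by (rule P)
    show ?thesis by (rule integrable_const_bound[of _ 1]) (use that in auto)
  qed
  have intr: "integrable (P n) f" if [measurable]: "f \<in> borel_measurable (P n)" and "\<And>x. \<bar>f x\<bar> \<le> 1"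
    for f :: "'b \<Rightarrow> real" and n
  proof -
    interpret prob_space "P n" by (rule P)
    show ?thesis by (rule integrable_const_bound[of _ 1]) (use that in auto)
  qed
  let ?N = "measure std_normal_distribution I"
  define c where "c a b n = (\<integral>x. iexp (a * U n x + b * V n x) \<partial>P n)" for a b n
  have c: "c a b \<longlonglongrightarrow> of_real (exp (- (a\<^sup>2 + b\<^sup>2) / 2))" for a b unfolding c_def by (rule lim)
  have iadd: "iexp (x + y) = iexp x * iexp y" for x y by (simp add: distrib_left exp_add)
  \<comment> \<open>The weighted exponential is a combination of plain exponentials at (a, 0), (a,
    b) and (a, - b), whose limits are the hypothesis.\<close>
  have gen_cos: "complex_of_real (1 + cos v) * iexp u = iexp u + iexp (u + v) / 2 + iexp (u + - v) / 2" for u v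
  proof -
    have "complex_of_real (1 + cos v) = 1 + (iexp v + iexp (- v)) / 2"
      by (simp add: cos_of_real[symmetric] cos_exp_eq)
    moreover have "(1 + (B + B') / 2) * A = A + A * B / 2 + A * B' / 2" for A B B' :: complex
      by (simp add: field_simps)
    ultimately show ?thesis unfolding iadd by metis
  qed
  have gen_sin: "complex_of_real (1 + sin v) * iexp u = iexp u + iexp (u + v) / (2 * \<i>) - iexp (u + - v) / (2 * \<i>)" for u v
  proof -
    have "complex_of_real (1 + sin v) = 1 + (iexp v - iexp (- v)) / (2 * \<i>)"
      by (simp add: sin_of_real[symmetric] sin_exp_eq)
    moreover have "(1 + (B - B') / (2 * \<i>)) * A = A + A * B / (2 * \<i>) - A * B' / (2 * \<i>)" for A B B' :: complex
      by (simp add: field_simps)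
    ultimately show ?thesis unfolding iadd by metis
  qed
  have e: "exp (- (a\<^sup>2 + b\<^sup>2) / 2) = exp (- a\<^sup>2 / 2) * exp (- b\<^sup>2 / 2)" for a b :: real
    by (simp add: add_divide_distrib diff_divide_distrib flip: exp_add)
  have ic: "integrable (P n) (\<lambda>x. iexp (a * U n x + b * V n x))" for a b n by (intro intb) (auto simp: norm_exp)
  have one: "(\<lambda>n. \<integral>x. 1 * indicator I (U n x) \<partial>P n) \<longlonglongrightarrow> 1 * ?N"
    by (rule weighted_levy[where C = 1]) (use P frontier_I lim[of _ 0] in auto)
  have cos: "(\<lambda>n. \<integral>x. (1 + cos (b * V n x)) * indicator I (U n x) \<partial>P n) \<longlonglongrightarrow> (1 + exp (- b\<^sup>2 / 2)) * ?N" for b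
  proof (rule weighted_levy[where C = 2])
    show "0 \<le> 1 + cos (b * V n x)" "1 + cos (b * V n x) \<le> 2" for n x
      using cos_ge_minus_one[of "b * V n x"] cos_le_one[of "b * V n x"] by linarith+
    fix a
    have "(\<integral>x. of_real (1 + cos (b * V n x)) * iexp (a * U n x) \<partial>P n) = c a 0 n + c a b n / 2 + c a (- b) n / 2" for n
    proof -
      have "complex_of_real (1 + cos (b * V n x)) * iexp (a * U n x)
          = iexp (a * U n x + 0 * V n x) + iexp (a * U n x + b * V n x) / 2 + iexp (a * U n x + (- b) * V n x) / 2" for x
        using gen_cos[of "b * V n x" "a * U n x"] by simp
      thus ?thesis using ic[of n a 0] ic[of n a b] ic[of n a "- b"] by (simp only: c_def) simp
    qed
    moreover have "(\<lambda>n. c a 0 n + c a b n / 2 + c a (- b) n / 2) \<longlonglongrightarrow>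
       of_real (exp (- (a\<^sup>2 + 0\<^sup>2) / 2)) + of_real (exp (- (a\<^sup>2 + b\<^sup>2) / 2)) / 2 + of_real (exp (- (a\<^sup>2 + (- b)\<^sup>2) / 2)) / 2"
      by (intro tendsto_intros c) auto
    moreover have "complex_of_real (exp (- (a\<^sup>2 + 0\<^sup>2) / 2)) + of_real (exp (- (a\<^sup>2 + b\<^sup>2) / 2)) / 2 + of_real (exp (- (a\<^sup>2 + (- b)\<^sup>2) / 2)) / 2
       = of_real ((1 + exp (- b\<^sup>2 / 2)) * exp (- a\<^sup>2 / 2))"
      unfolding e by (simp add: algebra_simps)
    ultimately show "(\<lambda>n. \<integral>x. of_real (1 + cos (b * V n x)) * iexp (a * U n x) \<partial>P n) \<longlonglongrightarrow> of_real ((1 + exp (- b\<^sup>2 / 2)) * exp (- a\<^sup>2 / 2))"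
      by simp
  qed (use P frontier_I in auto)
  \<comment> \<open>The limits at (a, b) and (a, - b) coincide, so the sine contributes nothing and
    the limit is that of the weight 1.\<close>
  have sin: "(\<lambda>n. \<integral>x. (1 + sin (b * V n x)) * indicator I (U n x) \<partial>P n) \<longlonglongrightarrow> 1 * ?N" for b
  proof (rule weighted_levy[where C = 2])
    show "0 \<le> 1 + sin (b * V n x)" "1 + sin (b * V n x) \<le> 2" for n x
      using sin_ge_minus_one[of "b * V n x"] sin_le_one[of "b * V n x"] by linarith+
    fix a
    have "(\<integral>x. of_real (1 + sin (b * V n x)) * iexp (a * U n x) \<partial>P n) = c a 0 n + c a b n / (2 * \<i>) - c a (- b) n / (2 * \<i>)" for n
    proof -
      have "complex_of_real (1 + sin (b * V n x)) * iexp (a * U n x)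
          = iexp (a * U n x + 0 * V n x) + iexp (a * U n x + b * V n x) / (2 * \<i>) - iexp (a * U n x + (- b) * V n x) / (2 * \<i>)" for x
        using gen_sin[of "b * V n x" "a * U n x"] by simp
      thus ?thesis using ic[of n a 0] ic[of n a b] ic[of n a "- b"] by (simp only: c_def) simp
    qed
    moreover have "(\<lambda>n. c a 0 n + c a b n / (2 * \<i>) - c a (- b) n / (2 * \<i>)) \<longlonglongrightarrow>
       of_real (exp (- (a\<^sup>2 + 0\<^sup>2) / 2)) + of_real (exp (- (a\<^sup>2 + b\<^sup>2) / 2)) / (2 * \<i>) - of_real (exp (- (a\<^sup>2 + (- b)\<^sup>2) / 2)) / (2 * \<i>)"
      by (intro tendsto_intros c) auto
    ultimately show "(\<lambda>n. \<integral>x. of_real (1 + sin (b * V n x)) * iexp (a * U n x) \<partial>P n) \<longlonglongrightarrow> of_real (1 * exp (- a\<^sup>2 / 2))"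
      by simp
  qed (use P frontier_I in auto)
  have iI: "integrable (P n) (\<lambda>x. indicator I (U n x) :: real)" for n by (intro intr) auto
  have iC: "integrable (P n) (\<lambda>x. cos (b * V n x) * indicator I (U n x))" "integrable (P n) (\<lambda>x. sin (b * V n x) * indicator I (U n x))" for b n
    by (intro intr; auto simp: indicator_def)+
  \<comment> \<open>Subtracting the case of weight 1 removes the shift that kept the weights
    nonnegative. What remains are the real and imaginary parts of the characteristic function of V
    restricted to the event U in I.\<close>
  have cos': "(\<lambda>n. \<integral>x. cos (b * V n x) * indicator I (U n x) \<partial>P n) \<longlonglongrightarrow> exp (- b\<^sup>2 / 2) * ?N" for b
    using tendsto_diff[OF cos[of b] one] iI iC by (simp add: distrib_right)
  have sin': "(\<lambda>n. \<integral>x. sin (b * V n x) * indicator I (U n x) \<partial>P n) \<longlonglongrightarrow> 0" for b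
    using tendsto_diff[OF sin[of b] one] iI iC by (simp add: distrib_right)
  have "(\<lambda>n. \<integral>x. indicator I (U n x) * indicator J (V n x) \<partial>P n) \<longlonglongrightarrow> ?N * measure std_normal_distribution J"
  proof (rule weighted_levy[where C = 1])
    fix b
    have "(\<integral>x. of_real (indicator I (U n x)) * iexp (b * V n x) \<partial>P n)
       = of_real (\<integral>x. cos (b * V n x) * indicator I (U n x) \<partial>P n) + \<i> * of_real (\<integral>x. sin (b * V n x) * indicator I (U n x) \<partial>P n)" for n
    proof -
      have "of_real (indicator I (U n x)) * iexp (b * V n x) = complex_of_real (cos (b * V n x) * indicator I (U n x))
          + \<i> * complex_of_real (sin (b * V n x) * indicator I (U n x))" for x
        by (simp add: complex_eq_iff Re_exp Im_exp)
      moreover have "(\<integral>x. complex_of_real (cos (b * V n x) * indicator I (U n x))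
          + \<i> * complex_of_real (sin (b * V n x) * indicator I (U n x)) \<partial>P n)
         = (\<integral>x. complex_of_real (cos (b * V n x) * indicator I (U n x)) \<partial>P n)
          + (\<integral>x. \<i> * complex_of_real (sin (b * V n x) * indicator I (U n x)) \<partial>P n)"
        by (intro Bochner_Integration.integral_add integrable_mult_right integrable_of_real iC)
      ultimately show ?thesis by (simp only: integral_complex_of_real integral_mult_right_zero)
    qed
    moreover have "(\<lambda>n. complex_of_real (\<integral>x. cos (b * V n x) * indicator I (U n x) \<partial>P n) + \<i> * of_real (\<integral>x. sin (b * V n x) * indicator I (U n x) \<partial>P n))
      \<longlonglongrightarrow> of_real (exp (- b\<^sup>2 / 2) * ?N) + \<i> * of_real 0"
      by (intro tendsto_intros cos' sin')
    ultimately show "(\<lambda>n. \<integral>x. of_real (indicator I (U n x)) * iexp (b * V n x) \<partial>P n) \<longlonglongrightarrow> of_real (?N * exp (- b\<^sup>2 / 2))"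
      by (simp add: mult.commute)
  qed (use P frontier_J in \<open>auto simp: indicator_def\<close>)
  moreover have "(\<integral>x. (indicator I (U n x) :: real) * indicator J (V n x) \<partial>P n) = measure (P n) {x \<in> space (P n). U n x \<in> I \<and> V n x \<in> J}" for n
  proof -
    have "(\<integral>x. (indicator I (U n x) :: real) * indicator J (V n x) \<partial>P n) = (\<integral>x. indicator {x \<in> space (P n). U n x \<in> I \<and> V n x \<in> J} x \<partial>P n)"
      by (intro Bochner_Integration.integral_cong) (auto simp: indicator_def)
    also have "\<dots> = measure (P n) {x \<in> space (P n). U n x \<in> I \<and> V n x \<in> J}" by simp
    finally show ?thesis .
  qed
  ultimately show ?thesis by simp
qed

section \<open>The complex Gaussian law as a product of two real normal laws\<close>

lemma measurable_Complex [measurable]: "(\<lambda>(x, y). Complex x y) \<in> borel_measurable (borel \<Otimes>\<^sub>M borel)"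
  unfolding borel_prod
  by (intro borel_measurable_continuous_onI) (auto simp: Complex_eq case_prod_beta intro!: continuous_intros)

lemma lborel_complex: "distr (lborel \<Otimes>\<^sub>M lborel) borel (\<lambda>(x, y). Complex x y) = (lborel :: complex measure)"
proof (rule lborel_eqI[symmetric])
  fix l u :: complex assume le: "\<And>b. b \<in> Basis \<Longrightarrow> l \<bullet> b \<le> u \<bullet> b"
  hence lu: "Re l \<le> Re u" "Im l \<le> Im u" using le[of 1] le[of \<i>] by (auto simp: Basis_complex_def)
  have "emeasure (distr (lborel \<Otimes>\<^sub>M lborel) borel (\<lambda>(x, y). Complex x y)) (box l u)
      = emeasure (lborel \<Otimes>\<^sub>M lborel) ((\<lambda>(x, y). Complex x y) -` box l u \<inter> space (lborel \<Otimes>\<^sub>M lborel))"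
    by (rule emeasure_distr) auto
  also have "(\<lambda>(x, y). Complex x y) -` box l u \<inter> space (lborel \<Otimes>\<^sub>M lborel) = {Re l<..<Re u} \<times> {Im l<..<Im u}"
    by (auto simp: box_def Basis_complex_def space_pair_measure)
  also have "emeasure (lborel \<Otimes>\<^sub>M lborel) \<dots> = ennreal (Re u - Re l) * ennreal (Im u - Im l)"
    using lu by (subst lborel.emeasure_pair_measure_Times) auto
  also have "\<dots> = ennreal (\<Prod>b\<in>Basis. (u - l) \<bullet> b)"
    using lu by (simp add: Basis_complex_def ennreal_mult)
  finally show "emeasure (distr (lborel \<Otimes>\<^sub>M lborel) borel (\<lambda>(x, y). Complex x y)) (box l u) = (\<Prod>b\<in>Basis. (u - l) \<bullet> b)" .
qed auto

definition gaussian :: "complex measure" where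
  "gaussian = density lborel (\<lambda>z. ennreal (exp (- (Re z)\<^sup>2 - (Im z)\<^sup>2) / pi))"

text \<open>The centred normal law of variance 1/2, the law of each coordinate under
  \<open>gaussian\<close>. It is not the law of the absolute value of a normal variable, which often
  bears this name.\<close>

definition half_normal :: "real measure" where
  "half_normal = density lborel (\<lambda>x. ennreal (normal_density 0 (1 / sqrt 2) x))"

lemma half_normal_density: "normal_density 0 (1 / sqrt 2) x = exp (- x\<^sup>2) / sqrt pi"
  by (simp add: normal_density_def power_divide)

lemma half_normal_eq: "half_normal = distr std_normal_distribution borel (\<lambda>x. x / sqrt 2)"
proof -
  interpret N: real_distribution std_normal_distribution by (rule real_dist_normal_dist)
  have "distributed std_normal_distribution lborel (\<lambda>x. x) (\<lambda>x. ennreal (std_normal_density x))"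
    by (auto simp: distributed_def distr_id2 intro!: measure_eqI cong: distr_cong)
  from N.normal_density_affine[OF this, of "1 / sqrt 2" 0]
  have "distributed std_normal_distribution lborel (\<lambda>x. x / sqrt 2) (\<lambda>x. ennreal (normal_density 0 (1 / sqrt 2) x))"
    by simp
  hence "distr std_normal_distribution lborel (\<lambda>x. x / sqrt 2) = half_normal"
    by (simp add: distributed_def half_normal_def)
  moreover have "distr std_normal_distribution lborel (\<lambda>x. x / sqrt 2) = distr std_normal_distribution borel (\<lambda>x. x / sqrt 2)"
    by (rule distr_cong) auto
  ultimately show ?thesis by simp
qed

lemma real_distribution_half_normal: "real_distribution half_normal"
  unfolding half_normal_eq
  by (intro prob_space.real_distribution_distr real_distribution.axioms(1) real_dist_normal_dist) simp

lemma char_half_normal: "char half_normal a = of_real (exp (- a\<^sup>2 / 4))"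
proof -
  have "char half_normal a = (\<integral>x. iexp (a * (x / sqrt 2)) \<partial>std_normal_distribution)"
    unfolding char_def half_normal_eq by (subst integral_distr) auto
  also have "\<dots> = char std_normal_distribution (a / sqrt 2)" by (simp add: char_def)
  also have "\<dots> = of_real (exp (- a\<^sup>2 / 4))"
    unfolding char_std_normal_distribution by (simp add: power_divide)
  finally show ?thesis .
qed

lemma gaussian_eq: "gaussian = distr (half_normal \<Otimes>\<^sub>M half_normal) borel (\<lambda>(x, y). Complex x y)"
proof -
  interpret H: real_distribution half_normal by (rule real_distribution_half_normal)
  have m: "(\<lambda>(x, y). Complex x y) \<in> measurable (lborel \<Otimes>\<^sub>M lborel) borel" by simp
  have "gaussian = density (distr (lborel \<Otimes>\<^sub>M lborel) borel (\<lambda>(x, y). Complex x y)) (\<lambda>z. ennreal (exp (- (Re z)\<^sup>2 - (Im z)\<^sup>2) / pi))"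
    unfolding gaussian_def lborel_complex ..
  also have "\<dots> = distr (density (lborel \<Otimes>\<^sub>M lborel) (\<lambda>z. ennreal (exp (- (Re (case z of (x, y) \<Rightarrow> Complex x y))\<^sup>2 - (Im (case z of (x, y) \<Rightarrow> Complex x y))\<^sup>2) / pi)))
     borel (\<lambda>(x, y). Complex x y)"
    by (rule density_distr[OF _ m]) simp
  also have "density (lborel \<Otimes>\<^sub>M lborel) (\<lambda>z. ennreal (exp (- (Re (case z of (x, y) \<Rightarrow> Complex x y))\<^sup>2 - (Im (case z of (x, y) \<Rightarrow> Complex x y))\<^sup>2) / pi))
      = density (lborel \<Otimes>\<^sub>M lborel) (\<lambda>(x, y). ennreal (normal_density 0 (1 / sqrt 2) x) * ennreal (normal_density 0 (1 / sqrt 2) y))"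
  proof (intro arg_cong[of _ _ "density (lborel \<Otimes>\<^sub>M lborel)"] ext)
    fix z :: "real \<times> real"
    obtain x y where z: "z = (x, y)" by (cases z)
    have "exp (- x\<^sup>2 - y\<^sup>2) / pi = (exp (- x\<^sup>2) / sqrt pi) * (exp (- y\<^sup>2) / sqrt pi)"
      by (simp add: exp_diff exp_minus field_simps flip: exp_add)
    thus "ennreal (exp (- (Re (case z of (x, y) \<Rightarrow> Complex x y))\<^sup>2 - (Im (case z of (x, y) \<Rightarrow> Complex x y))\<^sup>2) / pi)
       = (case z of (x, y) \<Rightarrow> ennreal (normal_density 0 (1 / sqrt 2) x) * ennreal (normal_density 0 (1 / sqrt 2) y))"
      by (simp only: z prod.case complex.sel half_normal_density) (simp flip: ennreal_mult)
  qed
  also have "\<dots> = half_normal \<Otimes>\<^sub>M half_normal"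
    unfolding half_normal_def
    by (rule pair_measure_density[symmetric])
       (use H.sigma_finite_measure_axioms in \<open>auto simp: half_normal_def intro: lborel.sigma_finite_measure_axioms\<close>)
  finally show ?thesis .
qed

lemma prob_space_gaussian: "prob_space gaussian"
proof -
  interpret H: real_distribution half_normal by (rule real_distribution_half_normal)
  interpret HH: pair_prob_space half_normal half_normal ..
  show ?thesis unfolding gaussian_eq by (intro HH.P.prob_space_distr) simp
qed

lemma char_gaussian: "(\<integral>z. iexp (Re (cnj t * z)) \<partial>gaussian) = of_real (exp (- (norm t)\<^sup>2 / 4))"
proof -
  interpret H: real_distribution half_normal by (rule real_distribution_half_normal)
  interpret HH: pair_prob_space half_normal half_normal ..
  have "(\<integral>z. iexp (Re (cnj t * z)) \<partial>gaussian) = (\<integral>w. iexp (Re (cnj t * (case w of (x, y) \<Rightarrow> Complex x y))) \<partial>(half_normal \<Otimes>\<^sub>M half_normal))"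
    unfolding gaussian_eq by (rule integral_distr) simp_all
  also have "\<dots> = (\<integral>w. iexp (Re t * fst w) * iexp (Im t * snd w) \<partial>(half_normal \<Otimes>\<^sub>M half_normal))"
    by (simp add: case_prod_beta distrib_left exp_add)
  also have "\<dots> = (\<integral>x. \<integral>y. iexp (Re t * x) * iexp (Im t * y) \<partial>half_normal \<partial>half_normal)"
  proof -
    have "integrable (half_normal \<Otimes>\<^sub>M half_normal) (\<lambda>w. iexp (Re t * fst w) * iexp (Im t * snd w))"
      by (rule HH.P.integrable_const_bound[of _ 1]) (auto simp: norm_mult)
    from HH.integral_fst'[OF this] show ?thesis by simp
  qed
  also have "\<dots> = char half_normal (Re t) * char half_normal (Im t)"
    unfolding char_def by (simp only: integral_mult_right_zero integral_mult_left_zero)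
  also have "\<dots> = of_real (exp (- (norm t)\<^sup>2 / 4))"
    unfolding char_half_normal cmod_power2
    by (simp add: add_divide_distrib diff_divide_distrib flip: of_real_mult exp_add)
  finally show ?thesis .
qed

text \<open>An interval is convex and the frontier of a convex set is Lebesgue null. Open, closed
  and half-open edges are thereby covered at once.\<close>

lemma std_normal_frontier_interval:
  assumes "is_interval I"
  shows "emeasure std_normal_distribution (frontier I) = 0"
proof -
  have "negligible (frontier I)" using assms by (intro negligible_convex_frontier is_interval_convex)
  hence "frontier I \<in> null_sets lebesgue" by (simp only: negligible_iff_null_sets)
  hence "frontier I \<in> null_sets lborel" by (simp add: null_sets_completion_iff borel_closed)
  hence "AE x in lborel. x \<notin> frontier I" by (rule AE_not_in)
  hence "AE x in std_normal_distribution. x \<notin> frontier I" by (subst AE_density) (auto elim: AE_mp)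
  thus ?thesis by (subst (asm) AE_iff_measurable[where N = "frontier I"]) (auto simp: borel_closed)
qed

lemma rotated_rectangle_iff:
  assumes c: "norm c = 1"
  shows "z \<in> {c * Complex x y |x y. x \<in> I \<and> y \<in> J} \<longleftrightarrow> Re (cnj c * z) \<in> I \<and> Im (cnj c * z) \<in> J"
proof
  have cc: "c * cnj c = 1" using c by (simp add: complex_norm_square[symmetric])
  show "Re (cnj c * z) \<in> I \<and> Im (cnj c * z) \<in> J" if "z \<in> {c * Complex x y |x y. x \<in> I \<and> y \<in> J}"
  proof -
    from that obtain x y where z: "z = c * Complex x y" "x \<in> I" "y \<in> J" by auto
    have "cnj c * z = (c * cnj c) * Complex x y" by (simp only: z mult_ac)
    also have "\<dots> = Complex x y" using cc by simp
    finally show ?thesis using z by (simp only: complex.sel)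
  qed
  show "z \<in> {c * Complex x y |x y. x \<in> I \<and> y \<in> J}" if "Re (cnj c * z) \<in> I \<and> Im (cnj c * z) \<in> J"
  proof -
    have "z = (c * cnj c) * z" using cc by simp
    also have "\<dots> = c * Complex (Re (cnj c * z)) (Im (cnj c * z))" by (simp only: complex_surj mult.assoc)
    finally show ?thesis using that by blast
  qed
qed

text \<open>The limiting characteristic function depends on the norm of t only, so it is unchanged
  by the rotation that makes the rectangle axis-parallel. Scaling by sqrt 2 turns the coordinate
  variance 1/2 into 1, after which \<open>joint_levy\<close> applies.\<close>

lemma rectangle_limit_std_normal:
  fixes P :: "nat \<Rightarrow> 'b measure" and Z :: "nat \<Rightarrow> 'b \<Rightarrow> complex"
  assumes P: "\<And>n. prob_space (P n)" and Z [measurable]: "\<And>n. Z n \<in> borel_measurable (P n)"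
    and lim: "\<And>t. (\<lambda>n. \<integral>x. iexp (Re (cnj t * Z n x)) \<partial>P n) \<longlonglongrightarrow> of_real (exp (- (norm t)\<^sup>2 / 4))"
    and c: "norm c = 1" and I: "is_interval I" and J: "is_interval J"
  shows "(\<lambda>n. measure (P n) {x \<in> space (P n). Z n x \<in> {c * Complex x y |x y. x \<in> I \<and> y \<in> J}})
     \<longlonglongrightarrow> measure std_normal_distribution ((*) (sqrt 2) ` I) * measure std_normal_distribution ((*) (sqrt 2) ` J)"
proof -
  define U where "U n x = sqrt 2 * Re (cnj c * Z n x)" for n x
  define V where "V n x = sqrt 2 * Im (cnj c * Z n x)" for n x
  have int: "is_interval ((*) (sqrt 2) ` K)" if "is_interval K" for K :: "real set"
    using that by (simp add: is_interval_convex_1 convex_scaling[of _ "sqrt 2", simplified])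
  have mem: "z \<in> {c * Complex x y |x y. x \<in> I \<and> y \<in> J} \<longleftrightarrow>
      sqrt 2 * Re (cnj c * z) \<in> (*) (sqrt 2) ` I \<and> sqrt 2 * Im (cnj c * z) \<in> (*) (sqrt 2) ` J" for z
  proof -
    have "z \<in> {c * Complex x y |x y. x \<in> I \<and> y \<in> J} \<longleftrightarrow> Re (cnj c * z) \<in> I \<and> Im (cnj c * z) \<in> J"
      by (rule rotated_rectangle_iff[OF c])
    thus ?thesis by (auto simp: image_iff)
  qed
  have "(\<lambda>n. measure (P n) {x \<in> space (P n). U n x \<in> (*) (sqrt 2) ` I \<and> V n x \<in> (*) (sqrt 2) ` J})
     \<longlonglongrightarrow> measure std_normal_distribution ((*) (sqrt 2) ` I) * measure std_normal_distribution ((*) (sqrt 2) ` J)"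
  proof (rule joint_levy[OF P])
    show "U n \<in> borel_measurable (P n)" "V n \<in> borel_measurable (P n)" for n unfolding U_def V_def by measurable
    fix a b
    have "a * U n x + b * V n x = Re (cnj (sqrt 2 * c * Complex a b) * Z n x)" for n x
      by (simp add: U_def V_def algebra_simps)
    moreover have "(norm (sqrt 2 * c * Complex a b))\<^sup>2 / 4 = (a\<^sup>2 + b\<^sup>2) / 2"
      using c by (simp add: norm_mult power_mult_distrib cmod_power2)
    ultimately show "(\<lambda>n. \<integral>x. iexp (a * U n x + b * V n x) \<partial>P n) \<longlonglongrightarrow> of_real (exp (- (a\<^sup>2 + b\<^sup>2) / 2))"
      using lim[of "sqrt 2 * c * Complex a b"] by (simp only: minus_divide_left[symmetric])
  qed (use int[OF I] int[OF J] in \<open>auto intro: real_interval_borel_measurable std_normal_frontier_interval\<close>)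
  thus ?thesis unfolding mem U_def V_def .
qed

lemma rectangle_measurable:
  assumes "rectangle E"
  shows "E \<in> sets borel"
proof -
  obtain c I J where E: "norm c = 1" "is_interval I" "is_interval J" "E = {c * Complex x y |x y. x \<in> I \<and> y \<in> J}"
    using assms unfolding rectangle_def by blast
  have [measurable]: "I \<in> sets borel" "J \<in> sets borel" using E real_interval_borel_measurable by auto
  have "E = {z. Re (cnj c * z) \<in> I \<and> Im (cnj c * z) \<in> J}"
    unfolding E(4) using rotated_rectangle_iff[OF E(1)] by blast
  also have "\<dots> \<in> sets borel" by measurable
  finally show ?thesis .
qed

lemma measure_gaussian:
  assumes "E \<in> sets borel"
  shows "measure gaussian E = 1 / pi * (LINT z:E|lebesgue. exp (- (Re z)\<^sup>2 - (Im z)\<^sup>2))"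
proof -
  interpret prob_space gaussian by (rule prob_space_gaussian)
  have [measurable]: "E \<in> sets borel" by (rule assms)
  have "measure gaussian E = (\<integral>z. indicator E z \<partial>gaussian)" by (simp add: gaussian_def)
  also have "\<dots> = (\<integral>z. (exp (- (Re z)\<^sup>2 - (Im z)\<^sup>2) / pi) *\<^sub>R indicator E z \<partial>lborel)"
    unfolding gaussian_def by (rule integral_density) auto
  also have "\<dots> = (\<integral>z. 1 / pi * (indicator E z *\<^sub>R exp (- (Re z)\<^sup>2 - (Im z)\<^sup>2)) \<partial>lborel)"
    by (intro Bochner_Integration.integral_cong) auto
  also have "\<dots> = 1 / pi * (\<integral>z. indicator E z *\<^sub>R exp (- (Re z)\<^sup>2 - (Im z)\<^sup>2) \<partial>lborel)"
    by (rule integral_mult_right_zero)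
  also have "(\<integral>z. indicator E z *\<^sub>R exp (- (Re z)\<^sup>2 - (Im z)\<^sup>2) \<partial>lborel) = (LINT z:E|lebesgue. exp (- (Re z)\<^sup>2 - (Im z)\<^sup>2))"
    unfolding set_lebesgue_integral_def by (rule integral_completion[symmetric]) simp
  finally show ?thesis .
qed

theorem rectangle_limit_gaussian:
  fixes P :: "nat \<Rightarrow> 'b measure" and Z :: "nat \<Rightarrow> 'b \<Rightarrow> complex"
  assumes "\<And>n. prob_space (P n)" "\<And>n. Z n \<in> borel_measurable (P n)"
    and "\<And>t. (\<lambda>n. \<integral>x. iexp (Re (cnj t * Z n x)) \<partial>P n) \<longlonglongrightarrow> of_real (exp (- (norm t)\<^sup>2 / 4))"
    and E: "rectangle E"
  shows "(\<lambda>n. measure (P n) {x \<in> space (P n). Z n x \<in> E})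
     \<longlonglongrightarrow> 1 / pi * (LINT z:E|lebesgue. exp (- (Re z)\<^sup>2 - (Im z)\<^sup>2))"
proof -
  obtain c I J where c: "norm c = 1" "is_interval I" "is_interval J" and E': "E = {c * Complex x y |x y. x \<in> I \<and> y \<in> J}"
    using E unfolding rectangle_def by blast
  let ?L = "measure std_normal_distribution ((*) (sqrt 2) ` I) * measure std_normal_distribution ((*) (sqrt 2) ` J)"
  \<comment> \<open>The Gaussian itself, as a constant sequence, identifies the limit without a rotation of coordinates.\<close>
  have "(\<lambda>n::nat. measure gaussian {z \<in> space gaussian. z \<in> E}) \<longlonglongrightarrow> ?L"
    unfolding E'
    by (rule rectangle_limit_std_normal[where P = "\<lambda>_. gaussian" and Z = "\<lambda>_ z. z"])
       (use c prob_space_gaussian in \<open>auto simp only: char_gaussian tendsto_const\<close>, auto simp: gaussian_def)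
  hence "measure gaussian E = ?L" by (simp add: LIMSEQ_const_iff gaussian_def)
  moreover have "(\<lambda>n. measure (P n) {x \<in> space (P n). Z n x \<in> E}) \<longlonglongrightarrow> ?L"
    unfolding E' using assms(1-3) c by (rule rectangle_limit_std_normal)
  ultimately show ?thesis using measure_gaussian[OF rectangle_measurable[OF E]] by simp
qed

section \<open>Rademacher and Steinhaus functions\<close>

definition mult_ext :: "(nat \<Rightarrow> complex) \<Rightarrow> nat \<Rightarrow> complex" where
  "mult_ext x n = (\<Prod>p\<in>prime_factors n. x p ^ multiplicity p n)"

text \<open>Primes that do not divide n have exponent 0, so the products belonging to several
  integers can be taken over one common set of primes.\<close>

lemma mult_ext_superset:
  assumes "n \<ge> 1" "finite S" "prime_factors n \<subseteq> S" "\<And>p. p \<in> S \<Longrightarrow> prime p"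
  shows "mult_ext x n = (\<Prod>p\<in>S. x p ^ multiplicity p n)"
  unfolding mult_ext_def
proof (rule prod.mono_neutral_left[OF assms(2,3)], safe)
  fix p assume p: "p \<in> S" "p \<notin> prime_factors n"
  hence "multiplicity p n = 0"
    using assms(1) assms(4)[OF p(1)] by (intro not_dvd_imp_multiplicity_0) (auto simp: in_prime_factors_iff)
  thus "x p ^ multiplicity p n = 1" by simp
qed

lemma mult_ext_mult:
  assumes "m \<ge> 1" "n \<ge> 1"
  shows "mult_ext x (m * n) = mult_ext x m * mult_ext x n"
proof -
  let ?S = "prime_factors m \<union> prime_factors n"
  have S: "finite ?S" "\<And>p. p \<in> ?S \<Longrightarrow> prime p" by auto
  have "prime_factors (m * n) \<subseteq> ?S" using assms by (auto simp: prime_factors_product)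
  hence "mult_ext x (m * n) = (\<Prod>p\<in>?S. x p ^ multiplicity p (m * n))"
    using assms S by (intro mult_ext_superset) auto
  also have "\<dots> = (\<Prod>p\<in>?S. x p ^ multiplicity p m * x p ^ multiplicity p n)"
    using assms S(2) by (intro prod.cong refl) (simp add: prime_elem_multiplicity_mult_distrib power_add)
  also have "\<dots> = mult_ext x m * mult_ext x n"
    unfolding prod.distrib using assms S mult_ext_superset[of m ?S x] mult_ext_superset[of n ?S x] by auto
  finally show ?thesis .
qed

lemma mult_ext_flip:
  assumes "prime p" "n \<ge> 1"
  shows "mult_ext (x(p := - x p)) n = (- 1) ^ multiplicity p n * mult_ext x n"
proof -
  let ?S = "insert p (prime_factors n)"
  have S: "finite ?S" "\<And>q. q \<in> ?S \<Longrightarrow> prime q" using assms by auto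
  have 1: "mult_ext z n = z p ^ multiplicity p n * (\<Prod>q\<in>?S - {p}. z q ^ multiplicity q n)" for z
    using assms S mult_ext_superset[of n ?S z] by (subst prod.remove[of ?S p, symmetric]) auto
  have "mult_ext (x(p := - x p)) n = (- x p) ^ multiplicity p n * (\<Prod>q\<in>?S - {p}. x q ^ multiplicity q n)"
    unfolding 1[of "x(p := - x p)"] by (intro arg_cong2[of _ _ _ _ "(*)"] prod.cong) auto
  thus ?thesis unfolding 1[of x] by (simp add: power_minus[of "x p"] mult.assoc)
qed

abbreviation (input) circle_space :: "complex measure" where
  "circle_space \<equiv> restrict_space borel (sphere 0 1)"

text \<open>The flips exist only on the canonical space of sequences, to which the values at the primes are
  transported after being corrected on the null set where they do not lie on the circle.\<close>

lemma (in random_multiplicative) AE_char_int_tendsto_if_symmetric: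
  assumes norm1: "\<And>p. prime p \<Longrightarrow> AE \<omega> in M. norm (X p \<omega>) = 1"
    and sym: "\<And>p. prime p \<Longrightarrow> distr M borel (\<lambda>\<omega>. - X p \<omega>) = distr M borel (X p)"
  shows "AE \<omega> in M. \<forall>t. (\<lambda>N. char_int t (trig_poly (\<lambda>n. X n \<omega>) N)) \<longlonglongrightarrow> of_real (exp (- (norm t)\<^sup>2 / 4))"
proof -
  let ?I = "{p::nat. prime p}"
  \<comment> \<open>The default 1 is just a point of the circle, taken on a null event. It makes the
    modulus 1 at every sample point, as the flip locale demands.\<close>
  define corr where "corr z = (if norm z = 1 then z else 1)" for z :: complex
  define Y where "Y p \<omega> = corr (X p \<omega>)" for p \<omega>
  define S where "S = (\<Pi>\<^sub>M p\<in>?I. circle_space)"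
  define Yt where "Yt \<omega> = (\<lambda>p\<in>?I. Y p \<omega>)" for \<omega>
  define L where "L = distr M S Yt"
  define T where "T p x = x(p := - x p :: complex)" for p :: nat and x
  have rvX: "X p \<in> borel_measurable M" if "prime p" for p
    using indep_primes that by (auto simp: indep_vars_def)
  have corr_m: "corr \<in> measurable borel circle_space"
    unfolding corr_def by (intro measurable_restrict_space2) auto
  have neg_m: "uminus \<in> measurable circle_space circle_space"
    by (intro measurable_restrict_space2 measurable_restrict_space1) auto
  have id_m: "(\<lambda>z. z) \<in> borel_measurable circle_space" by (intro measurable_restrict_space1) auto
  have indepY: "indep_vars (\<lambda>_. circle_space) Y ?I"
    unfolding Y_def by (rule indep_vars_compose2[OF indep_primes corr_m])
  have rvY: "Y p \<in> measurable M circle_space" if "prime p" for p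
    unfolding Y_def using measurable_compose[OF rvX[OF that] corr_m] .
  have ne: "?I \<noteq> {}" using two_is_prime_nat by blast
  \<comment> \<open>Independence enters as the identity of the joint law with the product of the
    marginal laws.\<close>
  have L_eq: "L = (\<Pi>\<^sub>M p\<in>?I. distr M circle_space (Y p))"
    using indep_vars_iff_distr_eq_PiM'[OF ne, where M' = "\<lambda>_. circle_space" and X = Y] rvY indepY
    unfolding L_def S_def Yt_def[abs_def] by auto
  have Yt_m: "Yt \<in> measurable M S"
    unfolding S_def Yt_def[abs_def] using rvY by (intro measurable_restrict) auto
  interpret L: prob_space L unfolding L_def using Yt_m by (rule prob_space_distr)
  have sets_L: "sets L = sets S" "space L = space S" by (simp_all add: L_def)
  have space_S: "x \<in> space S \<Longrightarrow> prime p \<Longrightarrow> norm (x p) = 1" for x p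
    by (auto simp: S_def space_PiM space_restrict_space dest!: PiE_mem[of _ _ _ p])
  have coord: "(\<lambda>x. x p) \<in> measurable S circle_space" if "prime p" for p
    unfolding S_def using that by (intro measurable_component_singleton) auto
  have T_m: "T p \<in> measurable S S" if p: "prime p" for p
  proof -
    have "(\<lambda>x q. T p x q) \<in> measurable S (\<Pi>\<^sub>M p\<in>?I. circle_space)"
    proof (rule measurable_PiM_single')
      fix q assume "q \<in> ?I"
      thus "(\<lambda>x. T p x q) \<in> measurable S circle_space"
        using coord[of q] measurable_compose[OF coord neg_m, of q] by (cases "q = p") (auto simp: T_def)
    next
      show "(\<lambda>x q. T p x q) \<in> space S \<rightarrow> (\<Pi>\<^sub>E q\<in>?I. space circle_space)"
        using p space_S by (auto simp: T_def S_def space_PiM space_restrict_space PiE_def extensional_def Pi_def)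
    qed
    thus ?thesis by (simp add: S_def)
  qed
  \<comment> \<open>The flip acts on a single factor of the product measure, and the law of that
    factor is symmetric.\<close>
  have T_distr: "distr L S (T p) = L" if p: "prime p" for p
  proof -
    define f where "f q = (if q = p then uminus else (\<lambda>z. z) :: complex \<Rightarrow> complex)" for q
    have f_m: "f q \<in> measurable circle_space circle_space" for q using neg_m by (auto simp: f_def)
    have "indep_vars (\<lambda>_. circle_space) (\<lambda>q \<omega>. f q (Y q \<omega>)) ?I" by (rule indep_vars_compose2[OF indepY f_m])
    moreover have rv: "(\<lambda>\<omega>. f q (Y q \<omega>)) \<in> measurable M circle_space" if "prime q" for q
      by (rule measurable_compose[OF rvY[OF that] f_m])
    ultimately have "distr M S (\<lambda>\<omega>. \<lambda>q\<in>?I. f q (Y q \<omega>)) = (\<Pi>\<^sub>M q\<in>?I. distr M circle_space (\<lambda>\<omega>. f q (Y q \<omega>)))"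
      using indep_vars_iff_distr_eq_PiM'[OF ne, where M' = "\<lambda>_. circle_space" and X = "\<lambda>q \<omega>. f q (Y q \<omega>)"] unfolding S_def by auto
    also have "\<dots> = L"
      unfolding L_eq
    proof (intro PiM_cong refl)
      fix q assume q: "q \<in> ?I"
      show "distr M circle_space (\<lambda>\<omega>. f q (Y q \<omega>)) = distr M circle_space (Y q)"
      proof (cases "q = p")
        case True
        show ?thesis
        proof (rule measure_eqI)
          fix A assume "A \<in> sets (distr M circle_space (\<lambda>\<omega>. f q (Y q \<omega>)))"
          hence A': "A \<in> sets circle_space" by simp
          hence A: "A \<in> sets borel" by (auto simp: sets_restrict_space)
          have [measurable]: "X p \<in> borel_measurable M" "A \<in> sets borel" using rvX[OF p] A by auto
          have [measurable]: "Y p \<in> borel_measurable M"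
            using measurable_compose[OF rvY[OF p] id_m] by simp
          have "emeasure (distr M circle_space (\<lambda>\<omega>. f q (Y q \<omega>))) A = emeasure M {\<omega> \<in> space M. - Y p \<omega> \<in> A}"
            using q A' rv[of q] True by (subst emeasure_distr) (auto simp: f_def intro!: arg_cong[of _ _ "emeasure M"])
          also have "\<dots> = emeasure M {\<omega> \<in> space M. - X p \<omega> \<in> A}"
            using norm1[OF p] by (intro emeasure_eq_AE) (auto simp: Y_def corr_def)
          also have "\<dots> = emeasure (distr M borel (\<lambda>\<omega>. - X p \<omega>)) A"
            by (subst emeasure_distr) (auto intro!: arg_cong[of _ _ "emeasure M"])
          also have "\<dots> = emeasure M {\<omega> \<in> space M. X p \<omega> \<in> A}"
            unfolding sym[OF p] by (subst emeasure_distr) (auto intro!: arg_cong[of _ _ "emeasure M"])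
          also have "\<dots> = emeasure M {\<omega> \<in> space M. Y p \<omega> \<in> A}"
            using norm1[OF p] by (intro emeasure_eq_AE) (auto simp: Y_def corr_def)
          also have "\<dots> = emeasure (distr M circle_space (Y q)) A"
            using q A' rvY[of q] True by (subst emeasure_distr) (auto intro!: arg_cong[of _ _ "emeasure M"])
          finally show "emeasure (distr M circle_space (\<lambda>\<omega>. f q (Y q \<omega>))) A = emeasure (distr M circle_space (Y q)) A" .
        qed simp
      qed (simp add: f_def)
    qed
    also have "(\<lambda>\<omega>. \<lambda>q\<in>?I. f q (Y q \<omega>)) = T p \<circ> Yt"
      using p by (auto simp: fun_eq_iff T_def Yt_def f_def)
    finally have "distr M S (T p \<circ> Yt) = L" .
    thus ?thesis unfolding L_def using distr_distr[OF T_m[OF p] Yt_m] by simp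
  qed
  have "symmetric_multiplicative L (\<lambda>n x. mult_ext x n) T"
  proof
    fix n
    show "(\<lambda>x. mult_ext x n) \<in> borel_measurable L"
    proof -
      have "(\<lambda>x. x p) \<in> borel_measurable L" if "prime p" for p
        using measurable_compose[OF coord[OF that] id_m] by (simp add: measurable_cong_sets[OF sets_L(1)])
      thus ?thesis unfolding mult_ext_def by (intro borel_measurable_prod borel_measurable_power) auto
    qed
  next
    fix n x assume "x \<in> space L"
    hence "norm (x p) = 1" if "prime p" for p using space_S that by (simp add: sets_L)
    thus "norm (mult_ext x n) = 1"
      unfolding mult_ext_def prod_norm[symmetric] by (intro prod.neutral) (auto simp: norm_power in_prime_factors_imp_prime)
  next
    fix p :: nat assume p: "prime p"
    show "T p \<in> measurable L L"
      using T_m[OF p] by (simp add: measurable_cong_sets[OF sets_L(1) sets_L(1)])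
    have "distr L L (T p) = distr L S (T p)" by (rule distr_cong) (auto simp: sets_L)
    thus "distr L L (T p) = L" using T_distr[OF p] by simp
    fix n :: nat and x assume "n \<ge> 1"
    thus "mult_ext (T p x) n = (- 1) ^ multiplicity p n * mult_ext x n"
      unfolding T_def by (rule mult_ext_flip[OF p])
  qed (simp add: mult_ext_mult)
  then interpret C: symmetric_multiplicative L "\<lambda>n x. mult_ext x n" T .
  have "AE \<omega> in M. \<forall>t. (\<lambda>N. char_int t (trig_poly (\<lambda>n. mult_ext (Yt \<omega>) n) N)) \<longlonglongrightarrow> of_real (exp (- (norm t)\<^sup>2 / 4))"
    using AE_distrD[OF Yt_m] C.AE_char_int_trig_poly_tendsto unfolding L_def by blast
  moreover have "AE \<omega> in M. \<forall>p\<in>?I. norm (X p \<omega>) = 1"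
    using norm1 by (subst AE_ball_countable) auto
  ultimately show ?thesis
    using AE_space[of M]
  proof eventually_elim
    case (elim \<omega>)
    \<comment> \<open>Agreement for n \<ge> 1 is enough, because \<open>trig_poly\<close> sums from
      1 on.\<close>
    have "mult_ext (Yt \<omega>) n = X n \<omega>" if "n \<ge> 1" for n
      unfolding multiplicative[OF that elim(3)] mult_ext_def
      using elim(2) by (intro prod.cong refl) (auto simp: Yt_def Y_def corr_def)
    hence "trig_poly (\<lambda>n. mult_ext (Yt \<omega>) n) N = trig_poly (\<lambda>n. X n \<omega>) N" for N
      unfolding trig_poly_def fun_eq_iff by (auto intro!: sum.cong)
    thus ?case using elim(1) by simp
  qed
qed

text \<open>The two atoms exhaust the total mass, and negation exchanges them; they carry equal
  weight.\<close>

lemma (in rademacher_multiplicative) rademacher_sign: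
  assumes p: "prime p"
  shows "AE \<omega> in M. X p \<omega> = 1 \<or> X p \<omega> = - 1"
    and "distr M borel (\<lambda>\<omega>. - X p \<omega>) = distr M borel (X p)"
proof -
  have [measurable]: "X p \<in> borel_measurable M"
    using indep_primes p by (auto simp: indep_vars_def)
  let ?P = "{\<omega> \<in> space M. X p \<omega> = 1}" and ?N = "{\<omega> \<in> space M. X p \<omega> = - 1}"
  have disj: "?P \<inter> ?N = {}" by auto
  have "prob (?P \<union> ?N) = 1"
    using finite_measure_Union[OF _ _ disj] prob_pos[OF p] prob_neg[OF p] by simp
  hence AE: "AE \<omega> in M. \<omega> \<in> ?P \<union> ?N" by (subst (asm) prob_eq_1) auto
  thus "AE \<omega> in M. X p \<omega> = 1 \<or> X p \<omega> = - 1" by eventually_elim auto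
  have law: "prob {\<omega> \<in> space M. s * X p \<omega> \<in> A} = (if s \<in> A then 1/2 else 0) + (if - s \<in> A then 1/2 else 0)"
    if [measurable]: "A \<in> sets borel" for A s
  proof -
    have "prob {\<omega> \<in> space M. s * X p \<omega> \<in> A} = prob ((if s \<in> A then ?P else {}) \<union> (if - s \<in> A then ?N else {}))"
      using AE by (intro finite_measure_eq_AE) (auto elim!: eventually_mono)
    also have "\<dots> = prob (if s \<in> A then ?P else {}) + prob (if - s \<in> A then ?N else {})"
      using disj by (intro finite_measure_Union) auto
    finally show ?thesis using prob_pos[OF p] prob_neg[OF p] by auto
  qed
  show "distr M borel (\<lambda>\<omega>. - X p \<omega>) = distr M borel (X p)"
  proof (rule measure_eqI)
    fix A assume "A \<in> sets (distr M borel (\<lambda>\<omega>. - X p \<omega>))"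
    hence A [measurable]: "A \<in> sets borel" by simp
    have "prob {\<omega> \<in> space M. - X p \<omega> \<in> A} = prob {\<omega> \<in> space M. X p \<omega> \<in> A}"
      using law[OF A, of "- 1"] law[OF A, of 1] by simp
    thus "emeasure (distr M borel (\<lambda>\<omega>. - X p \<omega>)) A = emeasure (distr M borel (X p)) A"
      by (simp add: emeasure_distr emeasure_eq_measure vimage_def Int_def conj_commute)
  qed simp
qed

lemma e_exp_half: "e_exp (x + 1/2) = - e_exp x" "e_exp (x - 1/2) = - e_exp x"
  by (simp_all add: e_exp_eq_cis cis_mult[symmetric] cis_divide[symmetric] distrib_left right_diff_distrib)

text \<open>Negation is rotation by half a turn, which in the variable \<theta> exchanges the two
  halves of the unit interval. Splitting into half-open halves allows ordinary translations of
  Lebesgue measure instead of addition modulo 1; the endpoint 1 is null.\<close>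

lemma uniform_circle_symmetric: "distr uniform_circle borel uminus = uniform_circle"
proof (rule measure_eqI)
  fix A assume "A \<in> sets (distr uniform_circle borel uminus)"
  hence [measurable]: "A \<in> sets borel" by simp
  have split: "emeasure unit_uniform B = emeasure lborel (B \<inter> {0..<1/2}) + emeasure lborel (B \<inter> {1/2..<1})"
    if [measurable]: "B \<in> sets borel" for B :: "real set"
  proof -
    have "emeasure unit_uniform B = emeasure lborel ({0..1} \<inter> B)"
      by (simp add: emeasure_uniform_measure divide_ennreal_def)
    also have "\<dots> = emeasure lborel ((B \<inter> {0..<1/2}) \<union> (B \<inter> {1/2..<1}))"
      by (intro emeasure_eq_AE) (use AE_lborel_singleton[of 1] in \<open>auto elim!: eventually_mono\<close>)
    also have "\<dots> = emeasure lborel (B \<inter> {0..<1/2}) + emeasure lborel (B \<inter> {1/2..<1})"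
      by (rule plus_emeasure[symmetric]) auto
    finally show ?thesis .
  qed
  have shift: "emeasure lborel ((+) c -` B) = emeasure lborel B" if "B \<in> sets borel" for B and c :: real
    using that emeasure_distr[of "(+) c" lborel borel B] by (simp add: lborel_distr_plus)
  let ?B = "e_exp -` A" and ?B' = "(\<lambda>\<theta>. - e_exp \<theta>) -` A"
  have B [measurable]: "?B \<in> sets borel" "?B' \<in> sets borel"
    using measurable_sets[of e_exp borel borel A] measurable_sets[of "\<lambda>\<theta>. - e_exp \<theta>" borel borel A] by simp_all
  have s1: "?B' \<inter> {0..<1/2} = (+) (1/2) -` (?B \<inter> {1/2..<1})"
    using e_exp_half(1) by (auto simp: add.commute[of "1/2"])
  have s2: "?B' \<inter> {1/2..<1} = (+) (- (1/2)) -` (?B \<inter> {0..<1/2})"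
    using e_exp_half(2) by (auto simp: add.commute[of "- (1/2)"])
  have "emeasure (distr uniform_circle borel uminus) A = emeasure unit_uniform ?B'"
    unfolding uniform_circle_def by (subst distr_distr) (auto simp: emeasure_distr o_def)
  also have "\<dots> = emeasure lborel (?B \<inter> {1/2..<1}) + emeasure lborel (?B \<inter> {0..<1/2})"
    unfolding split[OF B(2)] s1 s2 by (subst (1 2) shift) auto
  also have "\<dots> = emeasure unit_uniform ?B" unfolding split[OF B(1)] by (rule add.commute)
  also have "\<dots> = emeasure uniform_circle A" unfolding uniform_circle_def by (simp add: emeasure_distr)
  finally show "emeasure (distr uniform_circle borel uminus) A = emeasure uniform_circle A" .
qed (simp add: uniform_circle_def)

lemma (in steinhaus_multiplicative) steinhaus_circle:
  assumes p: "prime p"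
  shows "AE \<omega> in M. norm (X p \<omega>) = 1"
    and "distr M borel (\<lambda>\<omega>. - X p \<omega>) = distr M borel (X p)"
proof -
  have X [measurable]: "X p \<in> borel_measurable M"
    using indep_primes p by (auto simp: indep_vars_def)
  have "AE z in distr M borel (X p). norm z = 1"
    unfolding distr_prime[OF p] uniform_circle_def by (subst AE_distr_iff) auto
  thus "AE \<omega> in M. norm (X p \<omega>) = 1" by (rule AE_distrD[OF X])
  have "distr M borel (\<lambda>\<omega>. - X p \<omega>) = distr (distr M borel (X p)) borel uminus"
    by (subst distr_distr) (auto simp: o_def)
  thus "distr M borel (\<lambda>\<omega>. - X p \<omega>) = distr M borel (X p)"
    by (simp add: distr_prime[OF p] uniform_circle_symmetric)
qed

theorem theorem1p2:
  fixes M :: "'a measure" and X :: "nat \<Rightarrow> 'a \<Rightarrow> complex"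
  assumes "rademacher_multiplicative M X \<or> steinhaus_multiplicative M X"
  shows "AE \<omega> in M. \<forall>E. rectangle E \<longrightarrow>
    (\<lambda>N. measure lebesgue {\<theta> \<in> {0..1}. trig_poly (\<lambda>n. X n \<omega>) N \<theta> \<in> E})
      \<longlonglongrightarrow> 1 / pi * (LINT z:E|lebesgue. exp (- (Re z)\<^sup>2 - (Im z)\<^sup>2))"
proof -
  have "AE \<omega> in M. \<forall>t. (\<lambda>N. char_int t (trig_poly (\<lambda>n. X n \<omega>) N)) \<longlonglongrightarrow> of_real (exp (- (norm t)\<^sup>2 / 4))"
    using assms
  proof
    assume "rademacher_multiplicative M X"
    then interpret rademacher_multiplicative M X .
    have "AE \<omega> in M. norm (X p \<omega>) = 1" if "prime p" for p
      using rademacher_sign(1)[OF that] by eventually_elim auto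
    thus ?thesis by (intro AE_char_int_tendsto_if_symmetric rademacher_sign(2))
  next
    assume "steinhaus_multiplicative M X"
    then interpret steinhaus_multiplicative M X .
    show ?thesis by (intro AE_char_int_tendsto_if_symmetric steinhaus_circle)
  qed
  \<comment> \<open>The exceptional event is fixed by the characteristic functions alone. The rest
    is deterministic, so a single null set serves every rectangle.\<close>
  thus ?thesis
  proof eventually_elim
    case (elim \<omega>)
    show ?case
    proof (intro allI impI)
      fix E assume E: "rectangle E"
      let ?f = "\<lambda>N. trig_poly (\<lambda>n. X n \<omega>) N"
      have f [measurable]: "?f N \<in> borel_measurable borel" for N
        by (intro borel_measurable_continuous_onI continuous_intros)
      have "(\<lambda>N. measure unit_uniform {\<theta> \<in> space unit_uniform. ?f N \<theta> \<in> E})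
          \<longlonglongrightarrow> 1 / pi * (LINT z:E|lebesgue. exp (- (Re z)\<^sup>2 - (Im z)\<^sup>2))"
        using elim unfolding char_int_def
        by (intro rectangle_limit_gaussian[OF unit_uniform.prob_space_axioms _ _ E]) auto
      moreover have "measure unit_uniform {\<theta> \<in> space unit_uniform. ?f N \<theta> \<in> E} = measure lebesgue {\<theta> \<in> {0..1}. ?f N \<theta> \<in> E}" for N
      proof -
        have [measurable]: "E \<in> sets borel" by (rule rectangle_measurable[OF E])
        have "{\<theta>. ?f N \<theta> \<in> E} \<in> sets borel" "{\<theta> \<in> {0..1}. ?f N \<theta> \<in> E} \<in> sets borel" by measurable
        moreover have "{0..1} \<inter> {\<theta>. ?f N \<theta> \<in> E} = {\<theta> \<in> {0..1}. ?f N \<theta> \<in> E}" by auto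
        ultimately show ?thesis by simp
      qed
      ultimately show "(\<lambda>N. measure lebesgue {\<theta> \<in> {0..1}. ?f N \<theta> \<in> E})
          \<longlonglongrightarrow> 1 / pi * (LINT z:E|lebesgue. exp (- (Re z)\<^sup>2 - (Im z)\<^sup>2))" by simp
    qed
  qed
qed

end
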